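(* Let $p\ge 2$, let $u,v\ge 0$ be integers, let $\psi=(\psi_{ij})$ be a smooth symmetric $2$-tensor field on $\mathbb{R}^p$, and let $(N,g_N):=(M,g_\psi)\times\mathbb{R}^{(u,v)}$ be the isometric product pseudo-Riemannian manifold, of signature $(\bar p,\bar q):=(p+u,p+v)$, where $(M,g_\psi)$ is defined in the context. Then: (1) $(N,g_N)$ is $k$ Osserman for every admissible $k$, i.e. for every integer $k$ with $1\le k\le \bar p+\bar q-1$. (2) If $\psi\in\Psi$ (see context), then: (a) $(N,g_N)$ is Jordan Osserman (i) of types $(r,0)$ and $(\bar p-r,\bar q)$ if $u=0$ and $0<r\le p$; (ii) of types $(0,s)$ and $(\bar p,\bar q-s)$ if $v=0$ and $0<s\le p$; (iii) of types $(r,0)$ and $(\bar p-r,\bar q)$ if $u>0$ and $u+2\le r\le\bar p$; (iv) of types $(0,s)$ and $(\bar p,\bar q-s)$ if $v>0$ and $v+2\le s\le\bar q$. (b) $(N,g_N)$ is not Jordan Osserman of type $(r,s)$ for any admissible $(r,s)$ that is not one of the types listed in (a)(i)--(iv).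
   Context: Conventions. A pseudo-Riemannian manifold of signature $(p,q)$ has a metric $(\cdot,\cdot)=g$ with $p$ negative (timelike) and $q$ positive (spacelike) directions; $m=p+q$ is its dimension. $\mathbb{R}^{(u,v)}$ is $\mathbb{R}^{u+v}$ with the usual flat inner product of signature $(u,v)$. The curvature operator of the Levi-Civita connection is $R(Z_1,Z_2)=\nabla_{Z_1}\nabla_{Z_2}-\nabla_{Z_2}\nabla_{Z_1}-\nabla_{[Z_1,Z_2]}$, and the Jacobi operator is $J(X):Y\mapsto R(Y,X)X$, a self-adjoint operator on each tangent space. Higher order Jacobi operator. A pair of integers $(r,s)$ is admissible for signature $(p,q)$ if $0\le r\le p$, $0\le s\le q$ and $1\le r+s\le m-1$ (for $N$, use $(\bar p,\bar q)$ in place of $(p,q)$). $\mathrm{Gr}_{r,s}(M,g)$ is the bundle over $M$ of all non-degenerate subspaces of signature $(r,s)$ ($r$ timelike and $s$ spacelike directions) of the tangent spaces of $M$. For $\pi\in\mathrm{Gr}_{r,s}(M,g)$ with orthonormal basis $\{e_1,\dots,e_{r+s}\}$ put $J(\pi):=\sum_{i=1}^{r+s}(e_i,e_i)J(e_i)$; this does not depend on the orthonormal basis. Osserman conditions. $(M,g)$ is Osserman of type $(r,s)$ if the eigenvalues of $J(\pi)$ are constant as $\pi$ ranges over the whole bundle $\mathrm{Gr}_{r,s}(M,g)$. $(M,g)$ is Jordan Osserman of type $(r,s)$ if the Jordan normal form (conjugacy class) of $J(\pi)$ is constant as $\pi$ ranges over $\mathrm{Gr}_{r,s}(M,g)$.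 $(M,g)$ is $k$ Osserman if it is Osserman of type $(r,s)$ for all admissible $(r,s)$ with $r+s=k$ or $r+s=m-k$ (it is known that this holds for all such $(r,s)$ as soon as it holds for one). The manifold $(M,g_\psi)$. Let $M=\mathbb{R}^{2p}$ with coordinates $(x,y)=(x_1,\dots,x_p,y_1,\dots,y_p)$, coordinate vector fields $\partial_i^x,\partial_i^y$, and $\mathcal{X}=\mathrm{span}\{\partial_i^x\}_{1\le i\le p}$. For a smooth symmetric $2$-tensor $\psi$ on $\mathbb{R}^p$ with components $\psi_{ij}(x)=\psi(\partial_i^x,\partial_j^x)$, the metric $g_\psi$ of signature $(p,p)$ is given by $$g_\psi(\partial_i^x,\partial_j^y)=\delta_{ij},\quad g_\psi(\partial_i^y,\partial_j^y)=0,\quad g_\psi(\partial_i^x,\partial_j^x)=\psi_{ij}(x).$$ The set $\Psi$. A self-adjoint operator $A$ is called positive semi-definite if the form $(Z_1,Z_2)\mapsto (AZ_1,Z_2)$ is positive semi-definite. $\Psi$ is the set of all smooth symmetric $2$-tensor fields $\psi$ on $\mathbb{R}^p$ such that, at every point of $(M,g_\psi)$, the Jacobi operator $J(X)$ of $(M,g_\psi)$ is positive semi-definite of rank $p-1$ for every nonzero $X\in\mathcal{X}$. *)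

theory Defs
  imports
    "HOL-Analysis.Abstract_Euclidean_Space"
    "HOL-Analysis.Derivative"
    "HOL-Computational_Algebra.Polynomial"
    "Jordan_Normal_Form.Jordan_Normal_Form"
    "Jordan_Normal_Form.DL_Rank"
    "Jordan_Normal_Form.Gauss_Jordan_Elimination"
begin

text \<open>
  All manifolds are \<open>\<real>\<^sup>n\<close> with its global chart. A point is an element of
  \<open>topspace (Euclidean_space n)\<close>, i.e. a function \<open>nat \<Rightarrow> real\<close> vanishing from index \<open>n\<close> on
  (coordinates are numbered from 0; \<open>n = 0\<close> is allowed). A tangent vector is an element of
  \<open>carrier_vec n\<close>, namely its components in the coordinate frame, an endomorphism of a tangent
  space is an \<open>n \<times> n\<close> matrix, and a metric is its field of Gram matrices in the coordinate frame.
\<close>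

type_synonym point = "nat \<Rightarrow> real"
type_synonym vfield = "point \<Rightarrow> real vec"
type_synonym metric = "point \<Rightarrow> real mat"

subsection \<open>Smooth functions\<close>

definition partial :: "nat \<Rightarrow> (point \<Rightarrow> real) \<Rightarrow> point \<Rightarrow> real" where
  "partial i f x = deriv (\<lambda>t. f (x(i := t))) (x i)"

primrec C_upto :: "nat \<Rightarrow> nat \<Rightarrow> (point \<Rightarrow> real) \<Rightarrow> bool" where
  "C_upto n 0 f \<longleftrightarrow> continuous_map (Euclidean_space n) euclideanreal f"
| "C_upto n (Suc k) f \<longleftrightarrow>
     continuous_map (Euclidean_space n) euclideanreal f \<and>
     (\<forall>i<n. (\<forall>x\<in>topspace (Euclidean_space n). (\<lambda>t. f (x(i := t))) differentiable (at (x i))) \<and>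
            C_upto n k (partial i f))"

definition smooth :: "nat \<Rightarrow> (point \<Rightarrow> real) \<Rightarrow> bool" where
  "smooth n f \<longleftrightarrow> (\<forall>k. C_upto n k f)"

subsection \<open>Levi-Civita connection and curvature\<close>

text \<open>The Koszul formula for coordinate vector fields:
  \<open>\<nabla>\<^bsub>\<partial>i\<^esub> \<partial>j = (\<Sum>k<n. christoffel n g i j k \<cdot> \<partial>k)\<close>.\<close>

definition christoffel :: "nat \<Rightarrow> metric \<Rightarrow> nat \<Rightarrow> nat \<Rightarrow> nat \<Rightarrow> point \<Rightarrow> real" where
  "christoffel n g i j k x =
     (\<Sum>l<n. the (mat_inverse (g x)) $$ (k, l) *
        (partial i (\<lambda>z. g z $$ (j, l)) x + partial j (\<lambda>z. g z $$ (i, l)) x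
         - partial l (\<lambda>z. g z $$ (i, j)) x)) / 2"

definition nabla :: "nat \<Rightarrow> metric \<Rightarrow> vfield \<Rightarrow> vfield \<Rightarrow> vfield" where
  "nabla n g X Y x = vec n (\<lambda>k. \<Sum>i<n. X x $ i *
     (partial i (\<lambda>z. Y z $ k) x + (\<Sum>j<n. christoffel n g i j k x * Y x $ j)))"

definition lie_bracket :: "nat \<Rightarrow> vfield \<Rightarrow> vfield \<Rightarrow> vfield" where
  "lie_bracket n X Y x = vec n (\<lambda>k. \<Sum>i<n.
     X x $ i * partial i (\<lambda>z. Y z $ k) x - Y x $ i * partial i (\<lambda>z. X z $ k) x)"

definition curvature :: "nat \<Rightarrow> metric \<Rightarrow> vfield \<Rightarrow> vfield \<Rightarrow> vfield \<Rightarrow> vfield" where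
  "curvature n g Z1 Z2 Z x =
     nabla n g Z1 (nabla n g Z2 Z) x - nabla n g Z2 (nabla n g Z1 Z) x
     - nabla n g (lie_bracket n Z1 Z2) Z x"

text \<open>The matrix of \<open>J(v) : w \<mapsto> R(w,v)v\<close> at \<open>x\<close>. The curvature is a tensor, so tangent vectors
  may be extended to vector fields arbitrarily; they are extended with constant components.\<close>

definition jacobi :: "nat \<Rightarrow> metric \<Rightarrow> point \<Rightarrow> real vec \<Rightarrow> real mat" where
  "jacobi n g x v = mat n n (\<lambda>(i, j).
     curvature n g (\<lambda>_. unit_vec n j) (\<lambda>_. v) (\<lambda>_. v) x $ i)"

subsection \<open>Higher order Jacobi operator and Osserman conditions\<close>

definition gip :: "real mat \<Rightarrow> real vec \<Rightarrow> real vec \<Rightarrow> real" where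
  "gip G v w = v \<bullet> (G *\<^sub>v w)"

text \<open>Linear independence of an orthonormal basis follows from the orthogonality relations.\<close>

definition orthonormal_basis :: "nat \<Rightarrow> real mat \<Rightarrow> real vec set \<Rightarrow> real vec list \<Rightarrow> bool" where
  "orthonormal_basis n G \<pi> es \<longleftrightarrow>
     set es \<subseteq> carrier_vec n \<and>
     LinearCombinations.module.span class_ring (module_vec TYPE(real) n) (set es) = \<pi> \<and>
     (\<forall>i<length es. gip G (es ! i) (es ! i) \<in> {-1, 1}) \<and>
     (\<forall>i<length es. \<forall>j<length es. i \<noteq> j \<longrightarrow> gip G (es ! i) (es ! j) = 0)"

text \<open>The non-degenerate subspaces with \<open>r\<close> timelike and \<open>s\<close> spacelike directions.\<close>

definition Gr :: "nat \<Rightarrow> real mat \<Rightarrow> nat \<Rightarrow> nat \<Rightarrow> real vec set set" where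
  "Gr n G r s = {\<pi>. \<exists>es. orthonormal_basis n G \<pi> es \<and>
     length (filter (\<lambda>e. gip G e e = -1) es) = r \<and>
     length (filter (\<lambda>e. gip G e e = 1) es) = s}"

text \<open>The result does not depend on the orthonormal basis that is chosen.\<close>

definition jacobi_sub :: "nat \<Rightarrow> metric \<Rightarrow> point \<Rightarrow> real vec set \<Rightarrow> real mat" where
  "jacobi_sub n g x \<pi> =
     (let es = (SOME es. orthonormal_basis n (g x) \<pi> es)
      in mat n n (\<lambda>(i, j). \<Sum>e\<leftarrow>es. gip (g x) e e * jacobi n g x e $$ (i, j)))"

text \<open>Complex eigenvalues, counted with algebraic multiplicity.\<close>

definition eigenvalues_of :: "real mat \<Rightarrow> complex multiset" where
  "eigenvalues_of A = proots (char_poly (map_mat complex_of_real A))"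

definition osserman :: "nat \<Rightarrow> metric \<Rightarrow> nat \<Rightarrow> nat \<Rightarrow> bool" where
  "osserman n g r s \<longleftrightarrow>
     (\<forall>x\<in>topspace (Euclidean_space n). \<forall>x'\<in>topspace (Euclidean_space n).
      \<forall>\<pi>\<in>Gr n (g x) r s. \<forall>\<pi>'\<in>Gr n (g x') r s.
        eigenvalues_of (jacobi_sub n g x \<pi>) = eigenvalues_of (jacobi_sub n g x' \<pi>'))"

definition jordan_osserman :: "nat \<Rightarrow> metric \<Rightarrow> nat \<Rightarrow> nat \<Rightarrow> bool" where
  "jordan_osserman n g r s \<longleftrightarrow>
     (\<forall>x\<in>topspace (Euclidean_space n). \<forall>x'\<in>topspace (Euclidean_space n).
      \<forall>\<pi>\<in>Gr n (g x) r s. \<forall>\<pi>'\<in>Gr n (g x') r s.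
        similar_mat (jacobi_sub n g x \<pi>) (jacobi_sub n g x' \<pi>'))"

text \<open>Here and in \<open>k_osserman\<close>, \<open>(a, b)\<close> is the signature of the metric, so its dimension
  is \<open>a + b\<close>.\<close>

definition admissible :: "nat \<Rightarrow> nat \<Rightarrow> nat \<Rightarrow> nat \<Rightarrow> bool" where
  "admissible a b r s \<longleftrightarrow> r \<le> a \<and> s \<le> b \<and> 1 \<le> r + s \<and> r + s \<le> a + b - 1"

definition k_osserman :: "nat \<Rightarrow> nat \<Rightarrow> metric \<Rightarrow> nat \<Rightarrow> bool" where
  "k_osserman a b g k \<longleftrightarrow>
     (\<forall>r s. admissible a b r s \<and> (r + s = k \<or> r + s = a + b - k) \<longrightarrow> osserman (a + b) g r s)"

subsection \<open>The manifolds\<close>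

definition smooth_symmetric_tensor :: "nat \<Rightarrow> metric \<Rightarrow> bool" where
  "smooth_symmetric_tensor p \<psi> \<longleftrightarrow>
     (\<forall>x\<in>topspace (Euclidean_space p). \<psi> x \<in> carrier_mat p p \<and> transpose_mat (\<psi> x) = \<psi> x) \<and>
     (\<forall>i<p. \<forall>j<p. smooth p (\<lambda>x. \<psi> x $$ (i, j)))"

definition first_coords :: "nat \<Rightarrow> point \<Rightarrow> point" where
  "first_coords m z = (\<lambda>i. if i < m then z i else 0)"

text \<open>The coordinates on \<open>\<real>\<^sup>2\<^sup>p\<close> are \<open>x\<^sub>1, \<dots>, x\<^sub>p, y\<^sub>1, \<dots>, y\<^sub>p\<close>, in this order.\<close>

definition g_psi :: "nat \<Rightarrow> metric \<Rightarrow> metric" where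
  "g_psi p \<psi> z = four_block_mat (\<psi> (first_coords p z)) (1\<^sub>m p) (1\<^sub>m p) (0\<^sub>m p p)"

text \<open>The first \<open>u\<close> coordinates are timelike.\<close>

definition flat_metric :: "nat \<Rightarrow> nat \<Rightarrow> metric" where
  "flat_metric u v z =
     mat (u + v) (u + v) (\<lambda>(i, j). if i \<noteq> j then 0 else if i < u then -1 else 1)"

definition product_metric :: "nat \<Rightarrow> metric \<Rightarrow> nat \<Rightarrow> metric \<Rightarrow> metric" where
  "product_metric m g n h z =
     four_block_mat (g (first_coords m z)) (0\<^sub>m m n) (0\<^sub>m n m) (h (\<lambda>i. z (m + i)))"

definition g_N :: "nat \<Rightarrow> metric \<Rightarrow> nat \<Rightarrow> nat \<Rightarrow> metric" where
  "g_N p \<psi> u v = product_metric (2 * p) (g_psi p \<psi>) (u + v) (flat_metric u v)"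

subsection \<open>The set \<open>\<Psi>\<close>\<close>

text \<open>To be applied to self-adjoint operators \<open>A\<close> only (as are all Jacobi operators).\<close>

definition pos_semidef_op :: "nat \<Rightarrow> real mat \<Rightarrow> real mat \<Rightarrow> bool" where
  "pos_semidef_op n G A \<longleftrightarrow> (\<forall>Z\<in>carrier_vec n. 0 \<le> gip G (A *\<^sub>v Z) Z)"

text \<open>The span of the coordinate vector fields \<open>\<partial>\<^sub>i\<^sup>x\<close>.\<close>

definition X_space :: "nat \<Rightarrow> real vec set" where
  "X_space p = {a @\<^sub>v 0\<^sub>v p | a. a \<in> carrier_vec p}"

definition Psi :: "nat \<Rightarrow> metric set" where
  "Psi p = {\<psi>. smooth_symmetric_tensor p \<psi> \<and>
     (\<forall>x\<in>topspace (Euclidean_space (2 * p)). \<forall>X\<in>X_space p. X \<noteq> 0\<^sub>v (2 * p) \<longrightarrow>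
        pos_semidef_op (2 * p) (g_psi p \<psi> x) (jacobi (2 * p) (g_psi p \<psi>) x X) \<and>
        vec_space.rank (2 * p) (jacobi (2 * p) (g_psi p \<psi>) x X) = p - 1)}"

subsection \<open>The exceptional types\<close>

definition listed_types :: "nat \<Rightarrow> nat \<Rightarrow> nat \<Rightarrow> (nat \<times> nat) set" where
  "listed_types p u v =
     {t. \<exists>r. u = 0 \<and> 0 < r \<and> r \<le> p \<and> (t = (r, 0) \<or> t = (p + u - r, p + v))} \<union>
     {t. \<exists>s. v = 0 \<and> 0 < s \<and> s \<le> p \<and> (t = (0, s) \<or> t = (p + u, p + v - s))} \<union>
     {t. \<exists>r. u > 0 \<and> u + 2 \<le> r \<and> r \<le> p + u \<and> (t = (r, 0) \<or> t = (p + u - r, p + v))} \<union>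
     {t. \<exists>s. v > 0 \<and> v + 2 \<le> s \<and> s \<le> p + v \<and> (t = (0, s) \<or> t = (p + u, p + v - s))}"

end

theory Submission
  imports Defs
begin

text \<open>
  Why the theorem holds. The inverse of \<open>g\<^sub>\<psi>\<close> has no \<open>xx\<close>-entries and \<open>\<psi>\<close> depends on \<open>x\<close>
  only. Therefore the only Christoffel symbols that survive have two lower \<open>x\<close>-indices and an upper
  \<open>y\<close>-index and are functions of \<open>x\<close>; the curvature sees only the \<open>x\<close>-components of its arguments
  and takes values in the span of the \<open>\<partial>\<^sup>y\<close>. In coordinates the Jacobi operator of a vector with
  \<open>x\<close>-part \<open>c\<close> is thus strictly lower triangular with a single nonzero block \<open>S(c)\<close>, of size
  \<open>p \<times> p\<close> and quadratic in \<open>c\<close> (\<open>jacobi_g_N\<close>; the block is \<open>jac_form\<close> and the matrix built from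
  it is \<open>lower_block\<close>). The same holds for every higher order Jacobi operator, with block
  \<open>S(\<pi>) = \<Sum> \<epsilon>\<^sub>i S(c\<^sub>i)\<close>, where the \<open>c\<^sub>i\<close> are the \<open>x\<close>-parts of an orthonormal basis of \<open>\<pi>\<close>
  (\<open>jacobi_sub_eq\<close>). Such operators are nilpotent, so that all eigenvalues vanish
  (\<open>osserman_g_N\<close>), and equivalent blocks give similar operators (\<open>lower_block_similar\<close>): only the
  rank of the block matters for the Jordan form.

  Let \<open>\<psi> \<in> \<Psi>\<close>. Each \<open>S(c)\<close> with \<open>c \<noteq> 0\<close> is symmetric (here second partial derivatives have to
  commute), positive semidefinite, and its kernel is exactly the line through \<open>c\<close>. If \<open>\<pi>\<close> is
  definite, \<open>\<plusminus> S(\<pi>)\<close> is a sum of such forms, so its rank is \<open>0\<close>, \<open>p - 1\<close> or \<open>p\<close> according to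
  whether the \<open>x\<close>-parts of \<open>\<pi>\<close> span a space of dimension \<open>0\<close>, \<open>1\<close> or at least \<open>2\<close>. Vectors of
  \<open>\<pi>\<close> with vanishing \<open>x\<close>-part are measured by the flat factor alone, so counting equations shows
  that this dimension is at least \<open>2\<close> as soon as \<open>dim \<pi>\<close> exceeds the number of flat directions of
  the same sign by two or more, and that it equals \<open>1\<close> when \<open>\<pi>\<close> is a line and there are no such
  directions. These are the listed definite types (\<open>jordan_osserman_definite\<close>). For the
  complementary types one adds up an orthonormal basis of the whole tangent space: the sum of the
  \<open>\<epsilon>\<^sub>i e\<^sub>i \<otimes> e\<^sub>i\<close> is the inverse metric, whose \<open>xx\<close>-entries vanish, hence \<open>S(\<pi>\<^sup>\<bottom>) = - S(\<pi>)\<close>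
  (\<open>orthonormal_complement\<close>, \<open>jordan_osserman_codefinite\<close>).

  For the remaining types two subspaces with blocks of different rank are exhibited, spanned by flat
  coordinate vectors and by vectors \<open>e\<^sub>i\<^sup>\<plusminus>\<close> of norm \<open>\<plusminus>1\<close> which both have \<open>x\<close>-part
  \<open>t\<^sub>i \<partial>\<^sub>i\<^sup>x\<close> with a free parameter \<open>t\<^sub>i > 0\<close> (\<open>config_exists\<close>). In the definite case one takes
  \<open>k\<close> or \<open>k + 1\<close> coordinate axes with \<open>k \<le> 1\<close>, and the rank jumps. In the mixed case the block can
  be made zero as well as nonzero, or it can be brought to the form \<open>\<plusminus>(P - t Q)\<close> with \<open>P\<close> positive definite and
  \<open>Q \<noteq> 0\<close> positive semidefinite; the latter is singular when \<open>t\<close> is the least value of the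
  Rayleigh quotient of \<open>P\<close> by \<open>Q\<close>, and regular when \<open>t\<close> is half of it
  (\<open>definite_pencil_degenerates\<close>).
\<close>

section \<open>Mixed second partial derivatives\<close>

text \<open>The mean value theorem, applied in the first variable to the difference in the second variable and
  then in the second variable. As the second difference is symmetric in the two variables, it is
  compared with both mixed derivatives.\<close>

lemma second_difference_mean_value:
  fixes F Fs Fst :: "real \<Rightarrow> real \<Rightarrow> real"
  assumes 1: "\<And>s t. ((\<lambda>s. F s t) has_real_derivative Fs s t) (at s)"
    and 12: "\<And>s t. ((\<lambda>t. Fs s t) has_real_derivative Fst s t) (at t)"
    and h: "h > 0"
  shows "\<exists>s t. a < s \<and> s < a + h \<and> b < t \<and> t < b + h \<and>
    F (a + h) (b + h) - F (a + h) b - F a (b + h) + F a b = h * h * Fst s t"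
proof -
  have "\<exists>s. a < s \<and> s < a + h \<and>
    (F (a + h) (b + h) - F (a + h) b) - (F a (b + h) - F a b) = (a + h - a) * (Fs s (b + h) - Fs s b)"
    by (rule MVT2) (use h in \<open>auto intro!: derivative_eq_intros 1\<close>)
  then obtain s where s: "a < s" "s < a + h"
    "(F (a + h) (b + h) - F (a + h) b) - (F a (b + h) - F a b) = h * (Fs s (b + h) - Fs s b)"
    by auto
  have "\<exists>t. b < t \<and> t < b + h \<and> Fs s (b + h) - Fs s b = (b + h - b) * Fst s t"
    by (rule MVT2) (use h 12 in auto)
  then obtain t where "b < t" "t < b + h" "Fs s (b + h) - Fs s b = h * Fst s t"
    by auto
  with s show ?thesis by (intro exI[of _ s] exI[of _ t]) (auto simp: algebra_simps)
qed

text \<open>Both mixed derivatives, taken at suitable points of a shrinking square at \<open>(a, b)\<close>, equal the same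
  normalised second difference; continuity moves these points to \<open>(a, b)\<close>.\<close>

lemma mixed_derivatives_commute_plane:
  fixes F Fs Ft Fst Fts :: "real \<Rightarrow> real \<Rightarrow> real"
  assumes 1: "\<And>s t. ((\<lambda>s. F s t) has_real_derivative Fs s t) (at s)"
    and 2: "\<And>s t. ((\<lambda>t. F s t) has_real_derivative Ft s t) (at t)"
    and 12: "\<And>s t. ((\<lambda>t. Fs s t) has_real_derivative Fst s t) (at t)"
    and 21: "\<And>s t. ((\<lambda>s. Ft s t) has_real_derivative Fts s t) (at s)"
    and c12: "continuous_on UNIV (\<lambda>z. Fst (fst z) (snd z))"
    and c21: "continuous_on UNIV (\<lambda>z. Fts (fst z) (snd z))"
  shows "Fst a b = Fts a b"
proof -
  define h :: "nat \<Rightarrow> real" where "h k = inverse (real (Suc k))" for k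
  have h: "h k > 0" for k by (simp add: h_def)
  have h0: "h \<longlonglongrightarrow> 0" unfolding h_def by (rule LIMSEQ_inverse_real_of_nat)
  obtain s t where st: "\<And>k. a < s k \<and> s k < a + h k \<and> b < t k \<and> t k < b + h k \<and>
    F (a + h k) (b + h k) - F (a + h k) b - F a (b + h k) + F a b = h k * h k * Fst (s k) (t k)"
    using second_difference_mean_value[OF 1 12 h, of a _ b] by metis
  obtain s' t' where st': "\<And>k. b < t' k \<and> t' k < b + h k \<and> a < s' k \<and> s' k < a + h k \<and>
    F (a + h k) (b + h k) - F a (b + h k) - F (a + h k) b + F a b = h k * h k * Fts (s' k) (t' k)"
    using second_difference_mean_value[of "\<lambda>t s. F s t" "\<lambda>t s. Ft s t" "\<lambda>t s. Fts s t", OF 2 21 h, of b _ a]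
    by metis
  have eq: "Fst (s k) (t k) = Fts (s' k) (t' k)" for k
  proof -
    have "h k * h k * Fst (s k) (t k) = h k * h k * Fts (s' k) (t' k)"
      using st[of k] st'[of k] by linarith
    then show ?thesis using h[of k] by simp
  qed
  have squeeze: "r \<longlonglongrightarrow> c" if "\<And>k. c < r k \<and> r k < c + h k" for r c
  proof (rule tendsto_sandwich[where f = "\<lambda>_. c" and h = "\<lambda>k. c + h k"])
    show "(\<lambda>k. c + h k) \<longlonglongrightarrow> c" using tendsto_add[OF tendsto_const h0, of c] by simp
  qed (use that in \<open>auto intro!: always_eventually less_imp_le\<close>)
  have lim: "(\<lambda>k. G (r k) (q k)) \<longlonglongrightarrow> G a b"
    if "continuous_on UNIV (\<lambda>z. G (fst z) (snd z))" "r \<longlonglongrightarrow> a" "q \<longlonglongrightarrow> b"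
    for G :: "real \<Rightarrow> real \<Rightarrow> real" and r q
  proof -
    have "isCont (\<lambda>z. G (fst z) (snd z)) (a, b)"
      using that(1) by (simp add: continuous_on_eq_continuous_at)
    from isCont_tendsto_compose[OF this tendsto_Pair[OF that(2,3)]] show ?thesis by simp
  qed
  have "(\<lambda>k. Fst (s k) (t k)) \<longlonglongrightarrow> Fst a b"
    by (rule lim[OF c12]) (rule squeeze, use st in auto)+
  moreover have "(\<lambda>k. Fts (s' k) (t' k)) \<longlonglongrightarrow> Fts a b"
    by (rule lim[OF c21]) (rule squeeze, use st' in auto)+
  ultimately show ?thesis using eq LIMSEQ_unique by simp
qed

lemma fun_upd_in_Euclidean_space:
  "x \<in> topspace (Euclidean_space n) \<Longrightarrow> i < n \<Longrightarrow> x(i := t) \<in> topspace (Euclidean_space n)"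
  by (auto simp: topspace_Euclidean_space)

lemma first_coords_in_Euclidean_space: "first_coords n x \<in> topspace (Euclidean_space n)"
  by (auto simp: topspace_Euclidean_space first_coords_def)

lemma has_partial_derivative:
  assumes "C_upto n (Suc k) f" "i < n" "x \<in> topspace (Euclidean_space n)"
  shows "((\<lambda>t. f (x(i := t))) has_real_derivative partial i f (x(i := t))) (at t)"
proof -
  have "\<forall>y\<in>topspace (Euclidean_space n). (\<lambda>t. f (y(i := t))) differentiable (at (y i))"
    using assms(1,2) by simp
  from bspec[OF this fun_upd_in_Euclidean_space[OF assms(3,2), of t]] show ?thesis
    by (simp add: partial_def DERIV_deriv_iff_real_differentiable)
qed

lemma C_upto_partial: "C_upto n (Suc k) f \<Longrightarrow> i < n \<Longrightarrow> C_upto n k (partial i f)"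
  by simp

lemma C_upto_continuous: "C_upto n k f \<Longrightarrow> continuous_map (Euclidean_space n) euclideanreal f"
  by (cases k) auto

lemma continuous_on_coordinate_plane:
  assumes "continuous_map (Euclidean_space n) euclideanreal f"
    and "x \<in> topspace (Euclidean_space n)" "i < n" "j < n"
  shows "continuous_on UNIV (\<lambda>z. f (x(i := fst z, j := snd z)))"
proof -
  have "continuous_map (euclidean :: (real \<times> real) topology) (Euclidean_space n)
    (\<lambda>z. x(i := fst z, j := snd z))"
    unfolding Euclidean_space_def continuous_map_in_subtopology continuous_map_componentwise_UNIV
  proof (intro conjI allI)
    show "continuous_map euclidean euclideanreal (\<lambda>z. (x(i := fst z, j := snd z)) k)" for k
      by (cases "k = j"; cases "k = i") (auto intro!: continuous_intros)
    show "(\<lambda>z. x(i := fst z, j := snd z)) \<in> topspace euclidean \<rightarrow> {x. \<forall>i\<ge>n. x i = 0}"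
      using assms(2-4) by (auto simp: topspace_Euclidean_space)
  qed
  from continuous_map_compose[OF this assms(1)] show ?thesis by (simp add: o_def)
qed

text \<open>Schwarz's theorem, reduced to the plane of the two coordinates through \<open>x\<close>.\<close>

lemma partials_commute:
  assumes f: "C_upto n (Suc (Suc 0)) f" and x: "x \<in> topspace (Euclidean_space n)"
    and ij: "i < n" "j < n"
  shows "partial i (partial j f) x = partial j (partial i f) x"
proof (cases "i = j")
  case False
  let ?q = "\<lambda>s t. x(i := s, j := t)"
  have q: "?q s t \<in> topspace (Euclidean_space n)" for s t
    by (intro fun_upd_in_Euclidean_space x ij)
  have di: "((\<lambda>s. g (?q s t)) has_real_derivative partial i g (?q s t)) (at s)"
    if "C_upto n (Suc k) g" for g s t k
    using has_partial_derivative[OF that ij(1) q[of s t], of s] False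
    by (simp add: fun_upd_twist)
  have dj: "((\<lambda>t. g (?q s t)) has_real_derivative partial j g (?q s t)) (at t)"
    if "C_upto n (Suc k) g" for g s t k
    using has_partial_derivative[OF that ij(2) q[of s t], of t] by simp
  have ci: "C_upto n (Suc 0) (partial i f)" and cj: "C_upto n (Suc 0) (partial j f)"
    using f ij C_upto_partial by blast+
  have cont: "continuous_on UNIV (\<lambda>z. g (?q (fst z) (snd z)))" if "C_upto n 0 g" for g
    using continuous_on_coordinate_plane[OF C_upto_continuous[OF that] x ij] .
  have "partial j (partial i f) (?q (x i) (x j)) = partial i (partial j f) (?q (x i) (x j))"
    by (rule mixed_derivatives_commute_plane[where F = "\<lambda>s t. f (?q s t)" and
          Fs = "\<lambda>s t. partial i f (?q s t)" and Ft = "\<lambda>s t. partial j f (?q s t)"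
        and Fst = "\<lambda>s t. partial j (partial i f) (?q s t)"
        and Fts = "\<lambda>s t. partial i (partial j f) (?q s t)"])
      (intro di[OF f] dj[OF f] di[OF cj] dj[OF ci] cont C_upto_partial[OF ci ij(2)]
        C_upto_partial[OF cj ij(1)])+
  then show ?thesis by simp
qed simp

section \<open>The metric and its Jacobi operators\<close>

lemma partial_eqI:
  "((\<lambda>t. f (x(i := t))) has_real_derivative D) (at (x i)) \<Longrightarrow> partial i f x = D"
  unfolding partial_def by (rule DERIV_imp_deriv)

lemma partial_const [simp]: "partial i (\<lambda>_. c) x = 0"
  by (simp add: partial_def)

lemma partial_first_coords:
  "partial i (\<lambda>z. f (first_coords p z)) z = (if i < p then partial i f (first_coords p z) else 0)"
proof (cases "i < p")
  case True
  then have "first_coords p (z(i := t)) = (first_coords p z)(i := t)" for t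
    by (auto simp: first_coords_def)
  then show ?thesis using True by (simp add: partial_def first_coords_def)
next
  case False
  then have "first_coords p (z(i := t)) = first_coords p z" for t
    by (auto simp: first_coords_def)
  then show ?thesis using False by (simp add: partial_def)
qed

lemma sum_restrict_lessThan:
  fixes f :: "nat \<Rightarrow> 'a :: comm_monoid_add"
  assumes "p \<le> n"
  shows "(\<Sum>i<n. if i < p then f i else 0) = (\<Sum>i<p. f i)"
  using assms by (intro sum.mono_neutral_cong_right) auto

lemma sum_lessThan_add:
  fixes f :: "nat \<Rightarrow> 'a :: comm_monoid_add"
  shows "(\<Sum>i<a + b. f i) = (\<Sum>i<a. f i) + (\<Sum>i<b. f (a + i))"
  by (induction b) (simp_all add: add.assoc)

text \<open>The Christoffel symbols of the first kind of \<open>\<psi>\<close>, although \<open>\<psi>\<close> need not be a metric on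
  \<open>\<real>\<^sup>p\<close>. They are the only nonzero Christoffel symbols of the product metric, with the last index raised to
  the corresponding \<open>y\<close>-direction.\<close>

definition psi_christoffel :: "metric \<Rightarrow> nat \<Rightarrow> nat \<Rightarrow> nat \<Rightarrow> point \<Rightarrow> real" where
  "psi_christoffel \<psi> i j l x = (partial i (\<lambda>z. \<psi> z $$ (j, l)) x + partial j (\<lambda>z. \<psi> z $$ (i, l)) x
     - partial l (\<lambda>z. \<psi> z $$ (i, j)) x) / 2"

text \<open>The coefficient of \<open>\<partial>\<^sub>l\<^sup>y\<close> in \<open>R(\<partial>\<^sub>j\<^sup>x, \<partial>\<^sub>a\<^sup>x)\<partial>\<^sub>b\<^sup>x\<close>; products of Christoffel symbols do not
  occur in it since each of them maps into the \<open>y\<close>-directions, where all of them vanish.\<close>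

definition psi_riemann :: "metric \<Rightarrow> point \<Rightarrow> nat \<Rightarrow> nat \<Rightarrow> nat \<Rightarrow> nat \<Rightarrow> real" where
  "psi_riemann \<psi> x l j a b = partial j (psi_christoffel \<psi> a b l) x - partial a (psi_christoffel \<psi> j b l) x"

text \<open>The block of the Jacobi operator of a vector with \<open>x\<close>-part \<open>c\<close>, a quadratic function of \<open>c\<close>.\<close>

definition jac_form :: "nat \<Rightarrow> metric \<Rightarrow> point \<Rightarrow> (nat \<Rightarrow> real) \<Rightarrow> nat \<Rightarrow> nat \<Rightarrow> real" where
  "jac_form p \<psi> x c l j = (\<Sum>a<p. \<Sum>b<p. c a * c b * psi_riemann \<psi> x l j a b)"

text \<open>The operator on the tangent space, of dimension \<open>n \<ge> 2 p\<close>, that maps the \<open>x\<close>-directions to the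
  \<open>y\<close>-directions by \<open>S\<close> and annihilates the \<open>y\<close>-directions and the flat directions.\<close>

definition lower_block :: "nat \<Rightarrow> nat \<Rightarrow> (nat \<Rightarrow> nat \<Rightarrow> real) \<Rightarrow> real mat" where
  "lower_block p n S = mat n n (\<lambda>(i, j). if p \<le> i \<and> i < 2 * p \<and> j < p then S (i - p) j else 0)"

abbreviation (input) "flat_sign u k \<equiv> if k < u then -1 else 1 :: real"

context
  fixes p :: nat and \<psi> :: metric
  assumes \<psi>: "smooth_symmetric_tensor p \<psi>"
begin

lemma first_coords_twice: "first_coords p (first_coords (2 * p) z) = first_coords p z"
  by (auto simp: first_coords_def fun_eq_iff)

lemma psi_carrier: "\<psi> (first_coords p z) \<in> carrier_mat p p"
  using \<psi> first_coords_in_Euclidean_space[of p z] unfolding smooth_symmetric_tensor_def by blast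

lemma psi_sym:
  assumes "x \<in> topspace (Euclidean_space p)" "i < p" "j < p"
  shows "\<psi> x $$ (i, j) = \<psi> x $$ (j, i)"
proof -
  have "\<psi> x \<in> carrier_mat p p" "transpose_mat (\<psi> x) = \<psi> x"
    using \<psi> assms unfolding smooth_symmetric_tensor_def by blast+
  then show ?thesis using assms by (metis carrier_matD index_transpose_mat(1))
qed

lemma psi_C_upto: "i < p \<Longrightarrow> j < p \<Longrightarrow> C_upto p k (\<lambda>x. \<psi> x $$ (i, j))"
  using \<psi> unfolding smooth_symmetric_tensor_def smooth_def by blast

lemma g_N_carrier: "g_N p \<psi> u w z \<in> carrier_mat (2 * p + (u + w)) (2 * p + (u + w))"
  using psi_carrier[of "first_coords (2 * p) z"]
  by (auto simp: g_N_def product_metric_def g_psi_def flat_metric_def)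

lemma g_N_index:
  assumes "i < 2 * p + (u + w)" "j < 2 * p + (u + w)"
  shows "g_N p \<psi> u w z $$ (i, j) =
    (if i < p \<and> j < p then \<psi> (first_coords p z) $$ (i, j)
     else if j = p + i \<and> i < p \<or> i = p + j \<and> j < p then 1
     else if i = j \<and> 2 * p \<le> i then if i < 2 * p + u then -1 else 1
     else 0)"
  using psi_carrier[of z] assms
  by (cases "i < p"; cases "j < p"; cases "i < 2 * p"; cases "j < 2 * p")
    (simp_all add: g_N_def product_metric_def g_psi_def flat_metric_def first_coords_twice, auto)

lemma g_N_transpose: "transpose_mat (g_N p \<psi> u w z) = g_N p \<psi> u w z"
proof (rule eq_matI)
  have c: "dim_row (g_N p \<psi> u w z) = 2 * p + (u + w)" "dim_col (g_N p \<psi> u w z) = 2 * p + (u + w)" using g_N_carrier[of u w z] by auto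
  fix i j assume "i < dim_row (g_N p \<psi> u w z)" "j < dim_col (g_N p \<psi> u w z)"
  then have ij: "i < 2 * p + (u + w)" "j < 2 * p + (u + w)" using c by auto
  have "g_N p \<psi> u w z $$ (j, i) = g_N p \<psi> u w z $$ (i, j)"
    using psi_sym[OF first_coords_in_Euclidean_space, of i j z]
    by (auto simp: g_N_index[OF ij] g_N_index[OF ij(2,1)])
  then show "transpose_mat (g_N p \<psi> u w z) $$ (i, j) = g_N p \<psi> u w z $$ (i, j)" using ij c by simp
qed (use g_N_carrier[of u w z] in auto)

lemma gip_g_N:
  assumes a: "a \<in> carrier_vec (2 * p + (u + w))" and b: "b \<in> carrier_vec (2 * p + (u + w))"
  shows "gip (g_N p \<psi> u w z) a b =
    (\<Sum>i<p. \<Sum>j<p. a $ i * \<psi> (first_coords p z) $$ (i, j) * b $ j) +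
    (\<Sum>i<p. a $ i * b $ (p + i) + a $ (p + i) * b $ i) +
    (\<Sum>k<u + w. flat_sign u k * a $ (2 * p + k) * b $ (2 * p + k))"
proof -
  let ?\<psi> = "\<psi> (first_coords p z)"
  have split: "(\<Sum>i< 2 * p + (u + w). f i) = (\<Sum>i<p. f i) + (\<Sum>i<p. f (p + i)) + (\<Sum>k<u + w. f (2 * p + k))"
    for f :: "nat \<Rightarrow> real"
    using sum_lessThan_add[of f p p] by (simp only: sum_lessThan_add mult_2)
  have row: "(g_N p \<psi> u w z *\<^sub>v b) $ i = (\<Sum>j<p. g_N p \<psi> u w z $$ (i, j) * b $ j) + (\<Sum>j<p. g_N p \<psi> u w z $$ (i, p + j) * b $ (p + j)) +
      (\<Sum>k<u + w. g_N p \<psi> u w z $$ (i, 2 * p + k) * b $ (2 * p + k))" if "i < 2 * p + (u + w)" for i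
  proof -
    have "(g_N p \<psi> u w z *\<^sub>v b) $ i = (\<Sum>j< 2 * p + (u + w). g_N p \<psi> u w z $$ (i, j) * b $ j)"
      using that b g_N_carrier[of u w z] by (auto simp: scalar_prod_def atLeast0LessThan intro!: sum.cong)
    then show ?thesis unfolding split .
  qed
  have 1: "(g_N p \<psi> u w z *\<^sub>v b) $ i = (\<Sum>j<p. ?\<psi> $$ (i, j) * b $ j) + b $ (p + i)" if i: "i < p" for i
  proof -
    have "(\<Sum>j<p. g_N p \<psi> u w z $$ (i, j) * b $ j) = (\<Sum>j<p. ?\<psi> $$ (i, j) * b $ j)"
      by (intro sum.cong refl) (use i in \<open>simp add: g_N_index\<close>)
    moreover have "(\<Sum>j<p. g_N p \<psi> u w z $$ (i, p + j) * b $ (p + j)) = (\<Sum>j<p. if j = i then b $ (p + j) else 0)"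
      by (intro sum.cong refl) (use i in \<open>simp add: g_N_index\<close>)
    moreover have "(\<Sum>k<u + w. g_N p \<psi> u w z $$ (i, 2 * p + k) * b $ (2 * p + k)) = 0"
      by (intro sum.neutral) (use i in \<open>simp add: g_N_index\<close>)
    moreover have "i < 2 * p + (u + w)" using i by simp
    ultimately show ?thesis using row[of i] i by simp
  qed
  have 2: "(g_N p \<psi> u w z *\<^sub>v b) $ (p + i) = b $ i" if i: "i < p" for i
  proof -
    have "(\<Sum>j<p. g_N p \<psi> u w z $$ (p + i, j) * b $ j) = (\<Sum>j<p. if j = i then b $ j else 0)"
      by (intro sum.cong refl) (use i in \<open>simp add: g_N_index\<close>)
    moreover have "(\<Sum>j<p. g_N p \<psi> u w z $$ (p + i, p + j) * b $ (p + j)) = 0"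
      by (intro sum.neutral) (use i in \<open>simp add: g_N_index\<close>)
    moreover have "(\<Sum>k<u + w. g_N p \<psi> u w z $$ (p + i, 2 * p + k) * b $ (2 * p + k)) = 0"
      by (intro sum.neutral) (use i in \<open>simp add: g_N_index\<close>)
    moreover have "p + i < 2 * p + (u + w)" using i by simp
    ultimately show ?thesis using row[of "p + i"] i by simp
  qed
  have 3: "(g_N p \<psi> u w z *\<^sub>v b) $ (2 * p + k) = flat_sign u k * b $ (2 * p + k)" if k: "k < u + w" for k
  proof -
    have "(\<Sum>j<p. g_N p \<psi> u w z $$ (2 * p + k, j) * b $ j) = 0"
      by (intro sum.neutral) (use k in \<open>simp add: g_N_index\<close>)
    moreover have "(\<Sum>j<p. g_N p \<psi> u w z $$ (2 * p + k, p + j) * b $ (p + j)) = 0"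
      by (intro sum.neutral) (use k in \<open>simp add: g_N_index\<close>)
    moreover have "(\<Sum>j<u + w. g_N p \<psi> u w z $$ (2 * p + k, 2 * p + j) * b $ (2 * p + j)) =
        (\<Sum>j<u + w. if j = k then flat_sign u j * b $ (2 * p + j) else 0)"
      by (intro sum.cong refl) (use k in \<open>simp add: g_N_index\<close>)
    moreover have "2 * p + k < 2 * p + (u + w)" using k by simp
    ultimately show ?thesis using row[of "2 * p + k"] k by simp
  qed
  have "gip (g_N p \<psi> u w z) a b = (\<Sum>i< 2 * p + (u + w). a $ i * (g_N p \<psi> u w z *\<^sub>v b) $ i)"
    using g_N_carrier[of u w z] by (auto simp: gip_def scalar_prod_def atLeast0LessThan)
  also have "\<dots> = (\<Sum>i<p. a $ i * ((\<Sum>j<p. ?\<psi> $$ (i, j) * b $ j) + b $ (p + i))) + (\<Sum>i<p. a $ (p + i) * b $ i) +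
      (\<Sum>k<u + w. a $ (2 * p + k) * (flat_sign u k * b $ (2 * p + k)))"
    unfolding split by (intro arg_cong2[where f = "(+)"] sum.cong refl) (simp_all only: 1 2 3 lessThan_iff)
  finally show ?thesis
    by (simp add: algebra_simps sum.distrib sum_distrib_left)
qed

text \<open>The inverse of the product metric. Its \<open>xx\<close>-block is zero: this one fact makes the connection
  nearly trivial and later also the sum of all Jacobi operators over an orthonormal basis.\<close>

definition inverse_g_N :: "nat \<Rightarrow> nat \<Rightarrow> point \<Rightarrow> real mat" where
  "inverse_g_N u w z = four_block_mat
     (four_block_mat (0\<^sub>m p p) (1\<^sub>m p) (1\<^sub>m p) (- \<psi> (first_coords p z)))
     (0\<^sub>m (2 * p) (u + w)) (0\<^sub>m (u + w) (2 * p)) (flat_metric u w z)"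

lemma inverse_g_N_carrier: "inverse_g_N u w z \<in> carrier_mat (2 * p + (u + w)) (2 * p + (u + w))"
  using psi_carrier[of z] by (auto simp: inverse_g_N_def flat_metric_def)

lemma inverse_g_N_index:
  assumes "i < 2 * p + (u + w)" "l < p"
  shows "inverse_g_N u w z $$ (i, l) = (if i = p + l then 1 else 0)"
  using psi_carrier[of z] assms by (auto simp: inverse_g_N_def flat_metric_def)

lemma flat_metric_square: "flat_metric u w z * flat_metric u w z' = 1\<^sub>m (u + w)"
proof (rule eq_matI)
  fix i j assume ij: "i < dim_row (1\<^sub>m (u + w) :: real mat)" "j < dim_col (1\<^sub>m (u + w) :: real mat)"
  have "(flat_metric u w z * flat_metric u w z') $$ (i, j) =
    (\<Sum>k<u + w. flat_metric u w z $$ (i, k) * flat_metric u w z' $$ (k, j))"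
    using ij by (simp add: flat_metric_def scalar_prod_def atLeast0LessThan)
  also have "\<dots> = (\<Sum>k<u + w. if k = i then if i = j then 1 else 0 else 0)"
    by (intro sum.cong refl) (use ij in \<open>auto simp: flat_metric_def\<close>)
  also have "\<dots> = 1\<^sub>m (u + w) $$ (i, j)" using ij by simp
  finally show "(flat_metric u w z * flat_metric u w z') $$ (i, j) = 1\<^sub>m (u + w) $$ (i, j)" .
qed (auto simp: flat_metric_def)

lemma g_N_inverse_right: "g_N p \<psi> u w z * inverse_g_N u w z = 1\<^sub>m (2 * p + (u + w))"
proof -
  let ?\<psi> = "\<psi> (first_coords p z)"
  note c = psi_carrier[of z]
  have F: "flat_metric u w y \<in> carrier_mat (u + w) (u + w)" for y by (simp add: flat_metric_def)
  have 1: "four_block_mat ?\<psi> (1\<^sub>m p) (1\<^sub>m p) (0\<^sub>m p p) *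
      four_block_mat (0\<^sub>m p p) (1\<^sub>m p) (1\<^sub>m p) (- ?\<psi>) = 1\<^sub>m (2 * p)"
  proof -
    have "?\<psi> + - ?\<psi> = 0\<^sub>m p p" "1\<^sub>m p + - 0\<^sub>m p p = (1\<^sub>m p :: real mat)"
      using c by (auto intro!: eq_matI)
    then show ?thesis
      using c by (subst mult_four_block_mat[of _ p p _ p _ p _ _ p _ p])
        (auto simp: mult_2 four_block_one_mat)
  qed
  have c1: "four_block_mat ?\<psi> (1\<^sub>m p) (1\<^sub>m p) (0\<^sub>m p p) \<in> carrier_mat (2 * p) (2 * p)"
    "four_block_mat (0\<^sub>m p p) (1\<^sub>m p) (1\<^sub>m p) (- ?\<psi>) \<in> carrier_mat (2 * p) (2 * p)"
    using c by auto
  show ?thesis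
    unfolding g_N_def product_metric_def g_psi_def first_coords_twice inverse_g_N_def
    by (subst mult_four_block_mat[OF c1(1) _ _ F c1(2) _ _ F])
      (use c1 F in \<open>simp_all add: 1 flat_metric_square left_mult_zero_mat[OF c1(2)] left_mult_zero_mat[OF F]
         right_mult_zero_mat[OF c1(1)] right_mult_zero_mat[OF F] four_block_one_mat\<close>)
qed

lemma mat_inverse_g_N: "the (mat_inverse (g_N p \<psi> u w z)) = inverse_g_N u w z"
proof -
  let ?n = "2 * p + (u + w)"
  let ?G = "g_N p \<psi> u w z"
  have G: "?G \<in> carrier_mat ?n ?n" and H: "inverse_g_N u w z \<in> carrier_mat ?n ?n"
    by (rule g_N_carrier inverse_g_N_carrier)+
  have GH: "?G * inverse_g_N u w z = 1\<^sub>m ?n" by (rule g_N_inverse_right)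
  then have HG: "inverse_g_N u w z * ?G = 1\<^sub>m ?n" by (rule mat_mult_left_right_inverse[OF G H])
  have "?G \<in> Units (ring_mat TYPE(real) ?n ())"
    using G H GH HG by (auto simp: Units_def ring_mat_def)
  then obtain B where B: "mat_inverse ?G = Some B"
    using mat_inverse(1)[OF G] by fastforce
  from mat_inverse(2)[OF G B] have BG: "B * ?G = 1\<^sub>m ?n" and Bc: "B \<in> carrier_mat ?n ?n" by auto
  have "B = B * (?G * inverse_g_N u w z)" using Bc GH by simp
  also have "\<dots> = inverse_g_N u w z" using assoc_mult_mat[OF Bc G H] BG H by simp
  finally show ?thesis using B by simp
qed

lemma partial_g_N:
  assumes "j < 2 * p + (u + w)" "l < 2 * p + (u + w)"
  shows "partial i (\<lambda>z. g_N p \<psi> u w z $$ (j, l)) z =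
    (if i < p \<and> j < p \<and> l < p then partial i (\<lambda>x. \<psi> x $$ (j, l)) (first_coords p z) else 0)"
proof (cases "j < p \<and> l < p")
  case True
  then show ?thesis
    using partial_first_coords[of i "\<lambda>x. \<psi> x $$ (j, l)" p z] by (simp add: g_N_index[OF assms])
next
  case False
  then have "(\<lambda>z. g_N p \<psi> u w z $$ (j, l)) = (\<lambda>_. g_N p \<psi> u w z $$ (j, l))"
    by (auto simp: g_N_index[OF assms] fun_eq_iff)
  then show ?thesis using False by (metis partial_const)
qed

text \<open>Derivatives of the metric vanish unless all three indices are \<open>x\<close>-indices, and raising an
  \<open>x\<close>-index with the inverse metric gives exactly the corresponding \<open>y\<close>-index.\<close>

lemma christoffel_g_N:
  assumes "i < 2 * p + (u + w)" "j < 2 * p + (u + w)" "k < 2 * p + (u + w)"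
  shows "christoffel (2 * p + (u + w)) (g_N p \<psi> u w) i j k z =
    (if i < p \<and> j < p \<and> p \<le> k \<and> k < 2 * p then psi_christoffel \<psi> i j (k - p) (first_coords p z) else 0)"
proof -
  let ?n = "2 * p + (u + w)"
  let ?x = "first_coords p z"
  let ?g = "\<lambda>l. partial i (\<lambda>z. g_N p \<psi> u w z $$ (j, l)) z + partial j (\<lambda>z. g_N p \<psi> u w z $$ (i, l)) z
         - partial l (\<lambda>z. g_N p \<psi> u w z $$ (i, j)) z"
  have g: "?g l = (if i < p \<and> j < p \<and> l < p then 2 * psi_christoffel \<psi> i j l ?x else 0)" if "l < ?n" for l
    using that assms by (auto simp: partial_g_N psi_christoffel_def)
  have "christoffel ?n (g_N p \<psi> u w) i j k z = (\<Sum>l<?n. inverse_g_N u w z $$ (k, l) * ?g l) / 2"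
    by (simp add: christoffel_def mat_inverse_g_N)
  also have "(\<Sum>l<?n. inverse_g_N u w z $$ (k, l) * ?g l) =
    (\<Sum>l<?n. if l < p then if k = p + l then if i < p \<and> j < p then 2 * psi_christoffel \<psi> i j l ?x else 0 else 0 else 0)"
    by (intro sum.cong refl) (use assms in \<open>simp add: g inverse_g_N_index\<close>)
  also have "\<dots> = (\<Sum>l<p. if k = p + l then if i < p \<and> j < p then 2 * psi_christoffel \<psi> i j l ?x else 0 else 0)"
    by (rule sum_restrict_lessThan) simp
  also have "\<dots> = (\<Sum>l<p. if l = k - p then if p \<le> k \<and> i < p \<and> j < p then 2 * psi_christoffel \<psi> i j l ?x else 0 else 0)"
    by (intro sum.cong) auto
  also have "\<dots> = (if k - p < p \<and> p \<le> k \<and> i < p \<and> j < p then 2 * psi_christoffel \<psi> i j (k - p) ?x else 0)"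
    by simp
  also have "\<dots> = (if i < p \<and> j < p \<and> p \<le> k \<and> k < 2 * p then 2 * psi_christoffel \<psi> i j (k - p) ?x else 0)"
    by (cases "p \<le> k \<and> k < 2 * p") auto
  finally show ?thesis by (auto split: if_splits)
qed

lemma has_partial_psi_christoffel:
  assumes "i < p" "j < p" "l < p" "a < p" "x \<in> topspace (Euclidean_space p)"
  shows "((\<lambda>t. psi_christoffel \<psi> i j l (x(a := t))) has_real_derivative
    (partial a (partial i (\<lambda>z. \<psi> z $$ (j, l))) x + partial a (partial j (\<lambda>z. \<psi> z $$ (i, l))) x
      - partial a (partial l (\<lambda>z. \<psi> z $$ (i, j))) x) / 2) (at (x a))"
proof -
  have "((\<lambda>t. partial k (\<lambda>z. \<psi> z $$ (r, s)) (x(a := t))) has_real_derivative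
      partial a (partial k (\<lambda>z. \<psi> z $$ (r, s))) x) (at (x a))"
    if "k < p" "r < p" "s < p" for k r s
    using has_partial_derivative[OF C_upto_partial[OF psi_C_upto[OF that(2,3)] that(1)] assms(4,5), of "x a"]
    by simp
  then show ?thesis unfolding psi_christoffel_def using assms by (auto intro!: derivative_eq_intros)
qed

lemma partial_psi_christoffel:
  assumes "i < p" "j < p" "l < p" "a < p" "x \<in> topspace (Euclidean_space p)"
  shows "partial a (psi_christoffel \<psi> i j l) x =
    (partial a (partial i (\<lambda>z. \<psi> z $$ (j, l))) x + partial a (partial j (\<lambda>z. \<psi> z $$ (i, l))) x
      - partial a (partial l (\<lambda>z. \<psi> z $$ (i, j))) x) / 2"
  by (rule partial_eqI) (rule has_partial_psi_christoffel[OF assms])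

lemma nabla_const_g_N:
  shows "nabla (2 * p + (u + w)) (g_N p \<psi> u w) (\<lambda>_. s) (\<lambda>_. t) z =
    vec (2 * p + (u + w)) (\<lambda>k. if p \<le> k \<and> k < 2 * p then
      \<Sum>i<p. \<Sum>j<p. s $ i * t $ j * psi_christoffel \<psi> i j (k - p) (first_coords p z) else 0)"
proof -
  let ?n = "2 * p + (u + w)"
  let ?c = "\<lambda>i j k. christoffel ?n (g_N p \<psi> u w) i j k z"
  let ?gm = "\<lambda>i j k. psi_christoffel \<psi> i j (k - p) (first_coords p z)"
  have *: "(\<Sum>i<?n. s $ i * (\<Sum>j<?n. ?c i j k * t $ j)) =
      (if p \<le> k \<and> k < 2 * p then \<Sum>i<p. \<Sum>j<p. s $ i * t $ j * ?gm i j k else 0)" if k: "k < ?n" for k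
  proof -
    have "(\<Sum>j<?n. ?c i j k * t $ j) =
      (if i < p then if p \<le> k \<and> k < 2 * p then \<Sum>j<p. t $ j * ?gm i j k else 0 else 0)" if "i < ?n" for i
    proof -
      have "(\<Sum>j<?n. ?c i j k * t $ j) =
        (\<Sum>j<?n. if j < p then if i < p \<and> p \<le> k \<and> k < 2 * p then t $ j * ?gm i j k else 0 else 0)"
        by (intro sum.cong refl) (use that k in \<open>simp add: christoffel_g_N\<close>)
      also have "\<dots> = (\<Sum>j<p. if i < p \<and> p \<le> k \<and> k < 2 * p then t $ j * ?gm i j k else 0)"
        by (rule sum_restrict_lessThan) simp
      finally show ?thesis by auto
    qed
    then have "(\<Sum>i<?n. s $ i * (\<Sum>j<?n. ?c i j k * t $ j)) =
      (\<Sum>i<?n. if i < p then s $ i * (if p \<le> k \<and> k < 2 * p then \<Sum>j<p. t $ j * ?gm i j k else 0) else 0)"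
      by (intro sum.cong refl) simp
    also have "\<dots> = (\<Sum>i<p. s $ i * (if p \<le> k \<and> k < 2 * p then \<Sum>j<p. t $ j * ?gm i j k else 0))"
      by (rule sum_restrict_lessThan) simp
    also have "\<dots> = (if p \<le> k \<and> k < 2 * p then \<Sum>i<p. \<Sum>j<p. s $ i * t $ j * ?gm i j k else 0)"
      by (cases "p \<le> k"; cases "k < 2 * p") (simp_all add: sum_distrib_left mult.assoc)
    finally show ?thesis .
  qed
  show ?thesis unfolding nabla_def by (rule eq_vecI) (simp_all add: *)
qed

lemma partial_sum_psi_christoffel:
  assumes "a < p" "l < p" "x \<in> topspace (Euclidean_space p)"
  shows "partial a (\<lambda>x. \<Sum>i<p. \<Sum>j<p. s i * t j * psi_christoffel \<psi> i j l x) x =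
    (\<Sum>i<p. \<Sum>j<p. s i * t j * partial a (psi_christoffel \<psi> i j l) x)"
proof (rule partial_eqI)
  have "((\<lambda>t. psi_christoffel \<psi> i j l (x(a := t))) has_real_derivative partial a (psi_christoffel \<psi> i j l) x) (at (x a))"
    if "i < p" "j < p" for i j
    unfolding partial_psi_christoffel[OF that assms(2,1,3)] by (rule has_partial_psi_christoffel[OF that assms(2,1,3)])
  then show "((\<lambda>\<tau>. \<Sum>i<p. \<Sum>j<p. s i * t j * psi_christoffel \<psi> i j l (x(a := \<tau>))) has_real_derivative
     (\<Sum>i<p. \<Sum>j<p. s i * t j * partial a (psi_christoffel \<psi> i j l) x)) (at (x a))"
    by (intro DERIV_sum DERIV_cmult) auto
qed

text \<open>The inner derivative points in the \<open>y\<close>-directions, on which the Christoffel symbols vanish; only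
  the partial derivatives of its components remain.\<close>

lemma nabla_nabla_const_g_N:
  shows "nabla (2 * p + (u + w)) (g_N p \<psi> u w) (\<lambda>_. r)
      (nabla (2 * p + (u + w)) (g_N p \<psi> u w) (\<lambda>_. s) (\<lambda>_. t)) z =
    vec (2 * p + (u + w)) (\<lambda>k. if p \<le> k \<and> k < 2 * p then
      \<Sum>a<p. r $ a * (\<Sum>i<p. \<Sum>j<p. s $ i * t $ j * partial a (psi_christoffel \<psi> i j (k - p)) (first_coords p z)) else 0)"
proof -
  let ?n = "2 * p + (u + w)"
  let ?x = "first_coords p z"
  let ?N = "nabla ?n (g_N p \<psi> u w) (\<lambda>_. s) (\<lambda>_. t)"
  let ?f = "\<lambda>k. \<lambda>x. if p \<le> k \<and> k < 2 * p then \<Sum>i<p. \<Sum>j<p. s $ i * t $ j * psi_christoffel \<psi> i j (k - p) x else 0"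
  have N: "?N y $ k = ?f k (first_coords p y)" if "k < ?n" for y k
    using that by (simp add: nabla_const_g_N)
  have zero: "(\<Sum>j<?n. christoffel ?n (g_N p \<psi> u w) a j k z * ?N z $ j) = 0" if "a < ?n" "k < ?n" for a k
    by (rule sum.neutral) (use that in \<open>auto simp: christoffel_g_N N\<close>)
  have P: "partial a (\<lambda>y. ?N y $ k) z = (if a < p then if p \<le> k \<and> k < 2 * p then
      \<Sum>i<p. \<Sum>j<p. s $ i * t $ j * partial a (psi_christoffel \<psi> i j (k - p)) ?x else 0 else 0)" if "k < ?n" for a k
  proof -
    have "partial a (\<lambda>y. ?N y $ k) z = partial a (\<lambda>y. ?f k (first_coords p y)) z"
      using that by (simp add: N)
    also have "\<dots> = (if a < p then partial a (?f k) ?x else 0)"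
      by (rule partial_first_coords)
    finally show ?thesis
      using partial_sum_psi_christoffel[OF _ _ first_coords_in_Euclidean_space, of a "k - p" "($) s" "($) t" z] by auto
  qed
  have "(\<Sum>a<?n. r $ a * (partial a (\<lambda>y. ?N y $ k) z + (\<Sum>j<?n. christoffel ?n (g_N p \<psi> u w) a j k z * ?N z $ j)))
    = (if p \<le> k \<and> k < 2 * p then
      \<Sum>a<p. r $ a * (\<Sum>i<p. \<Sum>j<p. s $ i * t $ j * partial a (psi_christoffel \<psi> i j (k - p)) ?x) else 0)"
    (is "?L = ?R") if k: "k < ?n" for k
  proof -
    have "?L = (\<Sum>a<?n. if a < p then r $ a * (if p \<le> k \<and> k < 2 * p then
        \<Sum>i<p. \<Sum>j<p. s $ i * t $ j * partial a (psi_christoffel \<psi> i j (k - p)) ?x else 0) else 0)"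
      by (intro sum.cong refl) (use k in \<open>simp add: zero P\<close>)
    also have "\<dots> = (\<Sum>a<p. r $ a * (if p \<le> k \<and> k < 2 * p then
        \<Sum>i<p. \<Sum>j<p. s $ i * t $ j * partial a (psi_christoffel \<psi> i j (k - p)) ?x else 0))"
      by (rule sum_restrict_lessThan) simp
    finally show ?thesis by auto
  qed
  then show ?thesis unfolding nabla_def[of _ _ "\<lambda>_. r"] by (intro eq_vecI) simp_all
qed

lemma sum_unit_vec: "p \<le> n \<Longrightarrow> j < n \<Longrightarrow> (\<Sum>a<p. unit_vec n j $ a * f a) = (if j < p then f j else (0::real))"
  using sum.delta[of "{..<p}" j f] by (simp add: if_distrib[of "\<lambda>c. c * _"] cong: if_cong)

lemma jacobi_g_N:
  fixes v :: "real vec"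
  shows "jacobi (2 * p + (u + w)) (g_N p \<psi> u w) z v =
    lower_block p (2 * p + (u + w)) (jac_form p \<psi> (first_coords p z) (($) v))"
proof -
  let ?n = "2 * p + (u + w)"
  let ?g = "g_N p \<psi> u w"
  let ?x = "first_coords p z"
  have "lie_bracket ?n (\<lambda>_. s) (\<lambda>_. t) = (\<lambda>_. 0\<^sub>v ?n)" for s t
    by (auto simp: lie_bracket_def fun_eq_iff)
  then have br: "nabla ?n ?g (lie_bracket ?n (\<lambda>_. s) (\<lambda>_. t)) (\<lambda>_. r) z = 0\<^sub>v ?n" for s t r
    by (auto simp: nabla_const_g_N)
  have "curvature ?n ?g (\<lambda>_. unit_vec ?n j) (\<lambda>_. v) (\<lambda>_. v) z $ k =
    (if p \<le> k \<and> k < 2 * p \<and> j < p then jac_form p \<psi> ?x (($) v) (k - p) j else 0)"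
    if k: "k < ?n" and j: "j < ?n" for k j
  proof (cases "p \<le> k \<and> k < 2 * p")
    case False
    then show ?thesis using k
      by (cases "p \<le> k"; cases "k < 2 * p") (simp_all add: curvature_def nabla_nabla_const_g_N br)
  next
    case True
    let ?d = "\<lambda>a i b. partial a (psi_christoffel \<psi> i b (k - p)) ?x"
    have "curvature ?n ?g (\<lambda>_. unit_vec ?n j) (\<lambda>_. v) (\<lambda>_. v) z $ k =
      (\<Sum>a<p. unit_vec ?n j $ a * (\<Sum>i<p. \<Sum>b<p. v $ i * v $ b * ?d a i b)) -
      (\<Sum>a<p. v $ a * (\<Sum>i<p. \<Sum>b<p. unit_vec ?n j $ i * v $ b * ?d a i b))"
      using True k by (simp add: curvature_def nabla_nabla_const_g_N br)
    also have "(\<Sum>a<p. unit_vec ?n j $ a * (\<Sum>i<p. \<Sum>b<p. v $ i * v $ b * ?d a i b)) =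
      (if j < p then \<Sum>i<p. \<Sum>b<p. v $ i * v $ b * ?d j i b else 0)"
      by (rule sum_unit_vec) (use j in auto)
    also have "(\<Sum>a<p. v $ a * (\<Sum>i<p. \<Sum>b<p. unit_vec ?n j $ i * v $ b * ?d a i b)) =
      (\<Sum>a<p. v $ a * (if j < p then \<Sum>b<p. v $ b * ?d a j b else 0))"
      using j by (simp add: sum_unit_vec sum_distrib_left[symmetric] mult.assoc del: index_unit_vec)
    finally show ?thesis
      using True by (auto simp: jac_form_def psi_riemann_def sum_distrib_left right_diff_distrib sum_subtractf mult.assoc)
  qed
  then show ?thesis unfolding jacobi_def lower_block_def by (intro eq_matI) auto
qed

text \<open>The pair symmetry of the curvature tensor, by hand: after contraction with \<open>c \<otimes> c\<close> one pair of the
  six second derivatives cancels and the other four are permuted by exchanging \<open>l\<close> and \<open>j\<close>. Both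
  steps use that partial derivatives commute.\<close>

lemma jac_form_sym:
  assumes x: "x \<in> topspace (Euclidean_space p)" and lj: "l < p" "j < p"
  shows "jac_form p \<psi> x c l j = jac_form p \<psi> x c j l"
proof -
  let ?D = "\<lambda>i k r s. partial i (partial k (\<lambda>z. \<psi> z $$ (r, s))) x"
  have comm: "?D i k r s = ?D k i r s" if "i < p" "k < p" "r < p" "s < p" for i k r s
    by (rule partials_commute[OF psi_C_upto[OF that(3,4)] x that(1,2)])
  have psi_smooth: "?D i k r s = ?D i k s r" if "i < p" "k < p" "r < p" "s < p" for i k r s
  proof -
    have ev: "partial k (\<lambda>z. \<psi> z $$ (r, s)) y = partial k (\<lambda>z. \<psi> z $$ (s, r)) y"
      if "y \<in> topspace (Euclidean_space p)" for y
      unfolding partial_def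
      using psi_sym[OF fun_upd_in_Euclidean_space[OF that]] \<open>r < p\<close> \<open>s < p\<close> \<open>k < p\<close> by simp
    then show ?thesis
      unfolding partial_def[of i] using fun_upd_in_Euclidean_space[OF x \<open>i < p\<close>] by simp
  qed
  have r2: "2 * psi_riemann \<psi> x l j a b = ?D j b a l - ?D j l a b - ?D a b j l + ?D a l j b"
    if "a < p" "b < p" "l < p" "j < p" for a b l j
    unfolding psi_riemann_def partial_psi_christoffel[OF that(1,2,3,4) x] partial_psi_christoffel[OF that(4,2,3,1) x]
    using comm[of j a b l] that by (simp add: field_simps)
  have s2: "2 * jac_form p \<psi> x c l j = (\<Sum>a<p. \<Sum>b<p. c a * c b * ?D j b a l) - (\<Sum>a<p. \<Sum>b<p. c a * c b * ?D j l a b)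
    - (\<Sum>a<p. \<Sum>b<p. c a * c b * ?D a b j l) + (\<Sum>a<p. \<Sum>b<p. c a * c b * ?D a l j b)"
    if "l < p" "j < p" for l j
  proof -
    have "2 * jac_form p \<psi> x c l j = (\<Sum>a<p. \<Sum>b<p. c a * c b * (2 * psi_riemann \<psi> x l j a b))"
      by (simp add: jac_form_def sum_distrib_left mult.assoc mult.left_commute)
    also have "\<dots> = (\<Sum>a<p. \<Sum>b<p. c a * c b * (?D j b a l - ?D j l a b - ?D a b j l + ?D a l j b))"
      by (intro sum.cong refl) (use that in \<open>simp add: r2\<close>)
    finally show ?thesis by (simp add: algebra_simps sum.distrib sum_subtractf)
  qed
  have sw: "(\<Sum>a<p. \<Sum>b<p. c a * c b * ?D a l j b) = (\<Sum>a<p. \<Sum>b<p. c a * c b * ?D l b a j)"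
    if "l < p" "j < p" for l j
    by (subst sum.swap, intro sum.cong refl) (use that comm psi_smooth in \<open>simp add: mult.commute\<close>)
  have "2 * jac_form p \<psi> x c l j = 2 * jac_form p \<psi> x c j l"
    unfolding s2[OF lj] s2[OF lj(2,1)] sw[OF lj] sw[OF lj(2,1)]
    using comm[OF lj] psi_smooth[OF _ _ lj] by simp
  then show ?thesis by simp
qed

end

text \<open>\<open>J(v)v = R(v, v)v = 0\<close>.\<close>

lemma jac_form_kernel: "(\<Sum>j<p. jac_form p \<psi> x c l j * c j) = 0"
proof -
  let ?S = "\<Sum>j<p. \<Sum>a<p. \<Sum>b<p. c j * c a * c b * psi_riemann \<psi> x l j a b"
  have "?S = (\<Sum>a<p. \<Sum>j<p. \<Sum>b<p. c j * c a * c b * psi_riemann \<psi> x l j a b)" by (rule sum.swap)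
  also have "\<dots> = (\<Sum>a<p. \<Sum>j<p. \<Sum>b<p. - (c a * c j * c b * psi_riemann \<psi> x l a j b))"
    by (intro sum.cong refl) (simp add: psi_riemann_def algebra_simps)
  also have "\<dots> = - ?S" by (simp add: sum_negf)
  finally have "?S = 0" by simp
  then show ?thesis by (simp add: jac_form_def sum_distrib_left sum_distrib_right mult_ac)
qed

lemma jac_form_scale: "jac_form p \<psi> x (\<lambda>a. t * c a) l j = t\<^sup>2 * jac_form p \<psi> x c l j"
  by (simp add: jac_form_def sum_distrib_left power2_eq_square mult_ac)

lemma jac_form_cong: "(\<And>a. a < p \<Longrightarrow> c a = d a) \<Longrightarrow> jac_form p \<psi> x c l j = jac_form p \<psi> x d l j"
  unfolding jac_form_def by (intro sum.cong refl) simp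

lemma jac_form_zero: "(\<And>a. a < p \<Longrightarrow> c a = 0) \<Longrightarrow> jac_form p \<psi> x c l j = 0"
  unfolding jac_form_def by (intro sum.neutral) simp

section \<open>Orthonormal families for an indefinite scalar product\<close>

text \<open>The vanishing of a determinant with a zero row. Most dimension counts below are instances of this
  fact.\<close>

lemma underdetermined_system:
  fixes a :: "nat \<Rightarrow> nat \<Rightarrow> real"
  assumes "m < n"
  shows "\<exists>c. (\<exists>i<n. c i \<noteq> 0) \<and> (\<forall>k<m. (\<Sum>i<n. a k i * c i) = 0)"
proof -
  define M where "M = mat n n (\<lambda>(k, i). if k < m then a k i else 0)"
  have M: "M \<in> carrier_mat n n" by (simp add: M_def)
  have "transpose_mat M *\<^sub>v unit_vec n (n - 1) = 0\<^sub>v n"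
    using assms by (intro eq_vecI) (auto simp: M_def scalar_prod_def)
  moreover have "unit_vec n (n - 1) \<noteq> (0\<^sub>v n :: real vec)" using assms by simp
  ultimately have "det (transpose_mat M) = 0"
    using M by (subst det_0_iff_vec_prod_zero[of _ n]) (auto intro!: exI[of _ "unit_vec n (n - 1)"])
  then have "det M = 0" using det_transpose[OF M] by simp
  then obtain v where v: "v \<in> carrier_vec n" "v \<noteq> 0\<^sub>v n" "M *\<^sub>v v = 0\<^sub>v n"
    using det_0_iff_vec_prod_zero[OF M] by auto
  have "\<exists>i<n. v $ i \<noteq> 0" using v by (metis eq_vecI carrier_vecD index_zero_vec)
  moreover have "(\<Sum>i<n. a k i * v $ i) = 0" if "k < m" for k
  proof -
    have "(M *\<^sub>v v) $ k = (\<Sum>i<n. a k i * v $ i)"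
      using that assms v(1) by (simp add: M_def scalar_prod_def atLeast0LessThan)
    then show ?thesis using v that assms by simp
  qed
  ultimately show ?thesis by blast
qed

definition orthonormal :: "nat \<Rightarrow> real mat \<Rightarrow> real vec list \<Rightarrow> bool" where
  "orthonormal n G es \<longleftrightarrow> set es \<subseteq> carrier_vec n \<and>
     (\<forall>i<length es. gip G (es ! i) (es ! i) \<in> {-1, 1}) \<and>
     (\<forall>i<length es. \<forall>j<length es. i \<noteq> j \<longrightarrow> gip G (es ! i) (es ! j) = 0)"

text \<open>The bivector \<open>\<Sum> \<epsilon>\<^sub>i e\<^sub>i \<otimes> e\<^sub>i\<close>. A higher order Jacobi operator depends on the orthonormal basis
  only through it.\<close>

definition gram_sum :: "nat \<Rightarrow> real mat \<Rightarrow> real vec list \<Rightarrow> real mat" where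
  "gram_sum n G es = mat n n (\<lambda>(i, j). \<Sum>e\<leftarrow>es. gip G e e * (e $ i * e $ j))"

lemma gip_mat_of_cols:
  assumes "G \<in> carrier_mat n n" "set es \<subseteq> carrier_vec n" "w \<in> carrier_vec n" "y \<in> carrier_vec (length es)"
  shows "gip G w (mat_of_cols n es *\<^sub>v y) = (\<Sum>k<length es. gip G w (es ! k) * y $ k)"
proof -
  have E: "mat_of_cols n es \<in> carrier_mat n (length es)" by simp
  let ?g = "transpose_mat G *\<^sub>v w"
  have g: "?g \<in> carrier_vec n" using assms by simp
  have gip: "gip G w v = ?g \<bullet> v" if "v \<in> carrier_vec n" for v
    unfolding gip_def using transpose_vec_mult_scalar[OF assms(1) that assms(3)] by simp
  have "gip G w (mat_of_cols n es *\<^sub>v y) = ?g \<bullet> (mat_of_cols n es *\<^sub>v y)"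
    using assms by (intro gip mult_mat_vec_carrier[OF E])
  also have "\<dots> = (transpose_mat (mat_of_cols n es) *\<^sub>v ?g) \<bullet> y"
    using transpose_vec_mult_scalar[OF E assms(4) g] by simp
  also have "\<dots> = (\<Sum>k<length es. (es ! k \<bullet> ?g) * y $ k)"
  proof -
    have "(transpose_mat (mat_of_cols n es) *\<^sub>v ?g) $ k = es ! k \<bullet> ?g" if "k < length es" for k
    proof -
      have "es ! k \<in> carrier_vec n" using assms(2) that by auto
      then show ?thesis using that by (simp add: col_mat_of_cols)
    qed
    then show ?thesis using assms(4) by (simp add: scalar_prod_def[of _ y] atLeast0LessThan)
  qed
  also have "\<dots> = (\<Sum>k<length es. gip G w (es ! k) * y $ k)"
    using assms(2) g by (intro sum.cong refl) (metis comm_scalar_prod gip lessThan_iff nth_mem subsetD)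
  finally show ?thesis .
qed

context
  fixes n :: nat and G :: "real mat"
  assumes G: "G \<in> carrier_mat n n" and Gsym: "transpose_mat G = G"
begin

lemma gip_commute: "v \<in> carrier_vec n \<Longrightarrow> w \<in> carrier_vec n \<Longrightarrow> gip G v w = gip G w v"
  unfolding gip_def
  by (metis G Gsym comm_scalar_prod mult_mat_vec_carrier transpose_vec_mult_scalar)

lemma gip_add_right:
  "v \<in> carrier_vec n \<Longrightarrow> w \<in> carrier_vec n \<Longrightarrow> x \<in> carrier_vec n \<Longrightarrow>
   gip G x (v + w) = gip G x v + gip G x w"
  unfolding gip_def using G by (simp add: mult_add_distrib_mat_vec[OF G] scalar_prod_add_distrib[of _ n])

lemma gip_smult_right:
  "v \<in> carrier_vec n \<Longrightarrow> x \<in> carrier_vec n \<Longrightarrow> gip G x (c \<cdot>\<^sub>v v) = c * gip G x v"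
  unfolding gip_def using G by (simp add: mult_mat_vec[OF G])

lemma gip_add_left:
  "v \<in> carrier_vec n \<Longrightarrow> w \<in> carrier_vec n \<Longrightarrow> x \<in> carrier_vec n \<Longrightarrow>
   gip G (v + w) x = gip G v x + gip G w x"
  using gip_commute gip_add_right by simp

lemma gip_smult_left:
  "v \<in> carrier_vec n \<Longrightarrow> x \<in> carrier_vec n \<Longrightarrow> gip G (c \<cdot>\<^sub>v v) x = c * gip G v x"
  using gip_commute gip_smult_right by simp

lemma orthonormal_gip:
  assumes "orthonormal n G es" "i < length es" "j < length es"
  shows "gip G (es ! i) (es ! j) = (if i = j then gip G (es ! i) (es ! i) else 0)"
  using assms unfolding orthonormal_def by presburger

lemma orthonormal_gip_square:
  assumes "orthonormal n G es" "i < length es"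
  shows "gip G (es ! i) (es ! i) * gip G (es ! i) (es ! i) = 1"
proof -
  have "gip G (es ! i) (es ! i) \<in> {-1, 1}" using assms by (auto simp: orthonormal_def)
  then show ?thesis by auto
qed

lemma orthonormal_coordinate:
  assumes "orthonormal n G es" "k < length es" "y \<in> carrier_vec (length es)"
  shows "gip G (es ! k) (mat_of_cols n es *\<^sub>v y) = gip G (es ! k) (es ! k) * y $ k"
proof -
  have es: "set es \<subseteq> carrier_vec n" using assms by (simp add: orthonormal_def)
  then have "es ! k \<in> carrier_vec n" using assms(2) by auto
  then have "gip G (es ! k) (mat_of_cols n es *\<^sub>v y) = (\<Sum>l<length es. gip G (es ! k) (es ! l) * y $ l)"
    by (intro gip_mat_of_cols G es assms)
  also have "\<dots> = (\<Sum>l<length es. if l = k then gip G (es ! k) (es ! k) * y $ l else 0)"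
  proof (intro sum.cong refl)
    fix l assume "l \<in> {..<length es}"
    then show "gip G (es ! k) (es ! l) * y $ l = (if l = k then gip G (es ! k) (es ! k) * y $ l else 0)"
      using orthonormal_gip[OF assms(1,2), of l] by (cases "l = k") simp_all
  qed
  finally show ?thesis using assms(2) by simp
qed

lemma orthonormal_norm:
  assumes "orthonormal n G es" "y \<in> carrier_vec (length es)"
  shows "gip G (mat_of_cols n es *\<^sub>v y) (mat_of_cols n es *\<^sub>v y) =
    (\<Sum>k<length es. gip G (es ! k) (es ! k) * (y $ k)\<^sup>2)"
proof -
  have es: "set es \<subseteq> carrier_vec n" using assms by (simp add: orthonormal_def)
  have E: "mat_of_cols n es *\<^sub>v y \<in> carrier_vec n" using assms(2)
    by (intro mult_mat_vec_carrier[of _ _ "length es"]) auto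
  have "gip G (mat_of_cols n es *\<^sub>v y) (es ! k) = gip G (es ! k) (es ! k) * y $ k" if "k < length es" for k
    using orthonormal_coordinate[OF assms(1) that assms(2)] gip_commute[OF E, of "es ! k"] es that
    by (metis nth_mem subsetD)
  then show ?thesis
    unfolding gip_mat_of_cols[OF G es E assms(2)] by (simp add: power2_eq_square mult.assoc)
qed

lemma gram_sum_carrier [simp]: "gram_sum n G es \<in> carrier_mat n n"
  by (simp add: gram_sum_def)

lemma gram_sum_transpose: "transpose_mat (gram_sum n G es) = gram_sum n G es"
  by (rule eq_matI) (auto simp: gram_sum_def mult.commute)

lemma gram_sum_index:
  assumes "i < n" "j < n"
  shows "gram_sum n G es $$ (i, j) = (\<Sum>k<length es. gip G (es ! k) (es ! k) * (es ! k $ i * es ! k $ j))"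
  using assms by (simp add: gram_sum_def sum_list_sum_nth atLeast0LessThan)

definition sign_mat :: "real vec list \<Rightarrow> real mat" where
  "sign_mat es = mat (length es) (length es) (\<lambda>(i, j). if i = j then gip G (es ! i) (es ! i) else 0)"

lemma sign_mat_carrier [simp]: "sign_mat es \<in> carrier_mat (length es) (length es)"
  by (simp add: sign_mat_def)

lemma sign_mat_square: "orthonormal n G es \<Longrightarrow> sign_mat es * sign_mat es = 1\<^sub>m (length es)"
proof (rule eq_matI, goal_cases)
  case (1 i j)
  then have "(sign_mat es * sign_mat es) $$ (i, j) =
    (\<Sum>k<length es. sign_mat es $$ (i, k) * sign_mat es $$ (k, j))"
    by (simp add: sign_mat_def scalar_prod_def atLeast0LessThan)
  also have "\<dots> = (\<Sum>k<length es. if k = i then if i = j then 1 else 0 else 0)"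
    by (intro sum.cong refl) (use 1 orthonormal_gip_square in \<open>auto simp: sign_mat_def\<close>)
  finally show ?case using 1 by simp
qed (auto simp: sign_mat_def)

lemma gram_sum_factor:
  assumes "orthonormal n G es"
  shows "gram_sum n G es = mat_of_cols n es * sign_mat es * transpose_mat (mat_of_cols n es)"
proof (rule eq_matI)
  let ?E = "mat_of_cols n es"
  fix i j assume "i < dim_row (?E * sign_mat es * transpose_mat ?E)" "j < dim_col (?E * sign_mat es * transpose_mat ?E)"
  then have ij: "i < n" "j < n" by auto
  have ED: "(?E * sign_mat es) $$ (i, k) = gip G (es ! k) (es ! k) * es ! k $ i" if "k < length es" for k
  proof -
    have "(?E * sign_mat es) $$ (i, k) = (\<Sum>l<length es. es ! l $ i * (if l = k then gip G (es ! l) (es ! l) else 0))"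
      using ij that by (simp add: scalar_prod_def sign_mat_def mat_of_cols_def atLeast0LessThan)
    also have "\<dots> = (\<Sum>l<length es. if l = k then gip G (es ! l) (es ! l) * es ! l $ i else 0)"
      by (intro sum.cong) auto
    finally show ?thesis using that by simp
  qed
  have "(?E * sign_mat es * transpose_mat ?E) $$ (i, j) =
    (\<Sum>k<length es. (?E * sign_mat es) $$ (i, k) * transpose_mat ?E $$ (k, j))"
    using ij by (simp add: scalar_prod_def atLeast0LessThan sign_mat_def)
  also have "\<dots> = (\<Sum>k<length es. gip G (es ! k) (es ! k) * (es ! k $ i * es ! k $ j))"
  proof (intro sum.cong refl)
    fix k assume k: "k \<in> {..<length es}"
    then have "transpose_mat ?E $$ (k, j) = es ! k $ j" using ij by (simp add: mat_of_cols_def)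
    then show "(?E * sign_mat es) $$ (i, k) * transpose_mat ?E $$ (k, j) =
      gip G (es ! k) (es ! k) * (es ! k $ i * es ! k $ j)" using ED k by simp
  qed
  finally show "gram_sum n G es $$ (i, j) = (?E * sign_mat es * transpose_mat ?E) $$ (i, j)"
    by (simp add: gram_sum_index[OF ij])
qed (auto simp: gram_sum_def)

lemma orthonormal_gram:
  assumes "orthonormal n G es"
  shows "transpose_mat (mat_of_cols n es) * (G * mat_of_cols n es) = sign_mat es"
proof (rule eq_matI)
  let ?E = "mat_of_cols n es"
  have es: "set es \<subseteq> carrier_vec n" using assms by (simp add: orthonormal_def)
  fix i j assume "i < dim_row (sign_mat es)" "j < dim_col (sign_mat es)"
  then have ij: "i < length es" "j < length es" by (auto simp: sign_mat_def)
  have c: "col ?E k = es ! k" if "k < length es" for k using es that by (simp add: col_mat_of_cols subset_code(1))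
  have "(transpose_mat ?E * (G * ?E)) $$ (i, j) = col ?E i \<bullet> col (G * ?E) j" using ij G by simp
  also have "\<dots> = gip G (es ! i) (es ! j)"
    using ij G by (simp add: gip_def c col_mult2[of _ n n _ "length es"])
  finally show "(transpose_mat ?E * (G * ?E)) $$ (i, j) = sign_mat es $$ (i, j)"
    using orthonormal_gip[OF assms ij] ij by (simp add: sign_mat_def)
qed (auto simp: sign_mat_def)

text \<open>After lowering an index, \<open>gram_sum\<close> is the orthogonal projection onto the span of the family.\<close>

lemma gram_sum_projection:
  assumes "orthonormal n G es"
  shows "gram_sum n G es * (G * mat_of_cols n es) = mat_of_cols n es"
proof -
  let ?E = "mat_of_cols n es" and ?D = "sign_mat es"
  have E: "?E \<in> carrier_mat n (length es)" "transpose_mat ?E \<in> carrier_mat (length es) n" by auto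
  have GE: "G * ?E \<in> carrier_mat n (length es)" using G by auto
  have "gram_sum n G es * (G * ?E) = (?E * ?D) * (transpose_mat ?E * (G * ?E))"
    unfolding gram_sum_factor[OF assms] by (rule assoc_mult_mat[OF mult_carrier_mat[OF E(1) sign_mat_carrier] E(2) GE])
  also have "\<dots> = ?E * (?D * ?D)"
    unfolding orthonormal_gram[OF assms] by (rule assoc_mult_mat[OF E(1) sign_mat_carrier sign_mat_carrier])
  finally show ?thesis using E(1) by (simp add: sign_mat_square[OF assms])
qed

lemma in_span_mat_of_cols:
  assumes "set es \<subseteq> carrier_vec n"
    and "w \<in> LinearCombinations.module.span class_ring (module_vec TYPE(real) n) (set es)"
  shows "\<exists>c \<in> carrier_vec (length es). w = mat_of_cols n es *\<^sub>v c"
proof -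
  interpret vec_space "TYPE(real)" n .
  from assms(2) obtain f where "w = lincomb_list f es"
    unfolding span_list_as_span[OF assms(1), symmetric] span_list_def by auto
  then have "w = mat_of_cols n es *\<^sub>v vec (length es) f"
    using lincomb_list_as_mat_mult[of es f] assms(1) by (metis carrier_vecD subsetD)
  then show ?thesis by auto
qed

lemma gram_sum_fixes_span:
  assumes "orthonormal n G es" "orthonormal n G es'"
    and "LinearCombinations.module.span class_ring (module_vec TYPE(real) n) (set es) =
      LinearCombinations.module.span class_ring (module_vec TYPE(real) n) (set es')"
  shows "gram_sum n G es * G * gram_sum n G es' = gram_sum n G es'"
proof -
  interpret vec_space "TYPE(real)" n .
  let ?E = "mat_of_cols n es" and ?E' = "mat_of_cols n es'" and ?T = "gram_sum n G es"
  let ?F = "sign_mat es' * transpose_mat ?E'"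
  have es: "set es \<subseteq> carrier_vec n" and es': "set es' \<subseteq> carrier_vec n"
    using assms by (simp_all add: orthonormal_def)
  have "\<exists>c. c \<in> carrier_vec (length es) \<and> es' ! k = ?E *\<^sub>v c" if "k < length es'" for k
  proof -
    have "es' ! k \<in> span (set es')" using that in_own_span[OF es'] by auto
    then show ?thesis using in_span_mat_of_cols[OF es, of "es' ! k"] assms(3) by auto
  qed
  then obtain c where c: "\<And>k. k < length es' \<Longrightarrow> c k \<in> carrier_vec (length es) \<and> es' ! k = ?E *\<^sub>v c k"
    by metis
  define C where "C = mat_of_cols (length es) (map c [0..<length es'])"
  have C: "C \<in> carrier_mat (length es) (length es')"
    using mat_of_cols_carrier(1)[of "length es" "map c [0..<length es']"] by (simp add: C_def)
  have E: "?E \<in> carrier_mat n (length es)" and E': "?E' \<in> carrier_mat n (length es')" by auto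
  have EC: "?E' = ?E * C"
  proof (rule mat_col_eqI)
    fix k assume "k < dim_col (?E * C)"
    then have k: "k < length es'" using C by simp
    have "col (?E * C) k = ?E *\<^sub>v col C k" by (rule col_mult2[OF E C k])
    also have "col C k = c k" using k c[OF k] by (simp add: C_def col_mat_of_cols)
    finally show "col ?E' k = col (?E * C) k"
    proof -
      have "es' ! k \<in> carrier_vec n" using k es' by auto
      then show ?thesis using k c[OF k] \<open>col (?E * C) k = _\<close> \<open>col C k = c k\<close> by (simp add: col_mat_of_cols)
    qed
  qed (use C in auto)
  have TG: "?T * G \<in> carrier_mat n n" by (rule mult_carrier_mat[OF gram_sum_carrier G])
  have GE: "G * ?E \<in> carrier_mat n (length es)" using G by auto
  have TGE: "?T * G * ?E = ?E"
    using gram_sum_projection[OF assms(1)] assoc_mult_mat[OF gram_sum_carrier G E, of es] by simp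
  have TGE': "?T * G * ?E' = ?E'"
    unfolding EC using assoc_mult_mat[OF TG E C] TGE by simp
  have T': "gram_sum n G es' = ?E' * ?F"
    unfolding gram_sum_factor[OF assms(2)] by (rule assoc_mult_mat) auto
  have F: "?F \<in> carrier_mat (length es') n" by (auto intro: mult_carrier_mat[OF sign_mat_carrier])
  show ?thesis
    unfolding T' assoc_mult_mat[OF TG E' F, symmetric] TGE' ..
qed

text \<open>If \<open>T\<close> and \<open>T'\<close> belong to two orthonormal bases of one subspace, each fixes the other:
  \<open>T G T' = T'\<close> and \<open>T' G T = T\<close>. Transposition turns the second equation into \<open>T G T' = T\<close>. So
  the higher order Jacobi operator is well defined.\<close>

lemma gram_sum_span_eq:
  assumes "orthonormal n G es" "orthonormal n G es'"
    and "LinearCombinations.module.span class_ring (module_vec TYPE(real) n) (set es) =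
      LinearCombinations.module.span class_ring (module_vec TYPE(real) n) (set es')"
  shows "gram_sum n G es = gram_sum n G es'"
proof -
  let ?T = "gram_sum n G es" and ?T' = "gram_sum n G es'"
  have "?T = transpose_mat (?T' * G * ?T)"
    using gram_sum_fixes_span[OF assms(2,1) assms(3)[symmetric]] by (simp add: gram_sum_transpose)
  also have "\<dots> = transpose_mat ?T * transpose_mat (?T' * G)"
    by (rule transpose_mult[OF mult_carrier_mat[OF gram_sum_carrier G] gram_sum_carrier])
  also have "transpose_mat (?T' * G) = transpose_mat G * transpose_mat ?T'"
    by (rule transpose_mult[OF gram_sum_carrier G])
  also have "transpose_mat ?T * (transpose_mat G * transpose_mat ?T') = ?T * G * ?T'"
    by (simp add: gram_sum_transpose Gsym assoc_mult_mat[OF gram_sum_carrier G gram_sum_carrier])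
  also have "\<dots> = ?T'" by (rule gram_sum_fixes_span[OF assms])
  finally show ?thesis .
qed

text \<open>Let \<open>E\<close> have the basis as columns. If its Gram matrix \<open>D = E\<^sup>T G E\<close> satisfies \<open>D\<^sup>2 = 1\<close>, then
  \<open>D E\<^sup>T G\<close> inverts \<open>E\<close> from the left, hence also from the right.\<close>

lemma gram_sum_full:
  assumes "orthonormal n G es" "length es = n"
  shows "gram_sum n G es * G = 1\<^sub>m n"
proof -
  let ?E = "mat_of_cols n es" and ?D = "sign_mat es"
  have E: "?E \<in> carrier_mat n n" "transpose_mat ?E \<in> carrier_mat n n" using assms(2) by auto
  have D: "?D \<in> carrier_mat n n" using sign_mat_carrier[of es] assms(2) by simp
  have DE: "?D * transpose_mat ?E \<in> carrier_mat n n" using D E by auto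
  have "(?D * transpose_mat ?E * G) * ?E = ?D * (transpose_mat ?E * (G * ?E))"
    using assoc_mult_mat[OF DE G E(1)] assoc_mult_mat[OF D E(2), of "G * ?E" n] G E by simp
  then have "(?D * transpose_mat ?E * G) * ?E = 1\<^sub>m n"
    using orthonormal_gram[OF assms(1)] sign_mat_square[OF assms(1)] assms(2) by simp
  then have "?E * (?D * transpose_mat ?E * G) = 1\<^sub>m n"
    by (rule mat_mult_left_right_inverse[rotated 2]) (use DE G E in auto)
  then show ?thesis
    unfolding gram_sum_factor[OF assms(1)]
    using assoc_mult_mat[OF E(1) D E(2)] assoc_mult_mat[OF E(1) DE G] by simp
qed

lemma orthonormal_length:
  assumes "orthonormal n G es"
  shows "length es \<le> n"
proof (rule ccontr)
  assume "\<not> length es \<le> n"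
  then obtain c where c: "\<exists>i<length es. c i \<noteq> 0" "\<And>k. k < n \<Longrightarrow> (\<Sum>i<length es. es ! i $ k * c i) = 0"
    using underdetermined_system[of n "length es" "\<lambda>k i. es ! i $ k"] by auto
  let ?y = "vec (length es) c"
  have zero: "mat_of_cols n es *\<^sub>v ?y = 0\<^sub>v n"
  proof (rule eq_vecI)
    fix k assume "k < dim_vec (0\<^sub>v n :: real vec)"
    then have k: "k < n" by simp
    then have "(mat_of_cols n es *\<^sub>v ?y) $ k = (\<Sum>i<length es. es ! i $ k * c i)"
      by (simp add: scalar_prod_def mat_of_cols_def atLeast0LessThan)
    then show "(mat_of_cols n es *\<^sub>v ?y) $ k = 0\<^sub>v n $ k" using c(2)[OF k] k by simp
  qed simp
  from c(1) obtain i where i: "i < length es" "c i \<noteq> 0" by blast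
  have ei: "es ! i \<in> carrier_vec n" using assms i by (auto simp: orthonormal_def)
  have "gip G (es ! i) (es ! i) * c i = 0"
  proof -
    have "(0 :: real) \<cdot>\<^sub>v 0\<^sub>v n = 0\<^sub>v n" by (rule eq_vecI) auto
    then have "gip G (es ! i) (0\<^sub>v n) = 0" using gip_smult_right[of "0\<^sub>v n" "es ! i" 0] ei by simp
    then show ?thesis using orthonormal_coordinate[OF assms i(1), of ?y] i(1) zero by simp
  qed
  then show False using orthonormal_gip_square[OF assms i(1)] i(2) by auto
qed

lemma orthonormal_snoc:
  assumes "orthonormal n G es" "f \<in> carrier_vec n" "gip G f f \<in> {-1, 1}"
    and "\<And>e. e \<in> set es \<Longrightarrow> gip G e f = 0"
  shows "orthonormal n G (es @ [f])"
proof -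
  have es: "set es \<subseteq> carrier_vec n" using assms by (simp add: orthonormal_def)
  have "gip G f (es ! i) = 0" if "i < length es" for i
  proof -
    have "es ! i \<in> set es" "es ! i \<in> carrier_vec n" using that es by (auto simp: subset_iff)
    then show ?thesis using gip_commute[OF assms(2), of "es ! i"] assms(4)[of "es ! i"] by simp
  qed
  then show ?thesis
    using assms es by (auto simp: orthonormal_def nth_append less_Suc_eq)
qed

text \<open>The step of Gram-Schmidt for an indefinite scalar product. A nonzero \<open>w\<close> orthogonal to the family
  may be null, but then some \<open>z'\<close> orthogonal to the family pairs nontrivially with \<open>w\<close>, and one of
  \<open>w\<close>, \<open>z'\<close>, \<open>w + z'\<close> is not null.\<close>

lemma orthonormal_extend_one:
  assumes H: "H \<in> carrier_mat n n" "G * H = 1\<^sub>m n"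
    and on: "orthonormal n G es" and len: "length es < n"
  shows "\<exists>f. orthonormal n G (es @ [f])"
proof -
  have es: "set es \<subseteq> carrier_vec n" using on by (simp add: orthonormal_def)
  then have esk: "es ! k \<in> carrier_vec n" if "k < length es" for k using that by auto
  obtain c where c: "\<exists>i<n. c i \<noteq> 0" "\<And>k. k < length es \<Longrightarrow> (\<Sum>i<n. (G *\<^sub>v (es ! k)) $ i * c i) = 0"
    using underdetermined_system[OF len, of "\<lambda>k i. (G *\<^sub>v (es ! k)) $ i"] by auto
  define w where "w = vec n c"
  have w: "w \<in> carrier_vec n" by (simp add: w_def)
  have w_orth: "gip G (es ! k) w = 0" if "k < length es" for k
  proof -
    have "gip G (es ! k) w = gip G w (es ! k)" by (rule gip_commute[OF esk[OF that] w])
    also have "\<dots> = (\<Sum>i<n. (G *\<^sub>v (es ! k)) $ i * c i)"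
      using G esk[OF that] by (simp add: gip_def scalar_prod_def w_def atLeast0LessThan mult.commute)
    finally show ?thesis using c(2)[OF that] by simp
  qed
  obtain i where i: "i < n" "c i \<noteq> 0" using c(1) by blast
  define z where "z = H *\<^sub>v unit_vec n i"
  have z: "z \<in> carrier_vec n" using H by (simp add: z_def)
  have "G *\<^sub>v z = unit_vec n i"
    unfolding z_def using assoc_mult_mat_vec[OF G H(1), of "unit_vec n i"] H(2) by simp
  then have wz: "gip G w z = c i" using i by (simp add: gip_def w_def)
  define y where "y = vec (length es) (\<lambda>k. gip G (es ! k) (es ! k) * gip G (es ! k) z)"
  \<comment> \<open>the component of \<open>z\<close> orthogonal to the family; it still pairs with \<open>w\<close> as \<open>z\<close> does\<close>
  define z' where "z' = z + (- 1) \<cdot>\<^sub>v (mat_of_cols n es *\<^sub>v y)"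
  have Ey: "mat_of_cols n es *\<^sub>v y \<in> carrier_vec n"
    by (rule mult_mat_vec_carrier[of _ _ "length es"]) (auto simp: y_def)
  have z': "z' \<in> carrier_vec n" using z Ey by (simp add: z'_def)
  have gip_z': "gip G x z' = gip G x z - gip G x (mat_of_cols n es *\<^sub>v y)" if "x \<in> carrier_vec n" for x
    unfolding z'_def using that z Ey by (simp add: gip_add_right gip_smult_right)
  have z'_orth: "gip G (es ! k) z' = 0" if "k < length es" for k
    using orthonormal_coordinate[OF on that, of y] that gip_z'[OF esk[OF that]] orthonormal_gip_square[OF on that]
    by (simp add: y_def mult.assoc[symmetric])
  have "gip G w (mat_of_cols n es *\<^sub>v y) = 0"
    unfolding gip_mat_of_cols[OF G es w, of y, unfolded y_def, simplified]
    using gip_mat_of_cols[OF G es w, of y] w_orth gip_commute[OF w esk] by (simp add: y_def)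
  then have wz': "gip G w z' = c i" using gip_z'[OF w] wz by simp
  have "\<exists>f \<in> carrier_vec n. gip G f f \<noteq> 0 \<and> (\<forall>k<length es. gip G (es ! k) f = 0)"
  proof (cases "gip G w w = 0 \<and> gip G z' z' = 0")
    case True
    have "gip G (w + z') (w + z') = gip G w w + 2 * gip G w z' + gip G z' z'"
      using w z' gip_commute[OF w z'] by (simp add: gip_add_left gip_add_right)
    then have "gip G (w + z') (w + z') \<noteq> 0" using True wz' i by simp
    moreover have "gip G (es ! k) (w + z') = 0" if "k < length es" for k
      using w_orth[OF that] z'_orth[OF that] gip_add_right[OF w z' esk[OF that]] by simp
    ultimately show ?thesis using w z' by (intro bexI[of _ "w + z'"]) auto
  qed (use w z' w_orth z'_orth in blast)
  then obtain f where f: "f \<in> carrier_vec n" "gip G f f \<noteq> 0" "\<And>k. k < length es \<Longrightarrow> gip G (es ! k) f = 0"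
    by blast
  define a where "a = 1 / sqrt \<bar>gip G f f\<bar>"
  have "gip G (a \<cdot>\<^sub>v f) (a \<cdot>\<^sub>v f) = gip G f f / \<bar>gip G f f\<bar>"
    using f(1) by (simp add: gip_smult_left gip_smult_right a_def field_simps)
  also have "\<dots> \<in> {-1, 1}" using f(2) by (auto simp: abs_if)
  finally have "gip G (a \<cdot>\<^sub>v f) (a \<cdot>\<^sub>v f) \<in> {-1, 1}" .
  moreover have "gip G e (a \<cdot>\<^sub>v f) = 0" if "e \<in> set es" for e
    using that f esk by (auto simp: in_set_conv_nth gip_smult_right)
  ultimately have "orthonormal n G (es @ [a \<cdot>\<^sub>v f])"
    using f(1) by (intro orthonormal_snoc[OF on]) auto
  then show ?thesis by blast
qed

lemma orthonormal_extend:
  assumes H: "H \<in> carrier_mat n n" "G * H = 1\<^sub>m n"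
    and "orthonormal n G es"
  shows "\<exists>fs. orthonormal n G (es @ fs) \<and> length (es @ fs) = n"
  using assms(3)
proof (induction "n - length es" arbitrary: es)
  case 0
  then show ?case using orthonormal_length[OF 0(2)] by (intro exI[of _ "[]"]) auto
next
  case (Suc k)
  then obtain f where f: "orthonormal n G (es @ [f])"
  proof -
    have "length es < n" using Suc.hyps(2) by linarith
    from orthonormal_extend_one[OF H Suc.prems this] show ?thesis using that by blast
  qed
  then obtain fs where "orthonormal n G ((es @ [f]) @ fs)" "length ((es @ [f]) @ fs) = n"
  proof -
    have "k = n - length (es @ [f])" using Suc.hyps(2) by simp
    from Suc.hyps(1)[OF this f] show ?thesis using that by blast
  qed
  then show ?case by (intro exI[of _ "f # fs"]) auto
qed

end

lemma orthonormal_basis_iff: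
  "orthonormal_basis n G \<pi> es \<longleftrightarrow> orthonormal n G es \<and>
     LinearCombinations.module.span class_ring (module_vec TYPE(real) n) (set es) = \<pi>"
  by (auto simp: orthonormal_basis_def orthonormal_def)

lemma length_filter_partition_signs:
  assumes "\<forall>x\<in>set xs. f x \<in> {-1, 1 :: real}"
  shows "length xs = length (filter (\<lambda>x. f x = -1) xs) + length (filter (\<lambda>x. f x = 1) xs)"
  using assms by (induction xs) auto

text \<open>The description by distinct vectors is stable under selecting sublists, in contrast to the one by
  indices.\<close>

lemma orthonormal_iff_distinct:
  "orthonormal n G es \<longleftrightarrow> set es \<subseteq> carrier_vec n \<and> distinct es \<and> (\<forall>e\<in>set es. gip G e e \<in> {-1, 1}) \<and>
     (\<forall>e\<in>set es. \<forall>f\<in>set es. e \<noteq> f \<longrightarrow> gip G e f = 0)" (is "?l \<longleftrightarrow> ?r")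
proof
  assume on: ?l
  have "es ! i \<noteq> es ! j" if "i < length es" "j < length es" "i \<noteq> j" for i j
  proof
    assume eq: "es ! i = es ! j"
    have "gip G (es ! i) (es ! j) = 0" "gip G (es ! i) (es ! i) \<in> {-1, 1}"
      using on that unfolding orthonormal_def by blast+
    then show False using eq by auto
  qed
  then have d: "distinct es" by (simp add: distinct_conv_nth)
  have "gip G e f = 0" if ef: "e \<in> set es" "f \<in> set es" "e \<noteq> f" for e f
  proof -
    obtain i j where ij: "i < length es" "e = es ! i" "j < length es" "f = es ! j"
      using ef by (auto simp: in_set_conv_nth)
    then have "i \<noteq> j" using ef(3) by auto
    then show ?thesis using on ij unfolding orthonormal_def by blast
  qed
  moreover have "gip G e e \<in> {-1, 1}" if "e \<in> set es" for e
    using on that unfolding orthonormal_def in_set_conv_nth by blast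
  ultimately show ?r using d on by (simp add: orthonormal_def)
next
  assume r: ?r
  then have "gip G (es ! i) (es ! j) = 0" if "i < length es" "j < length es" "i \<noteq> j" for i j
    using nth_eq_iff_index_eq[of es i j] nth_mem[OF that(1)] nth_mem[OF that(2)] that by blast
  then show ?l using r unfolding orthonormal_def by (meson nth_mem)
qed

lemma orthonormal_filter: "orthonormal n G es \<Longrightarrow> orthonormal n G (filter P es)"
  unfolding orthonormal_iff_distinct by auto

section \<open>Positive semidefinite forms and their pencils\<close>

text \<open>Symmetric matrices on \<open>\<real>\<^sup>p\<close> are treated as functions of two indices, of which only those below \<open>p\<close>
  count. This makes sums of such matrices and matrix pencils pointwise operations.\<close>

definition form_vec :: "nat \<Rightarrow> (nat \<Rightarrow> nat \<Rightarrow> real) \<Rightarrow> (nat \<Rightarrow> real) \<Rightarrow> nat \<Rightarrow> real" where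
  "form_vec p S x i = (\<Sum>j<p. S i j * x j)"

definition form_val :: "nat \<Rightarrow> (nat \<Rightarrow> nat \<Rightarrow> real) \<Rightarrow> (nat \<Rightarrow> real) \<Rightarrow> (nat \<Rightarrow> real) \<Rightarrow> real" where
  "form_val p S x y = (\<Sum>i<p. y i * form_vec p S x i)"

definition sym_form :: "nat \<Rightarrow> (nat \<Rightarrow> nat \<Rightarrow> real) \<Rightarrow> bool" where
  "sym_form p S \<longleftrightarrow> (\<forall>i<p. \<forall>j<p. S i j = S j i)"

definition psd :: "nat \<Rightarrow> (nat \<Rightarrow> nat \<Rightarrow> real) \<Rightarrow> bool" where
  "psd p S \<longleftrightarrow> sym_form p S \<and> (\<forall>x. 0 \<le> form_val p S x x)"

definition nondeg :: "nat \<Rightarrow> (nat \<Rightarrow> nat \<Rightarrow> real) \<Rightarrow> bool" where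
  "nondeg p S \<longleftrightarrow> (\<forall>x. (\<forall>i<p. form_vec p S x i = 0) \<longrightarrow> (\<forall>i<p. x i = 0))"

lemma form_vec_add: "form_vec p S (\<lambda>i. x i + y i) i = form_vec p S x i + form_vec p S y i"
  by (simp add: form_vec_def algebra_simps sum.distrib)

lemma form_vec_scale: "form_vec p S (\<lambda>i. t * x i) i = t * form_vec p S x i"
  by (simp add: form_vec_def algebra_simps sum_distrib_left)

lemma form_vec_sum_form: "form_vec p (\<lambda>i j. \<Sum>k\<in>K. c k * S k i j) x i = (\<Sum>k\<in>K. c k * form_vec p (S k) x i)"
  unfolding form_vec_def sum_distrib_left sum_distrib_right
  by (subst sum.swap) (simp add: mult.assoc)

lemma form_vec_diff_form: "form_vec p (\<lambda>i j. P i j - t * Q i j) x i = form_vec p P x i - t * form_vec p Q x i"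
  by (simp add: form_vec_def algebra_simps sum_subtractf sum_distrib_left)

lemma form_val_sum_form: "form_val p (\<lambda>i j. \<Sum>k\<in>K. c k * S k i j) x y = (\<Sum>k\<in>K. c k * form_val p (S k) x y)"
  unfolding form_val_def form_vec_sum_form sum_distrib_left by (subst sum.swap) (simp add: mult.left_commute)

lemma form_val_diff_form: "form_val p (\<lambda>i j. P i j - t * Q i j) x y = form_val p P x y - t * form_val p Q x y"
  by (simp add: form_val_def form_vec_diff_form algebra_simps sum_subtractf sum_distrib_left)

lemma form_val_commute:
  assumes "sym_form p S"
  shows "form_val p S x y = form_val p S y x"
proof -
  have "form_val p S x y = (\<Sum>i<p. \<Sum>j<p. y i * (S i j * x j))" by (simp add: form_val_def form_vec_def sum_distrib_left)
  also have "\<dots> = (\<Sum>j<p. \<Sum>i<p. y i * (S i j * x j))" by (rule sum.swap)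
  also have "\<dots> = (\<Sum>j<p. \<Sum>i<p. x j * (S j i * y i))"
    by (intro sum.cong refl) (use assms in \<open>auto simp: sym_form_def\<close>)
  finally show ?thesis by (simp add: form_val_def form_vec_def sum_distrib_left)
qed

lemma form_val_add_scale:
  assumes "sym_form p S"
  shows "form_val p S (\<lambda>i. x i + t * y i) (\<lambda>i. x i + t * y i) = form_val p S x x + 2 * t * form_val p S x y + t\<^sup>2 * form_val p S y y"
proof -
  have "form_val p S (\<lambda>i. x i + t * y i) (\<lambda>i. x i + t * y i) =
    form_val p S x x + t * form_val p S x y + t * form_val p S y x + t\<^sup>2 * form_val p S y y"
    unfolding form_val_def form_vec_add form_vec_scale
    by (simp add: algebra_simps sum.distrib sum_distrib_left power2_eq_square)
  then show ?thesis using form_val_commute[OF assms, of x y] by simp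
qed

text \<open>The form is nonnegative on \<open>x + t y\<close> for all \<open>t\<close>. If \<open>y\<close> is isotropic this is an affine function of
  \<open>t\<close>, otherwise take the minimum at \<open>t = - b / c\<close>.\<close>

lemma form_val_Cauchy_Schwarz:
  assumes "psd p S"
  shows "(form_val p S x y)\<^sup>2 \<le> form_val p S x x * form_val p S y y"
proof -
  let ?a = "form_val p S x x" and ?b = "form_val p S x y" and ?c = "form_val p S y y"
  have q: "0 \<le> ?a + 2 * t * ?b + t\<^sup>2 * ?c" for t
    using assms form_val_add_scale[of p S x t y] unfolding psd_def by metis
  have c: "0 \<le> ?c" using assms by (simp add: psd_def)
  show ?thesis
  proof (cases "?c = 0")
    case True
    have "?b = 0"
    proof (rule ccontr)
      assume "?b \<noteq> 0"
      then have "2 * (- (?a + 1) / (2 * ?b)) * ?b = - (?a + 1)" by simp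
      with q[of "- (?a + 1) / (2 * ?b)"] True show False by simp
    qed
    then show ?thesis using True by simp
  next
    case False
    have "0 \<le> ?c * (?a + 2 * (- ?b / ?c) * ?b + (- ?b / ?c)\<^sup>2 * ?c)"
      by (intro mult_nonneg_nonneg c q)
    also have "\<dots> = ?a * ?c - ?b\<^sup>2" using False by (simp add: field_simps power2_eq_square)
    finally show ?thesis by simp
  qed
qed

lemma form_val_unit: "i < p \<Longrightarrow> form_val p S x (\<lambda>k. if k = i then 1 else 0) = form_vec p S x i"
  using sum.delta[of "{..<p}" i "form_vec p S x"] by (simp add: form_val_def if_distrib[of "\<lambda>c. c * _"] cong: if_cong)

lemma psd_isotropic_kernel:
  assumes "psd p S" "form_val p S x x = 0" "i < p"
  shows "form_vec p S x i = 0"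
  using form_val_Cauchy_Schwarz[OF assms(1), of x "\<lambda>k. if k = i then 1 else 0"] assms(2)
  by (simp add: form_val_unit[OF assms(3)])

lemma kernel_isotropic: "(\<And>i. i < p \<Longrightarrow> form_vec p S x i = 0) \<Longrightarrow> form_val p S x y = 0"
  by (simp add: form_val_def)

text \<open>Solve \<open>S z = t \<delta>\<^sub>i\<close> for the \<open>p + 1\<close> unknowns \<open>(z, t)\<close>; nondegeneracy excludes \<open>t = 0\<close>.\<close>

lemma nondeg_solvable:
  assumes "nondeg p S" "i < p"
  shows "\<exists>z. \<forall>k<p. form_vec p S z k = (if k = i then 1 else 0)"
proof -
  obtain c where c: "\<exists>l<Suc p. c l \<noteq> 0"
    "\<And>k. k < p \<Longrightarrow> (\<Sum>l<Suc p. (if l < p then S k l else if k = i then - 1 else 0) * c l) = 0"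
    using underdetermined_system[of p "Suc p" "\<lambda>k l. if l < p then S k l else if k = i then - 1 else 0"] by auto
  have eq: "form_vec p S c k = (if k = i then c p else 0)" if "k < p" for k
    using c(2)[OF that] by (cases "k = i") (simp_all add: form_vec_def)
  have "c p \<noteq> 0"
  proof
    assume "c p = 0"
    then have "\<forall>k<p. form_vec p S c k = 0" using eq by simp
    then have "\<forall>l<p. c l = 0" using assms(1) by (simp add: nondeg_def)
    then show False using c(1) \<open>c p = 0\<close> by (metis less_Suc_eq)
  qed
  then have "\<forall>k<p. form_vec p S (\<lambda>l. (1 / c p) * c l) k = (if k = i then 1 else 0)"
    by (simp only: form_vec_scale) (simp add: eq)
  then show ?thesis by blast
qed

text \<open>With an explicit constant: if \<open>M z\<^sub>i = \<delta>\<^sub>i\<close>, Cauchy-Schwarz for \<open>M\<close> gives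
  \<open>x\<^sub>i\<^sup>2 = M(z\<^sub>i, x)\<^sup>2 \<le> M(z\<^sub>i, z\<^sub>i) M(x, x)\<close>, which bounds every monomial of \<open>Q(x, x)\<close>.\<close>

lemma definite_dominates:
  assumes M: "psd p M" "nondeg p M"
  shows "\<exists>C>0. \<forall>x. form_val p Q x x \<le> C * form_val p M x x"
proof -
  obtain z where z: "\<And>i k. i < p \<Longrightarrow> k < p \<Longrightarrow> form_vec p M (z i) k = (if k = i then 1 else 0)"
    using nondeg_solvable[OF M(2)] by metis
  define N where "N i = form_val p M (z i) (z i)" for i
  have N: "N i \<ge> 0" for i using M(1) by (simp add: N_def psd_def)
  have coord: "(x i)\<^sup>2 \<le> N i * form_val p M x x" if i: "i < p" for x i
  proof -
    have "form_val p M (z i) x = (\<Sum>k<p. if k = i then x k else 0)"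
      unfolding form_val_def by (intro sum.cong refl) (use z i in simp)
    then have "form_val p M (z i) x = x i" using i by simp
    then show ?thesis using form_val_Cauchy_Schwarz[OF M(1), of "z i" x] by (simp add: N_def)
  qed
  define C where "C = (\<Sum>i<p. \<Sum>j<p. \<bar>Q i j\<bar> * (N i + N j))"
  \<comment> \<open>the added \<open>1\<close> only keeps the constant positive\<close>
  have "form_val p Q x x \<le> (C + 1) * form_val p M x x" for x
  proof -
    have m: "form_val p M x x \<ge> 0" using M(1) by (simp add: psd_def)
    have "form_val p Q x x = (\<Sum>i<p. \<Sum>j<p. x i * (Q i j * x j))" by (simp add: form_val_def form_vec_def sum_distrib_left)
    also have "\<dots> \<le> (\<Sum>i<p. \<Sum>j<p. \<bar>Q i j\<bar> * (N i + N j) * form_val p M x x)"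
    proof (intro sum_mono)
      fix i j assume "i \<in> {..<p}" "j \<in> {..<p}"
      then have "(x i)\<^sup>2 + (x j)\<^sup>2 \<le> (N i + N j) * form_val p M x x"
        using coord[of i x] coord[of j x] by (simp add: algebra_simps)
      moreover have "\<bar>x i * x j\<bar> \<le> (x i)\<^sup>2 + (x j)\<^sup>2"
      proof -
        have "0 \<le> \<bar>x i\<bar> * \<bar>x j\<bar>" by simp
        moreover have "2 * (\<bar>x i\<bar> * \<bar>x j\<bar>) \<le> (x i)\<^sup>2 + (x j)\<^sup>2"
          using sum_squares_bound[of "\<bar>x i\<bar>" "\<bar>x j\<bar>"] by simp
        ultimately show ?thesis unfolding abs_mult by linarith
      qed
      ultimately have "\<bar>Q i j\<bar> * \<bar>x i * x j\<bar> \<le> \<bar>Q i j\<bar> * ((N i + N j) * form_val p M x x)"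
        by (intro mult_left_mono) auto
      moreover have "x i * (Q i j * x j) \<le> \<bar>Q i j\<bar> * \<bar>x i * x j\<bar>"
        by (metis abs_ge_self abs_mult mult.left_commute)
      ultimately show "x i * (Q i j * x j) \<le> \<bar>Q i j\<bar> * (N i + N j) * form_val p M x x" by (simp add: mult.assoc)
    qed
    also have "\<dots> = C * form_val p M x x" by (simp add: C_def sum_distrib_right)
    also have "\<dots> \<le> (C + 1) * form_val p M x x" using m by (simp add: algebra_simps)
    finally show ?thesis .
  qed
  moreover have "C + 1 > 0" using N by (auto simp: C_def intro!: add_nonneg_pos sum_nonneg)
  ultimately show ?thesis by blast
qed

text \<open>Take for \<open>t\<close> the infimum of the Rayleigh quotients \<open>P(x, x) / Q(x, x)\<close>. Then \<open>P - t Q\<close> is still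
  positive semidefinite. If it were nondegenerate it would dominate a multiple of \<open>Q\<close>, and the
  infimum would be larger. On the other hand \<open>P - (t / 2) Q\<close> is half the sum of \<open>P\<close> and
  \<open>P - t Q\<close>, hence positive definite.\<close>

lemma definite_pencil_degenerates:
  assumes P: "psd p P" "nondeg p P" and Q: "psd p Q" "form_val p Q x0 x0 > 0"
  shows "\<exists>t>0. \<not> nondeg p (\<lambda>i j. P i j - t * Q i j) \<and> nondeg p (\<lambda>i j. P i j - t / 2 * Q i j)"
proof -
  define R where "R = {form_val p P x x / form_val p Q x x | x. form_val p Q x x > 0}"
  define t where "t = Inf R"
  have P0: "form_val p P x x \<ge> 0" and Q0: "form_val p Q x x \<ge> 0" for x using P Q by (auto simp: psd_def)
  obtain C where C: "C > 0" "\<And>x. form_val p Q x x \<le> C * form_val p P x x"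
    using definite_dominates[OF P, of Q] by blast
  have R_ne: "R \<noteq> {}" using Q(2) by (auto simp: R_def)
  have R_lower: "r \<ge> 1 / C" if "r \<in> R" for r
    using that C by (auto simp: R_def field_simps)
  have bdd: "bdd_below R" using R_lower by (meson bdd_belowI)
  have "1 / C \<le> t" unfolding t_def using R_lower by (intro cInf_greatest R_ne)
  moreover have "0 < 1 / C" using C(1) by simp
  ultimately have t: "t > 0" by linarith
  let ?M = "\<lambda>i j. P i j - t * Q i j"
  have M0: "form_val p ?M x x \<ge> 0" for x
  proof (cases "form_val p Q x x > 0")
    case True
    then have "t \<le> form_val p P x x / form_val p Q x x" unfolding t_def by (intro cInf_lower bdd) (auto simp: R_def)
    then show ?thesis using True by (simp add: form_val_diff_form field_simps)
  next
    case False
    then have "form_val p Q x x = 0" using Q0[of x] by simp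
    then show ?thesis using P0 by (simp add: form_val_diff_form)
  qed
  then have M: "psd p ?M" using P(1) Q(1) by (auto simp: psd_def sym_form_def)
  have "\<not> nondeg p ?M"
  proof
    assume "nondeg p ?M"
    then obtain D where D: "D > 0" "\<And>x. form_val p Q x x \<le> D * form_val p ?M x x"
      using definite_dominates[OF M, of Q] by blast
    have "t + 1 / D \<le> r" if "r \<in> R" for r
    proof -
      from that obtain x where x: "r = form_val p P x x / form_val p Q x x" "form_val p Q x x > 0" by (auto simp: R_def)
      have "form_val p Q x x \<le> D * (form_val p P x x - t * form_val p Q x x)" using D(2)[of x] by (simp add: form_val_diff_form)
      then have "form_val p Q x x / D + t * form_val p Q x x \<le> form_val p P x x" using D(1) by (simp add: field_simps)
      then show ?thesis unfolding x(1) using x(2) by (simp add: pos_le_divide_eq algebra_simps)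
    qed
    then have "t + 1 / D \<le> t" unfolding t_def[symmetric] using cInf_greatest[OF R_ne, of "t + 1 / D"] t_def by simp
    then show False using D(1) by simp
  qed
  moreover have "nondeg p (\<lambda>i j. P i j - t / 2 * Q i j)"
    unfolding nondeg_def
  proof (rule allI, rule impI)
    fix x assume "\<forall>i<p. form_vec p (\<lambda>i j. P i j - t / 2 * Q i j) x i = 0"
    then have "form_val p (\<lambda>i j. P i j - t / 2 * Q i j) x x = 0" by (intro kernel_isotropic) auto
    then have "form_val p P x x - t / 2 * form_val p Q x x = 0" unfolding form_val_diff_form .
    moreover have "form_val p P x x - t * form_val p Q x x \<ge> 0" using M0[of x] unfolding form_val_diff_form .
    ultimately have "form_val p P x x = 0" using P0[of x] by (simp add: field_simps)
    then have "\<forall>i<p. form_vec p P x i = 0" using psd_isotropic_kernel[OF P(1)] by blast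
    then show "\<forall>i<p. x i = 0" using P(2) by (simp add: nondeg_def)
  qed
  ultimately show ?thesis using t by blast
qed

section \<open>Similarity of nilpotent matrices with a single block\<close>

lemma lower_block_carrier [simp]: "lower_block p n S \<in> carrier_mat n n"
  by (simp add: lower_block_def)

lemma lower_block_dim [simp]: "dim_row (lower_block p n S) = n" "dim_col (lower_block p n S) = n"
  by (simp_all add: lower_block_def)

lemma lower_block_cong: "(\<And>l j. l < p \<Longrightarrow> j < p \<Longrightarrow> S l j = S' l j) \<Longrightarrow> lower_block p n S = lower_block p n S'"
  unfolding lower_block_def by (rule eq_matI) auto

lemma eigenvalues_lower_block: "eigenvalues_of (lower_block p n S) = eigenvalues_of (lower_block p n S')"
proof -
  have "char_poly (map_mat complex_of_real (lower_block p n S)) = (\<Prod>a\<leftarrow>replicate n 0. [:- a, 1:])" for S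
  proof -
    let ?A = "map_mat complex_of_real (lower_block p n S)"
    have A: "?A \<in> carrier_mat n n" by simp
    have ut: "upper_triangular (transpose_mat ?A)"
      by (auto simp: upper_triangular_def lower_block_def)
    have d: "diag_mat (transpose_mat ?A) = replicate n 0"
      by (rule nth_equalityI) (auto simp: diag_mat_def lower_block_def)
    have "char_poly ?A = char_poly (transpose_mat ?A)" using char_poly_transpose_mat[OF A] by simp
    also have "\<dots> = (\<Prod>a\<leftarrow>diag_mat (transpose_mat ?A). [:- a, 1:])"
      by (rule char_poly_upper_triangular[of _ n]) (use A ut in auto)
    finally show ?thesis unfolding d .
  qed
  then show ?thesis by (simp add: eigenvalues_of_def)
qed

abbreviation form_mat :: "nat \<Rightarrow> (nat \<Rightarrow> nat \<Rightarrow> real) \<Rightarrow> real mat" where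
  "form_mat p S \<equiv> mat p p (\<lambda>(i, j). S i j)"

lemma lower_block_four_block:
  "lower_block p (2 * p + w) S = four_block_mat (four_block_mat (0\<^sub>m p p) (0\<^sub>m p p) (form_mat p S) (0\<^sub>m p p))
     (0\<^sub>m (2 * p) w) (0\<^sub>m w (2 * p)) (0\<^sub>m w w)"
  unfolding lower_block_def by (rule eq_matI) auto

text \<open>Conjugation by the block diagonal matrix with blocks \<open>Q'\<close>, \<open>P\<close> and the identity.\<close>

lemma lower_block_similar:
  assumes inv: "P * P' = 1\<^sub>m p" "P' * P = 1\<^sub>m p" "Q * Q' = 1\<^sub>m p" "Q' * Q = 1\<^sub>m p"
    and car: "P \<in> carrier_mat p p" "P' \<in> carrier_mat p p" "Q \<in> carrier_mat p p" "Q' \<in> carrier_mat p p"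
    and eq: "form_mat p S' = P * form_mat p S * Q"
  shows "similar_mat (lower_block p (2 * p + w) S') (lower_block p (2 * p + w) S)"
proof -
  have 1: "similar_mat_wit (0\<^sub>m p p) (0\<^sub>m p p) Q' Q" "similar_mat_wit (0\<^sub>m p p) (0\<^sub>m p p) P P'"
    by (rule similar_mat_witI[of _ _ p]; use inv car in simp)+
  have 2: "similar_mat_wit (four_block_mat (0\<^sub>m p p) (0\<^sub>m p p) (form_mat p S') (0\<^sub>m p p))
      (four_block_mat (0\<^sub>m p p) (0\<^sub>m p p) (form_mat p S) (0\<^sub>m p p))
      (four_block_mat Q' (0\<^sub>m p p) (0\<^sub>m p p) P) (four_block_mat Q (0\<^sub>m p p) (0\<^sub>m p p) P')" (is "similar_mat_wit ?A ?B ?X ?Y")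
    by (rule similar_mat_wit_four_block[OF 1 _ eq]) (use car in auto)
  have c: "?A \<in> carrier_mat (2 * p) (2 * p)" "?B \<in> carrier_mat (2 * p) (2 * p)"
    "?X \<in> carrier_mat (2 * p) (2 * p)" "?Y \<in> carrier_mat (2 * p) (2 * p)"
    using car by auto
  have 3: "similar_mat_wit (0\<^sub>m w w) (0\<^sub>m w w) (1\<^sub>m w) (1\<^sub>m w :: real mat)"
    by (rule similar_mat_witI[of _ _ w]) auto
  have "similar_mat_wit (four_block_mat ?A (0\<^sub>m (2 * p) w) (0\<^sub>m w (2 * p)) (0\<^sub>m w w))
     (four_block_mat ?B (0\<^sub>m (2 * p) w) (0\<^sub>m w (2 * p)) (0\<^sub>m w w))
     (four_block_mat ?X (0\<^sub>m (2 * p) w) (0\<^sub>m w (2 * p)) (1\<^sub>m w))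
     (four_block_mat ?Y (0\<^sub>m (2 * p) w) (0\<^sub>m w (2 * p)) (1\<^sub>m w))"
    by (rule similar_mat_wit_four_block[OF 2 3])
      (use c in \<open>auto simp: left_mult_zero_mat[OF c(4)] right_mult_zero_mat[OF c(3)]\<close>)
  then show ?thesis unfolding lower_block_four_block similar_mat_def by blast
qed

lemma similar_lower_block_uminus:
  assumes "similar_mat (lower_block p n S) (lower_block p n S')"
  shows "similar_mat (lower_block p n (\<lambda>l j. - S l j)) (lower_block p n (\<lambda>l j. - S' l j))"
proof -
  have "lower_block p n (\<lambda>l j. - S l j) = (- 1) \<cdot>\<^sub>m lower_block p n S" for S
    by (rule eq_matI) (auto simp: lower_block_def)
  then show ?thesis using similar_mat_smult[OF assms, of "- 1"] by simp
qed

lemma form_mat_mult_vec: "i < p \<Longrightarrow> (form_mat p S *\<^sub>v vec p x) $ i = form_vec p S x i"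
  by (simp add: form_vec_def scalar_prod_def atLeast0LessThan)

lemma nondeg_invertible:
  assumes "nondeg p S"
  obtains T where "T \<in> carrier_mat p p" "form_mat p S * T = 1\<^sub>m p" "T * form_mat p S = 1\<^sub>m p"
proof -
  have c: "form_mat p S \<in> carrier_mat p p" by simp
  have "det (form_mat p S) \<noteq> 0"
  proof
    assume "det (form_mat p S) = 0"
    then obtain v where v: "v \<in> carrier_vec p" "v \<noteq> 0\<^sub>v p" "form_mat p S *\<^sub>v v = 0\<^sub>v p"
      using det_0_iff_vec_prod_zero[OF c] by blast
    have "v = vec p (($) v)" using v(1) by auto
    then have "form_vec p S (($) v) i = 0" if "i < p" for i
      using form_mat_mult_vec[OF that, of S "($) v"] v(3) that by simp
    then have "\<forall>i<p. v $ i = 0" using assms by (simp add: nondeg_def)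
    then show False using v(1,2) by (auto intro: eq_vecI)
  qed
  from det_non_zero_imp_unit[OF c this, of "()"] show ?thesis
    using that by (auto simp: Units_def ring_mat_def)
qed

lemma lower_block_similar_nondeg:
  assumes "nondeg p S" "nondeg p S'"
  shows "similar_mat (lower_block p (2 * p + w) S) (lower_block p (2 * p + w) S')"
proof -
  obtain T where T: "T \<in> carrier_mat p p" "form_mat p S * T = 1\<^sub>m p" "T * form_mat p S = 1\<^sub>m p"
    using nondeg_invertible[OF assms(1)] .
  obtain T' where T': "T' \<in> carrier_mat p p" "form_mat p S' * T' = 1\<^sub>m p" "T' * form_mat p S' = 1\<^sub>m p"
    using nondeg_invertible[OF assms(2)] .
  have F: "form_mat p S \<in> carrier_mat p p" "form_mat p S' \<in> carrier_mat p p" by auto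
  have *: "(A * B) * (C * D) = A * (B * C) * D"
    if "A \<in> carrier_mat p p" "B \<in> carrier_mat p p" "C \<in> carrier_mat p p" "D \<in> carrier_mat p p"
    for A B C D :: "real mat" using that by (smt (verit) assoc_mult_mat mult_carrier_mat)
  show ?thesis
  proof (rule lower_block_similar[where P = "form_mat p S * T'" and P' = "form_mat p S' * T" and Q = "1\<^sub>m p" and Q' = "1\<^sub>m p"])
    show "form_mat p S * T' * (form_mat p S' * T) = 1\<^sub>m p" "form_mat p S' * T * (form_mat p S * T') = 1\<^sub>m p"
      using *[OF F(1) T'(1) F(2) T(1)] *[OF F(2) T(1) F(1) T'(1)] T T' F by simp_all
    show "form_mat p S = form_mat p S * T' * form_mat p S' * 1\<^sub>m p"
      using T' F assoc_mult_mat[OF F(1) T'(1) F(2)] by simp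
  qed (use T T' F in \<open>auto intro: mult_carrier_mat\<close>)
qed

lemma form_mat_mult:
  "form_mat p S * form_mat p T = form_mat p (\<lambda>i j. \<Sum>k<p. S i k * T k j)"
  by (rule eq_matI) (auto simp: scalar_prod_def atLeast0LessThan)

lemma form_mat_one: "form_mat p (\<lambda>i j. if i = j then 1 else 0) = 1\<^sub>m p"
  by (rule eq_matI) auto

abbreviation "proj_along a \<equiv> \<lambda>i j :: nat. (if i = j then 1 else 0) - a i * a j :: real"

text \<open>The reflection \<open>H\<close> in the hyperplane orthogonal to \<open>d = a - b\<close> exchanges the unit vectors \<open>a\<close> and
  \<open>b\<close>, and therefore conjugates the projections along them. If \<open>a = b\<close>, then \<open>2 / N = 2 / 0 = 0\<close> and
  the formula gives the identity, as it should.\<close>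

lemma lower_block_similar_hyperplane_projections:
  assumes a: "(\<Sum>i<p. a i * a i) = 1" and b: "(\<Sum>i<p. b i * b i) = 1"
  shows "similar_mat (lower_block p (2 * p + w) (proj_along a)) (lower_block p (2 * p + w) (proj_along b))"
proof -
  define d where "d i = a i - b i" for i
  define N where "N = (\<Sum>i<p. d i * d i)"
  define H where "H i j = (if i = j then 1 else 0) - 2 / N * d i * d j" for i j
  let ?m = "\<Sum>i<p. a i * b i"
  have N: "N = 2 - 2 * ?m"
    using a b by (simp add: N_def d_def algebra_simps sum.distrib sum_subtractf sum_distrib_left)
  have db: "(\<Sum>i<p. d i * b i) = - N / 2"
    unfolding N using b by (simp add: d_def algebra_simps sum_subtractf)
  have d0: "d i = 0" if "N = 0" "i < p" for i
    using that sum_nonneg_eq_0_iff[of "{..<p}" "\<lambda>i. d i * d i"] by (simp add: N_def)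
  have Hb: "(\<Sum>k<p. H i k * b k) = a i" if "i < p" for i
  proof -
    have "(\<Sum>k<p. H i k * b k) = (\<Sum>k<p. (if k = i then b k else 0) - 2 / N * d i * (d k * b k))"
      by (intro sum.cong) (auto simp: H_def algebra_simps)
    also have "\<dots> = b i - 2 / N * d i * (\<Sum>k<p. d k * b k)"
      using that by (simp add: sum_subtractf sum_distrib_left)
    also have "\<dots> = b i + N / N * d i" by (simp add: db)
    also have "\<dots> = a i" using d0[OF _ that] by (cases "N = 0") (auto simp: d_def)
    finally show ?thesis .
  qed
  have HH: "(\<Sum>k<p. H i k * H k j) = (if i = j then 1 else 0)" if ij: "i < p" "j < p" for i j
  proof -
    have "(\<Sum>k<p. H i k * H k j) = (\<Sum>k<p. (if k = i then H k j else 0) - 2 / N * d i * (d k * H k j))"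
      by (intro sum.cong) (auto simp: H_def[of i] algebra_simps)
    also have "\<dots> = H i j - 2 / N * d i * (\<Sum>k<p. d k * H k j)"
      using ij by (simp add: sum_subtractf sum_distrib_left)
    also have "(\<Sum>k<p. d k * H k j) = (\<Sum>k<p. (if k = j then d k else 0) - 2 / N * d j * (d k * d k))"
      by (intro sum.cong) (auto simp: H_def algebra_simps)
    also have "\<dots> = d j - (\<Sum>k<p. 2 / N * d j * (d k * d k))"
      using ij by (simp add: sum_subtractf)
    also have "(\<Sum>k<p. 2 / N * d j * (d k * d k)) = 2 / N * d j * N"
      unfolding N_def by (rule sum_distrib_left[symmetric])
    also have "H i j - 2 / N * d i * (d j - 2 / N * d j * N) = (if i = j then 1 else 0)"
      using d0[OF _ ij(1)] by (cases "N = 0") (auto simp: H_def algebra_simps)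
    finally show ?thesis .
  qed
  have Hsym: "H i j = H j i" for i j by (simp add: H_def)
  have H2: "form_mat p H * form_mat p H = 1\<^sub>m p"
    unfolding form_mat_mult form_mat_one[symmetric] by (rule eq_matI) (auto simp: HH)
  have "(\<Sum>l<p. (\<Sum>k<p. H i k * proj_along b k l) * H l j) = proj_along a i j" if ij: "i < p" "j < p" for i j
  proof -
    have Hp: "(\<Sum>k<p. H i k * proj_along b k l) = H i l - a i * b l" if "l < p" for l
    proof -
      have "(\<Sum>k<p. H i k * proj_along b k l) = (\<Sum>k<p. (if k = l then H i k else 0) - (H i k * b k) * b l)"
        by (intro sum.cong) (auto simp: algebra_simps)
      also have "\<dots> = H i l - (\<Sum>k<p. H i k * b k) * b l"
        using that by (simp add: sum_subtractf sum_distrib_right)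
      finally show ?thesis using Hb[OF ij(1)] by simp
    qed
    have "(\<Sum>l<p. (\<Sum>k<p. H i k * proj_along b k l) * H l j) = (\<Sum>l<p. (H i l - a i * b l) * H l j)"
      by (intro sum.cong refl) (simp only: lessThan_iff Hp)
    also have "\<dots> = (\<Sum>l<p. H i l * H l j - a i * (H j l * b l))"
      by (intro sum.cong refl) (simp add: algebra_simps Hsym[of _ j])
    also have "\<dots> = (if i = j then 1 else 0) - a i * a j"
      by (simp add: sum_subtractf sum_distrib_left[symmetric] HH[OF ij] Hb[OF ij(2)])
    finally show ?thesis .
  qed
  then have "form_mat p (proj_along a) = form_mat p H * form_mat p (proj_along b) * form_mat p H"
    unfolding form_mat_mult by (intro eq_matI) auto
  then show ?thesis
    by (intro lower_block_similar[OF H2 H2 H2 H2]) auto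
qed

text \<open>Filling the kernel, \<open>T = S + a \<otimes> a\<close> is invertible, and \<open>S = T (1 - a \<otimes> a)\<close> because
  \<open>T a = a\<close>. By \<open>lower_block_similar_hyperplane_projections\<close>, all symmetric forms whose kernel is a line give
  similar operators.\<close>

lemma lower_block_similar_line_kernel:
  assumes S: "sym_form p S" and a: "(\<Sum>i<p. a i * a i) = 1"
    and Sa: "\<And>i. i < p \<Longrightarrow> form_vec p S a i = 0"
    and ker: "\<And>x. (\<And>i. i < p \<Longrightarrow> form_vec p S x i = 0) \<Longrightarrow> \<exists>t. \<forall>i<p. x i = t * a i"
  shows "similar_mat (lower_block p (2 * p + w) S) (lower_block p (2 * p + w) (proj_along a))"
proof -
  define T where "T i j = S i j + a i * a j" for i j
  have apT: "form_vec p T x i = form_vec p S x i + a i * (\<Sum>j<p. a j * x j)" for x i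
    by (simp add: T_def form_vec_def algebra_simps sum.distrib sum_distrib_left)
  have "nondeg p T"
    unfolding nondeg_def
  proof (rule allI, rule impI)
    fix x assume x: "\<forall>i<p. form_vec p T x i = 0"
    define m where "m = (\<Sum>j<p. a j * x j)"
    have "0 = (\<Sum>i<p. a i * form_vec p T x i)" using x by simp
    also have "\<dots> = (\<Sum>i<p. a i * form_vec p S x i + (a i * a i) * m)"
      by (simp add: apT m_def algebra_simps)
    also have "\<dots> = form_val p S x a + (\<Sum>i<p. a i * a i) * m"
      by (simp add: form_val_def sum.distrib sum_distrib_right)
    also have "form_val p S x a = form_val p S a x" by (rule form_val_commute[OF S])
    also have "\<dots> = 0" using Sa by (rule kernel_isotropic)
    finally have m: "m = 0" using a by simp
    then have "form_vec p S x i = 0" if "i < p" for i using x apT[of x i] that by (simp add: m_def)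
    then obtain t where t: "\<forall>i<p. x i = t * a i" using ker by blast
    then have "m = (\<Sum>j<p. t * (a j * a j))" unfolding m_def by (intro sum.cong) auto
    then have "t = 0" using a m by (simp add: sum_distrib_left[symmetric])
    then show "\<forall>i<p. x i = 0" using t by simp
  qed
  then obtain T' where T': "T' \<in> carrier_mat p p" "form_mat p T * T' = 1\<^sub>m p" "T' * form_mat p T = 1\<^sub>m p"
    using nondeg_invertible by blast
  have "(\<Sum>k<p. T i k * proj_along a k j) = S i j" if ij: "i < p" "j < p" for i j
  proof -
    have "(\<Sum>k<p. T i k * proj_along a k j) = (\<Sum>k<p. (if k = j then T i k else 0) - (T i k * a k) * a j)"
      by (intro sum.cong) (auto simp: algebra_simps)
    also have "\<dots> = T i j - form_vec p T a i * a j"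
      using ij by (simp add: sum_subtractf sum_distrib_right[symmetric] form_vec_def)
    also have "\<dots> = S i j" using Sa[OF ij(1)] a by (simp add: apT T_def)
    finally show ?thesis .
  qed
  then have "form_mat p S = form_mat p T * form_mat p (proj_along a) * 1\<^sub>m p"
    by (subst right_mult_one_mat[of _ p p]) (auto simp: form_mat_mult intro!: eq_matI)
  then show ?thesis
    by (intro lower_block_similar[OF T'(2,3), of "1\<^sub>m p" "1\<^sub>m p"]) (use T'(1) in auto)
qed

lemma similar_lower_block_zero:
  assumes "similar_mat (lower_block p (2 * p + w) S) (lower_block p (2 * p + w) (\<lambda>_ _. 0))" "i < p" "j < p"
  shows "S i j = 0"
proof -
  let ?n = "2 * p + w"
  have Z: "lower_block p ?n (\<lambda>_ _. 0) = 0\<^sub>m ?n ?n" by (rule eq_matI) (auto simp: lower_block_def)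
  from assms(1) obtain X Y where "similar_mat_wit (lower_block p ?n S) (lower_block p ?n (\<lambda>_ _. 0)) X Y"
    unfolding similar_mat_def by blast
  from similar_mat_witD2[OF lower_block_carrier this] have "lower_block p ?n S = X * 0\<^sub>m ?n ?n * Y"
    "X \<in> carrier_mat ?n ?n" "Y \<in> carrier_mat ?n ?n" by (auto simp: Z)
  then have "lower_block p ?n S = 0\<^sub>m ?n ?n" by simp
  then have "lower_block p ?n S $$ (p + i, j) = 0" using assms by simp
  then show ?thesis using assms by (simp add: lower_block_def)
qed

lemma lower_block_mult_vec:
  assumes "v \<in> carrier_vec n" "2 * p \<le> n" "i < n"
  shows "(lower_block p n S *\<^sub>v v) $ i = (if p \<le> i \<and> i < 2 * p then form_vec p S (($) v) (i - p) else 0)"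
proof -
  have "(lower_block p n S *\<^sub>v v) $ i = (\<Sum>j<n. (if j < p then if p \<le> i \<and> i < 2 * p then S (i - p) j * v $ j else 0 else 0))"
    using assms by (auto simp: lower_block_def scalar_prod_def atLeast0LessThan intro!: sum.cong)
  also have "\<dots> = (\<Sum>j<p. if p \<le> i \<and> i < 2 * p then S (i - p) j * v $ j else 0)"
    by (rule sum_restrict_lessThan) (use assms in simp)
  finally show ?thesis by (auto simp: form_vec_def)
qed

text \<open>The rank of the block is an invariant. If \<open>S\<close> is invertible, the kernel of its operator consists of
  the vectors with vanishing \<open>x\<close>-part. A vector \<open>x\<close> in the kernel of \<open>S'\<close> would make the kernel of the
  other operator larger; as the conjugation maps it into the first kernel, this contradicts its
  injectivity.\<close>

lemma similar_lower_block_nondeg: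
  assumes sim: "similar_mat (lower_block p (2 * p + w) S) (lower_block p (2 * p + w) S')" and S: "nondeg p S"
  shows "nondeg p S'"
  unfolding nondeg_def
proof (rule allI, rule impI, rule ccontr)
  let ?n = "2 * p + w"
  fix x assume x: "\<forall>i<p. form_vec p S' x i = 0" "\<not> (\<forall>i<p. x i = 0)"
  obtain X Y where "similar_mat_wit (lower_block p ?n S) (lower_block p ?n S') X Y"
    using sim unfolding similar_mat_def by blast
  note W = similar_mat_witD2[OF lower_block_carrier this]
  have XY: "Y * X = 1\<^sub>m ?n" "X * Y = 1\<^sub>m ?n" "lower_block p ?n S = X * lower_block p ?n S' * Y"
    and X: "X \<in> carrier_mat ?n ?n" and Y: "Y \<in> carrier_mat ?n ?n" by (rule W)+
  \<comment> \<open>the kernel of the second operator contains the vectors \<open>z c\<close>, a family with \<open>p + w + 1\<close> parameters\<close>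
  define z where "z c i = (if i < p then c (p + w) * x i else c (i - p))" for c :: "nat \<Rightarrow> real" and i
  obtain c where c: "\<exists>i<Suc (p + w). c i \<noteq> 0"
    "\<And>k. k < p + w \<Longrightarrow> (\<Sum>i<Suc (p + w). (if i = p + w then \<Sum>j<p. X $$ (p + k, j) * x j else X $$ (p + k, p + i)) * c i) = 0"
    using underdetermined_system[of "p + w" "Suc (p + w)"
      "\<lambda>k i. if i = p + w then \<Sum>j<p. X $$ (p + k, j) * x j else X $$ (p + k, p + i)"] by auto
  define v where "v = vec ?n (z c)"
  have v: "v \<in> carrier_vec ?n" by (simp add: v_def)
  have Xv: "X *\<^sub>v v \<in> carrier_vec ?n" using X v by simp
  have split: "(\<Sum>j<?n. f j) = (\<Sum>j<p. f j) + (\<Sum>j<p + w. f (p + j))" for f :: "nat \<Rightarrow> real"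
    using sum_lessThan_add[of f p "p + w"] by (simp add: mult_2 add.assoc)
  have bottom: "(X *\<^sub>v v) $ (p + k) = 0" if k: "k < p + w" for k
  proof -
    have "(X *\<^sub>v v) $ (p + k) = (\<Sum>j<?n. X $$ (p + k, j) * z c j)"
      using X k by (simp add: v_def scalar_prod_def atLeast0LessThan)
    also have "\<dots> = (\<Sum>j<p. X $$ (p + k, j) * x j) * c (p + w) + (\<Sum>j<p + w. X $$ (p + k, p + j) * c j)"
      unfolding split by (simp add: z_def sum_distrib_left sum_distrib_right mult_ac)
    also have "\<dots> = 0" using c(2)[OF k] by simp
    finally show ?thesis .
  qed
  have "form_vec p S' (($) v) i = c (p + w) * form_vec p S' x i" for i
    unfolding form_vec_def sum_distrib_left by (intro sum.cong) (auto simp: v_def z_def)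
  then have S'v: "lower_block p ?n S' *\<^sub>v v = 0\<^sub>v ?n"
    using x(1) by (intro eq_vecI) (auto simp: lower_block_mult_vec[OF v] simp del: index_mult_mat_vec)
  have "Y *\<^sub>v (X *\<^sub>v v) = v" using assoc_mult_mat_vec[OF Y X v] XY v by simp
  then have "lower_block p ?n S *\<^sub>v (X *\<^sub>v v) = X *\<^sub>v (lower_block p ?n S' *\<^sub>v v)"
    unfolding XY(3) using X Y Xv by (smt (verit) lower_block_carrier assoc_mult_mat_vec mult_carrier_mat v)
  then have SXv: "lower_block p ?n S *\<^sub>v (X *\<^sub>v v) = 0\<^sub>v ?n" unfolding S'v using X by auto
  have "form_vec p S (($) (X *\<^sub>v v)) i = 0" if "i < p" for i
    using arg_cong[OF SXv, of "\<lambda>u. u $ (p + i)"] lower_block_mult_vec[OF Xv, of p "p + i" S] that by simp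
  then have top: "\<forall>i<p. (X *\<^sub>v v) $ i = 0" using S by (simp add: nondeg_def)
  have "X *\<^sub>v v = 0\<^sub>v ?n"
  proof (rule eq_vecI)
    fix i assume "i < dim_vec (0\<^sub>v ?n :: real vec)"
    then show "(X *\<^sub>v v) $ i = 0\<^sub>v ?n $ i" using top bottom[of "i - p"] by (cases "i < p") auto
  qed (use X in simp)
  with \<open>Y *\<^sub>v (X *\<^sub>v v) = v\<close> have "v = 0\<^sub>v ?n" using Y by auto
  then have z0: "z c i = 0" if "i < ?n" for i using that by (metis index_vec index_zero_vec(1) v_def)
  have "c i = 0" if "i < p + w" for i using z0[of "p + i"] that by (simp add: z_def)
  moreover have "c (p + w) = 0"
  proof -
    obtain i where "i < p" "x i \<noteq> 0" using x(2) by blast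
    then show ?thesis using z0[of i] by (simp add: z_def)
  qed
  ultimately show False using c(1) by (metis less_Suc_eq)
qed

text \<open>Each summand is an outer product, and the rank is subadditive.\<close>

lemma rank_le_card_of_sum:
  fixes M :: "real mat"
  assumes "finite K" "M \<in> carrier_mat n nc"
    "\<And>i j. i < n \<Longrightarrow> j < nc \<Longrightarrow> M $$ (i, j) = (\<Sum>k\<in>K. f k i * h k j)"
  shows "vec_space.rank n M \<le> card K"
  using assms
proof (induction K arbitrary: M rule: finite_induct)
  case empty
  then have "M = 0\<^sub>m n nc" by (intro eq_matI) auto
  then show ?case by (simp add: vec_space.rank_0I)
next
  case (insert k K)
  let ?A = "mat n nc (\<lambda>(i, j). f k i * h k j)" and ?B = "mat n nc (\<lambda>(i, j). \<Sum>k\<in>K. f k i * h k j)"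
  have "M = ?A + ?B" using insert by (intro eq_matI) auto
  then have "vec_space.rank n M \<le> vec_space.rank n ?A + vec_space.rank n ?B"
    using vec_space.rank_subadditive[of ?A n nc ?B] by simp
  moreover have "vec_space.rank n ?A \<le> 1"
    by (rule vec_space.rank_le_1_product_entries[of _ n nc "f k" "h k"]) auto
  moreover have "vec_space.rank n ?B \<le> card K" by (rule insert.IH) auto
  moreover have "card (insert k K) = Suc (card K)" using insert.hyps by simp
  ultimately show ?case by linarith
qed

text \<open>If \<open>a\<close> and \<open>b\<close> in the kernel are independent, some \<open>2 \<times> 2\<close> minor of them, in positions \<open>i\<close> and
  \<open>j\<close>, is nonzero. Suitable combinations of \<open>a\<close> and \<open>b\<close> then express columns \<open>i\<close> and \<open>j\<close> of \<open>S\<close> by the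
  other \<open>p - 2\<close> columns, and the rank is less than \<open>p - 1\<close>.\<close>

lemma lower_block_rank_kernel:
  assumes rank: "vec_space.rank n (lower_block p n S) = p - 1" and p: "p \<ge> 2" "2 * p \<le> n"
    and a: "\<And>i. i < p \<Longrightarrow> form_vec p S a i = 0" and b: "\<And>i. i < p \<Longrightarrow> form_vec p S b i = 0"
    and ij: "i < p" "j < p"
  shows "a i * b j = a j * b i"
proof (rule ccontr)
  assume ne: "a i * b j \<noteq> a j * b i"
  then have "i \<noteq> j" by auto
  define D where "D = a i * b j - a j * b i"
  have D: "D \<noteq> 0" using ne by (simp add: D_def)
  \<comment> \<open>the combinations of \<open>a\<close> and \<open>b\<close> with entries \<open>(1, 0)\<close> and \<open>(0, 1)\<close> in positions \<open>i\<close> and \<open>j\<close>\<close>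
  define c where "c k = (b j * a k - a j * b k) / D" for k
  define d where "d k = (a i * b k - b i * a k) / D" for k
  have cd: "c i = 1" "c j = 0" "d i = 0" "d j = 1" using D by (simp_all add: c_def d_def D_def mult.commute)
  have apc: "form_vec p S c l = 0" "form_vec p S d l = 0" if "l < p" for l
  proof -
    have "form_vec p S c l = (b j * form_vec p S a l - a j * form_vec p S b l) / D"
      unfolding form_vec_def c_def by (simp add: algebra_simps sum_distrib_left sum_subtractf sum_divide_distrib diff_divide_distrib)
    moreover have "form_vec p S d l = (a i * form_vec p S b l - b i * form_vec p S a l) / D"
      unfolding form_vec_def d_def by (simp add: algebra_simps sum_distrib_left sum_subtractf sum_divide_distrib diff_divide_distrib)
    ultimately show "form_vec p S c l = 0" "form_vec p S d l = 0" using a b that by simp_all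
  qed
  define K where "K = {..<p} - {i, j}"
  have splitK: "(\<Sum>k<p. f k) = f i + f j + (\<Sum>k\<in>K. f k)" for f :: "nat \<Rightarrow> real"
  proof -
    have eq: "{..<p} = insert i (insert j K)" using ij by (auto simp: K_def)
    have "finite K" "i \<notin> insert j K" "j \<notin> K" using \<open>i \<noteq> j\<close> by (auto simp: K_def)
    then show ?thesis unfolding eq by (simp add: add.assoc)
  qed
  have cardK: "card K = p - 2" using ij \<open>i \<noteq> j\<close> by (simp add: K_def card_Diff_subset)
  have Si: "S l i = - (\<Sum>k\<in>K. S l k * c k)" and Sj: "S l j = - (\<Sum>k\<in>K. S l k * d k)" if "l < p" for l
    using apc[OF that] unfolding form_vec_def splitK by (simp_all add: cd)
  define h where "h k m = (if m < p then (if k = m then 1 else 0) - (if m = i then c k else 0) - (if m = j then d k else 0) else 0)" for k m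
  have hs: "(\<Sum>k\<in>K. S l k * h k m) = S l m" if "l < p" "m < p" for l m
  proof -
    have "(\<Sum>k\<in>K. S l k * h k m) = (\<Sum>k\<in>K. (if k = m then S l k else 0) - (if m = i then S l k * c k else 0) - (if m = j then S l k * d k else 0))"
      by (intro sum.cong refl) (use that in \<open>auto simp: h_def algebra_simps\<close>)
    also have "\<dots> = (if m \<in> K then S l m else 0) - (if m = i then \<Sum>k\<in>K. S l k * c k else 0) - (if m = j then \<Sum>k\<in>K. S l k * d k else 0)"
      by (simp add: sum_subtractf K_def)
    also have "\<dots> = S l m" using that Si Sj \<open>i \<noteq> j\<close> by (auto simp: K_def)
    finally show ?thesis .
  qed
  have "vec_space.rank n (lower_block p n S) \<le> card K"
  proof (rule rank_le_card_of_sum[where f = "\<lambda>k l. if p \<le> l \<and> l < 2 * p then S (l - p) k else 0" and h = h and nc = n])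
    fix l m assume lm: "l < n" "m < n"
    show "lower_block p n S $$ (l, m) = (\<Sum>k\<in>K. (if p \<le> l \<and> l < 2 * p then S (l - p) k else 0) * h k m)"
    proof (cases "p \<le> l \<and> l < 2 * p \<and> m < p")
      case True
      then have "l - p < p" by auto
      then show ?thesis using True lm hs[of "l - p" m] by (simp add: lower_block_def)
    next
      case False
      then show ?thesis using lm by (auto simp: lower_block_def h_def)
    qed
  qed (auto simp: K_def)
  then show False using rank cardK p by linarith
qed

section \<open>Consequences of the condition on the Jacobi operators\<close>

text \<open>All results on the product metric thus specialise to \<open>g\<^sub>\<psi>\<close>, to which the definition of \<open>\<Psi>\<close>
  refers.\<close>

lemma g_N_0_0:
  assumes "smooth_symmetric_tensor p \<psi>"
  shows "g_N p \<psi> 0 0 = g_psi p \<psi>"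
proof
  fix z
  have c: "\<psi> (first_coords p z) \<in> carrier_mat p p" by (rule psi_carrier[OF assms])
  have block: "four_block_mat M (0\<^sub>m m (0 + 0)) (0\<^sub>m (0 + 0) m) F = M" if "M \<in> carrier_mat m m" "F \<in> carrier_mat 0 0"
    for M F :: "real mat" and m
    using that by (intro eq_matI) auto
  have "four_block_mat (\<psi> (first_coords p z)) (1\<^sub>m p) (1\<^sub>m p) (0\<^sub>m p p) \<in> carrier_mat (2 * p) (2 * p)"
    using c by (auto simp: mult_2)
  from block[OF this, of "flat_metric 0 0 (\<lambda>i. z (2 * p + i))"] show "g_N p \<psi> 0 0 z = g_psi p \<psi> z"
    unfolding g_N_def product_metric_def g_psi_def first_coords_twice[OF assms] by (simp add: flat_metric_def)
qed

lemma Psi_smooth: "\<psi> \<in> Psi p \<Longrightarrow> smooth_symmetric_tensor p \<psi>"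
  by (simp add: Psi_def)

context
  fixes p :: nat and \<psi> :: metric
  assumes Psi: "\<psi> \<in> Psi p" and p2: "p \<ge> 2"
begin

text \<open>For a vector \<open>Z\<close> with components \<open>(y, 0)\<close> the form \<open>(J(X)Z, Z)\<close> is the value of the block at \<open>y\<close>. The
  kernel of the block contains \<open>c\<close>, and the rank leaves room for nothing else.\<close>

lemma Psi_jac_form:
  assumes c: "\<exists>i<p. c i \<noteq> 0"
  shows "psd p (jac_form p \<psi> (first_coords p z) c)"
    and "\<And>y i j. (\<And>i. i < p \<Longrightarrow> form_vec p (jac_form p \<psi> (first_coords p z) c) y i = 0) \<Longrightarrow> i < p \<Longrightarrow> j < p \<Longrightarrow>
      c i * y j = c j * y i"
proof -
  let ?x = "first_coords p z"
  let ?A = "jac_form p \<psi> ?x c"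
  define X where "X = vec p c @\<^sub>v 0\<^sub>v p"
  have X: "X \<in> carrier_vec (2 * p)" by (simp add: X_def mult_2)
  have Xi: "X $ i = c i" if "i < p" for i using that by (simp add: X_def)
  have "X \<in> X_space p" unfolding X_space_def X_def by (auto intro!: exI[of _ "vec p c"])
  moreover have "X \<noteq> 0\<^sub>v (2 * p)"
  proof
    assume "X = 0\<^sub>v (2 * p)"
    then have "c i = 0" if "i < p" for i using Xi[OF that] that by simp
    then show False using c by blast
  qed
  moreover have "?x \<in> topspace (Euclidean_space (2 * p))"
    by (auto simp: topspace_Euclidean_space first_coords_def)
  ultimately have ps: "pos_semidef_op (2 * p) (g_psi p \<psi> ?x) (jacobi (2 * p) (g_psi p \<psi>) ?x X)"
    and rk: "vec_space.rank (2 * p) (jacobi (2 * p) (g_psi p \<psi>) ?x X) = p - 1"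
    using Psi unfolding Psi_def by blast+
  have fx: "first_coords p ?x = ?x" by (auto simp: first_coords_def)
  have J: "jacobi (2 * p) (g_psi p \<psi>) ?x X = lower_block p (2 * p) ?A"
  proof -
    have "jacobi (2 * p) (g_psi p \<psi>) ?x X = lower_block p (2 * p) (jac_form p \<psi> ?x (($) X))"
      using jacobi_g_N[OF Psi_smooth[OF Psi], of 0 0 ?x X] by (simp add: g_N_0_0[OF Psi_smooth[OF Psi]] fx)
    also have "\<dots> = lower_block p (2 * p) ?A" by (intro lower_block_cong jac_form_cong) (simp add: Xi)
    finally show ?thesis .
  qed
  have sym: "sym_form p ?A"
    unfolding sym_form_def using jac_form_sym[OF Psi_smooth[OF Psi] first_coords_in_Euclidean_space] by blast
  have "0 \<le> form_val p ?A y y" for y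
  proof -
    define Z where "Z = vec (2 * p) (\<lambda>i. if i < p then y i else 0)"
    have Z: "Z \<in> carrier_vec (2 * p)" by (simp add: Z_def)
    let ?JZ = "lower_block p (2 * p) ?A *\<^sub>v Z"
    have JZ: "?JZ \<in> carrier_vec (2 * p)" by (rule mult_mat_vec_carrier[OF lower_block_carrier Z])
    have top: "?JZ $ i = 0" if "i < p" for i
      using lower_block_mult_vec[OF Z, of p i ?A] that by (simp del: index_mult_mat_vec)
    have Zi: "Z $ i = y i" "Z $ (p + i) = 0" if "i < p" for i using that by (simp_all add: Z_def)
    have "0 \<le> gip (g_psi p \<psi> ?x) ?JZ Z" using ps Z unfolding pos_semidef_op_def J by blast
    also have "gip (g_psi p \<psi> ?x) ?JZ Z = (\<Sum>i<p. ?JZ $ (p + i) * y i)"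
      using gip_g_N[OF Psi_smooth[OF Psi], of ?JZ 0 0 Z ?x] Z JZ
      by (simp add: g_N_0_0[OF Psi_smooth[OF Psi]] top Zi del: index_mult_mat_vec)
    also have "\<dots> = form_val p ?A y y"
      unfolding form_val_def
    proof (intro sum.cong refl)
      fix i assume "i \<in> {..<p}"
      moreover have "form_vec p ?A (($) Z) i = form_vec p ?A y i" unfolding form_vec_def by (intro sum.cong) (auto simp: Z_def)
      ultimately show "?JZ $ (p + i) * y i = y i * form_vec p ?A y i"
        by (simp add: lower_block_mult_vec[OF Z] del: index_mult_mat_vec)
    qed
    finally show ?thesis .
  qed
  then show "psd p ?A" using sym by (simp add: psd_def)
  fix y i j assume y: "\<And>i. i < p \<Longrightarrow> form_vec p ?A y i = 0" and ij: "i < p" "j < p"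
  show "c i * y j = c j * y i"
    by (rule lower_block_rank_kernel[OF rk[unfolded J] p2 _ _ y ij]) (use jac_form_kernel[of p \<psi> ?x c] in \<open>auto simp: form_vec_def\<close>)
qed

lemma Psi_jac_form_psd: "psd p (jac_form p \<psi> (first_coords p z) c)"
proof (cases "\<exists>i<p. c i \<noteq> 0")
  case False
  then have "jac_form p \<psi> (first_coords p z) c l j = 0" for l j by (intro jac_form_zero) auto
  then show ?thesis by (simp add: psd_def sym_form_def form_val_def form_vec_def)
qed (rule Psi_jac_form)

lemma Psi_jac_form_kernel:
  assumes "\<And>i. i < p \<Longrightarrow> form_vec p (jac_form p \<psi> (first_coords p z) c) y i = 0" "i < p" "j < p"
  shows "c i * y j = c j * y i"
proof (cases "\<exists>i<p. c i \<noteq> 0")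
  case True
  then show ?thesis using Psi_jac_form(2)[OF True] assms by blast
qed (use assms in auto)

end

section \<open>Jacobi operators of non-degenerate subspaces\<close>

text \<open>The block of the higher order Jacobi operator, computed from an orthonormal basis \<open>es\<close>.\<close>

definition jacobi_form :: "nat \<Rightarrow> metric \<Rightarrow> point \<Rightarrow> real mat \<Rightarrow> real vec list \<Rightarrow> nat \<Rightarrow> nat \<Rightarrow> real" where
  "jacobi_form p \<psi> x G es l j = (\<Sum>k<length es. gip G (es ! k) (es ! k) * jac_form p \<psi> x (($) (es ! k)) l j)"

lemma jacobi_form_append:
  "jacobi_form p \<psi> x G (es @ fs) l j = jacobi_form p \<psi> x G es l j + jacobi_form p \<psi> x G fs l j"
  by (simp add: jacobi_form_def sum_lessThan_add nth_append)

lemma jacobi_form_gram_sum: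
  assumes "p \<le> n"
  shows "jacobi_form p \<psi> x G es l j = (\<Sum>a<p. \<Sum>b<p. gram_sum n G es $$ (a, b) * psi_riemann \<psi> x l j a b)"
proof -
  have "jacobi_form p \<psi> x G es l j = (\<Sum>k<length es. \<Sum>a<p. \<Sum>b<p.
      gip G (es ! k) (es ! k) * (es ! k $ a * es ! k $ b) * psi_riemann \<psi> x l j a b)"
    by (simp add: jacobi_form_def jac_form_def sum_distrib_left mult.assoc)
  also have "\<dots> = (\<Sum>a<p. \<Sum>k<length es. \<Sum>b<p.
      gip G (es ! k) (es ! k) * (es ! k $ a * es ! k $ b) * psi_riemann \<psi> x l j a b)"
    by (rule sum.swap)
  also have "\<dots> = (\<Sum>a<p. \<Sum>b<p. \<Sum>k<length es.
      gip G (es ! k) (es ! k) * (es ! k $ a * es ! k $ b) * psi_riemann \<psi> x l j a b)"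
    by (rule sum.cong[OF refl], rule sum.swap)
  also have "\<dots> = (\<Sum>a<p. \<Sum>b<p. gram_sum n G es $$ (a, b) * psi_riemann \<psi> x l j a b)"
    by (intro sum.cong refl)
      (use assms in \<open>simp add: gram_sum_def sum_list_sum_nth atLeast0LessThan sum_distrib_right\<close>)
  finally show ?thesis .
qed

context
  fixes p u w :: nat and \<psi> :: metric
begin

private abbreviation (input) "n \<equiv> 2 * p + (u + w)"

private abbreviation (input) "G z \<equiv> g_N p \<psi> u w z"

private abbreviation (input) "J_op z \<pi> \<equiv> jacobi_sub n (g_N p \<psi> u w) z \<pi>"

private abbreviation (input) "block_similar S S' \<equiv> similar_mat (lower_block p n S) (lower_block p n S')"

text \<open>The sign \<open>\<sigma>\<close> is \<open>-1\<close> for timelike and \<open>1\<close> for spacelike families, so that both cases are treated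
  at once; \<open>flat_dim\<close> and \<open>flat_index\<close> select the flat directions of the same sign.\<close>

definition definite_family :: "point \<Rightarrow> real \<Rightarrow> real vec list \<Rightarrow> bool" where
  "definite_family z \<sigma> es \<longleftrightarrow> orthonormal n (G z) es \<and> (\<forall>e\<in>set es. gip (G z) e e = \<sigma>)"

definition flat_dim :: "real \<Rightarrow> nat" where
  "flat_dim \<sigma> = (if \<sigma> = -1 then u else w)"

definition flat_index :: "real \<Rightarrow> nat \<Rightarrow> nat" where
  "flat_index \<sigma> k = (if \<sigma> = -1 then 2 * p + k else 2 * p + u + k)"

context
  assumes \<psi>: "smooth_symmetric_tensor p \<psi>"
begin

text \<open>The basis chosen in the definition may be replaced by any other one.\<close>

lemma jacobi_sub_eq:
  assumes "orthonormal_basis n (G z) \<pi> es"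
  shows "J_op z \<pi> = lower_block p n (jacobi_form p \<psi> (first_coords p z) (G z) es)"
proof -
  let ?x = "first_coords p z"
  define es' where "es' = (SOME es. orthonormal_basis n (G z) \<pi> es)"
  have es': "orthonormal_basis n (G z) \<pi> es'" unfolding es'_def using assms by (rule someI)
  have "gram_sum n (G z) es' = gram_sum n (G z) es"
    by (rule gram_sum_span_eq[OF g_N_carrier[OF \<psi>] g_N_transpose[OF \<psi>]]) (use assms es' in \<open>auto simp: orthonormal_basis_iff\<close>)
  then have eq: "jacobi_form p \<psi> ?x (G z) es' = jacobi_form p \<psi> ?x (G z) es"
    by (intro ext) (simp add: jacobi_form_gram_sum[of p n])
  have "J_op z \<pi> = lower_block p n (jacobi_form p \<psi> ?x (G z) es')"
    unfolding jacobi_sub_def es'_def[symmetric] Let_def jacobi_g_N[OF \<psi>]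
    by (rule eq_matI)
      (auto simp: lower_block_def jacobi_form_def sum_list_sum_nth atLeast0LessThan intro!: sum.neutral)
  then show ?thesis unfolding eq .
qed

lemma Gr_orthonormal_basis:
  assumes "\<pi> \<in> Gr n (G z) r s"
  obtains es where "orthonormal_basis n (G z) \<pi> es" "orthonormal n (G z) es"
    "length (filter (\<lambda>e. gip (G z) e e = -1) es) = r" "length (filter (\<lambda>e. gip (G z) e e = 1) es) = s"
    "length es = r + s"
    "J_op z \<pi> = lower_block p n (jacobi_form p \<psi> (first_coords p z) (G z) es)"
proof -
  from assms obtain es where es: "orthonormal_basis n (G z) \<pi> es"
    "length (filter (\<lambda>e. gip (G z) e e = -1) es) = r" "length (filter (\<lambda>e. gip (G z) e e = 1) es) = s"
    unfolding Gr_def by blast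
  then have "orthonormal n (G z) es" by (simp add: orthonormal_basis_iff)
  then have "length es = r + s"
    using length_filter_partition_signs[of es "\<lambda>e. gip (G z) e e"] es unfolding orthonormal_iff_distinct by simp
  with es jacobi_sub_eq[OF es(1)] \<open>orthonormal n (G z) es\<close> that show ?thesis by blast
qed

lemma osserman_g_N: "osserman n (g_N p \<psi> u w) r s"
  unfolding osserman_def
proof (intro ballI)
  fix z z' \<pi> \<pi>' assume \<pi>: "\<pi> \<in> Gr n (G z) r s" "\<pi>' \<in> Gr n (G z') r s"
  obtain S where "J_op z \<pi> = lower_block p n S" using Gr_orthonormal_basis[OF \<pi>(1)] .
  moreover obtain S' where "J_op z' \<pi>' = lower_block p n S'" using Gr_orthonormal_basis[OF \<pi>(2)] .
  ultimately show "eigenvalues_of (J_op z \<pi>) = eigenvalues_of (J_op z' \<pi>')"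
    using eigenvalues_lower_block by simp
qed

lemma inverse_g_N_right: "G z * inverse_g_N p \<psi> u w z = 1\<^sub>m n"
  by (rule g_N_inverse_right[OF \<psi>])

text \<open>Over a basis of the whole tangent space one contracts the curvature with the \<open>xx\<close>-block of the
  inverse metric.\<close>

lemma jacobi_form_full:
  assumes es: "orthonormal n (G z) es" "length es = n"
  shows "jacobi_form p \<psi> x (G z) es l j = 0"
proof -
  let ?T = "gram_sum n (G z) es" and ?H = "inverse_g_N p \<psi> u w z"
  have c: "?T \<in> carrier_mat n n" "?H \<in> carrier_mat n n"
    by (rule gram_sum_carrier[OF g_N_carrier[OF \<psi>] g_N_transpose[OF \<psi>]] inverse_g_N_carrier[OF \<psi>])+
  have TG: "?T * G z = 1\<^sub>m n" by (rule gram_sum_full[OF g_N_carrier[OF \<psi>] g_N_transpose[OF \<psi>] es])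
  have "?T * (G z * ?H) = (?T * G z) * ?H" by (rule assoc_mult_mat[OF c(1) g_N_carrier[OF \<psi>] c(2), symmetric])
  then have "?T = ?H" using c TG inverse_g_N_right[of z] by simp
  then have "?T $$ (a, b) = 0" if "a < p" "b < p" for a b
    using inverse_g_N_index[OF \<psi>, of a u w b z] that by simp
  then show ?thesis by (simp add: jacobi_form_gram_sum[of p n])
qed

lemma orthonormal_complement:
  assumes "orthonormal n (G z) es"
  obtains fs where "orthonormal n (G z) (es @ fs)" "length es + length fs = n"
    "jacobi_form p \<psi> x (G z) es = (\<lambda>l j. - jacobi_form p \<psi> x (G z) fs l j)"
proof -
  obtain fs where fs: "orthonormal n (G z) (es @ fs)" "length (es @ fs) = n"
    using orthonormal_extend[OF g_N_carrier[OF \<psi>] g_N_transpose[OF \<psi>] inverse_g_N_carrier[OF \<psi>] inverse_g_N_right assms] by blast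
  have "jacobi_form p \<psi> x (G z) es = (\<lambda>l j. - jacobi_form p \<psi> x (G z) fs l j)"
    using jacobi_form_full[OF fs, of x] by (auto simp: jacobi_form_append fun_eq_iff add_eq_0_iff2)
  then show ?thesis using that fs by simp
qed

section \<open>Definite subspaces\<close>

text \<open>The family spans a definite space whose dimension is its length; hence \<open>m\<close> linear conditions on it,
  fewer than the length, leave a vector of nonzero norm with sign \<open>\<sigma>\<close>.\<close>

lemma definite_family_combination:
  fixes a :: "nat \<Rightarrow> nat \<Rightarrow> real"
  assumes es: "definite_family z \<sigma> es" and \<sigma>: "\<sigma> \<in> {-1, 1}" and m: "m < length es"
  obtains c v where "v \<in> carrier_vec n" "\<And>i. i < n \<Longrightarrow> v $ i = (\<Sum>k<length es. c k * es ! k $ i)"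
    "\<And>q. q < m \<Longrightarrow> (\<Sum>k<length es. a q k * c k) = 0" "\<sigma> * gip (G z) v v > 0"
proof -
  have on: "orthonormal n (G z) es" using es by (simp add: definite_family_def)
  obtain c where c: "\<exists>k<length es. c k \<noteq> 0" "\<And>q. q < m \<Longrightarrow> (\<Sum>k<length es. a q k * c k) = 0"
    using underdetermined_system[OF m, of a] by blast
  define v where "v = mat_of_cols n es *\<^sub>v vec (length es) c"
  have v: "v \<in> carrier_vec n" unfolding v_def by (rule mult_mat_vec_carrier[of _ _ "length es"]) auto
  have vi: "v $ i = (\<Sum>k<length es. c k * es ! k $ i)" if "i < n" for i
    using that by (simp add: v_def scalar_prod_def mat_of_cols_def atLeast0LessThan mult.commute)
  have "gip (G z) v v = (\<Sum>k<length es. gip (G z) (es ! k) (es ! k) * (c k)\<^sup>2)"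
    unfolding v_def by (subst orthonormal_norm[OF g_N_carrier[OF \<psi>] g_N_transpose[OF \<psi>] on]) auto
  also have "\<dots> = \<sigma> * (\<Sum>k<length es. (c k)\<^sup>2)"
    using es by (simp add: definite_family_def sum_distrib_left)
  finally have "\<sigma> * gip (G z) v v = (\<Sum>k<length es. (c k)\<^sup>2)" using \<sigma> by auto
  also have "\<dots> > 0" using c(1) by (auto intro!: sum_pos2)
  finally show ?thesis using that v vi c(2) by blast
qed

text \<open>Only flat directions of the opposite sign contribute.\<close>

lemma flat_part_sign:
  assumes \<sigma>: "\<sigma> \<in> {-1, 1}" and v: "\<And>k. k < flat_dim \<sigma> \<Longrightarrow> v $ flat_index \<sigma> k = 0"
  shows "\<sigma> * (\<Sum>k<u + w. flat_sign u k * v $ (2 * p + k) * v $ (2 * p + k)) \<le> 0"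
proof -
  have "\<sigma> * (flat_sign u k * v $ (2 * p + k) * v $ (2 * p + k)) \<le> 0" if k: "k < u + w" for k
  proof (cases "\<sigma> = flat_sign u k")
    case True
    have "v $ (2 * p + k) = 0"
    proof (cases "k < u")
      case True
      then show ?thesis using \<open>\<sigma> = flat_sign u k\<close> v[of k] by (simp add: flat_dim_def flat_index_def)
    next
      case False
      then show ?thesis using \<open>\<sigma> = flat_sign u k\<close> v[of "k - u"] k by (simp add: flat_dim_def flat_index_def)
    qed
    then show ?thesis by simp
  next
    case False
    then have "\<sigma> * flat_sign u k = - 1" using \<sigma> by (auto split: if_splits)
    then have "\<sigma> * (flat_sign u k * v $ (2 * p + k) * v $ (2 * p + k)) = - (v $ (2 * p + k) * v $ (2 * p + k))"
      by (simp only: mult.assoc[symmetric])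
    then show ?thesis by simp
  qed
  then show ?thesis unfolding sum_distrib_left by (intro sum_nonpos) auto
qed

text \<open>The bound by the signature of the metric. In terms of \<open>y' = y + \<psi> x / 2\<close> the norm is
  \<open>2 x \<cdot> y'\<close> plus a flat part. The \<open>p\<close> conditions \<open>y' = - \<sigma> x\<close> make the first term
  \<open>- 2 \<sigma> |x|\<^sup>2\<close>, and the others remove the flat directions of sign \<open>\<sigma>\<close>, so a longer family would
  contain a vector whose norm has the wrong sign.\<close>

lemma definite_family_length:
  assumes es: "definite_family z \<sigma> es" and \<sigma>: "\<sigma> \<in> {-1, 1}"
  shows "length es \<le> p + flat_dim \<sigma>"
proof (rule ccontr)
  let ?\<psi> = "\<psi> (first_coords p z)"
  let ?a = "\<lambda>q k. if q < p then es ! k $ (p + q) + (\<Sum>j<p. ?\<psi> $$ (q, j) * es ! k $ j) / 2 + \<sigma> * es ! k $ q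
    else es ! k $ flat_index \<sigma> (q - p)"
  assume "\<not> length es \<le> p + flat_dim \<sigma>"
  then have lt: "p + flat_dim \<sigma> < length es" by simp
  obtain v c where v: "v \<in> carrier_vec n" and vi: "\<And>i. i < n \<Longrightarrow> v $ i = (\<Sum>k<length es. c k * es ! k $ i)"
    and c: "\<And>q. q < p + flat_dim \<sigma> \<Longrightarrow> (\<Sum>k<length es. ?a q k * c k) = 0" and pos: "\<sigma> * gip (G z) v v > 0"
    by (rule definite_family_combination[OF es \<sigma> lt, of ?a], rule that)
  have fl: "v $ flat_index \<sigma> k = 0" if "k < flat_dim \<sigma>" for k
  proof -
    have "flat_index \<sigma> k < n" using that by (auto simp: flat_index_def flat_dim_def split: if_splits)
    then show ?thesis using c[of "p + k"] that vi[of "flat_index \<sigma> k"] by (simp add: mult.commute)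
  qed
  have y: "v $ (p + q) = - (\<Sum>j<p. ?\<psi> $$ (q, j) * v $ j) / 2 - \<sigma> * v $ q" if q: "q < p" for q
  proof -
    have "(\<Sum>j<p. ?\<psi> $$ (q, j) * v $ j) = (\<Sum>j<p. \<Sum>k<length es. ?\<psi> $$ (q, j) * (c k * es ! k $ j))"
      by (intro sum.cong refl) (simp add: vi sum_distrib_left)
    also have "\<dots> = (\<Sum>k<length es. c k * (\<Sum>j<p. ?\<psi> $$ (q, j) * es ! k $ j))"
      by (subst sum.swap) (simp add: sum_distrib_left mult.left_commute)
    finally have s: "(\<Sum>j<p. ?\<psi> $$ (q, j) * v $ j) = (\<Sum>k<length es. c k * (\<Sum>j<p. ?\<psi> $$ (q, j) * es ! k $ j))" .
    have "0 = (\<Sum>k<length es. ?a q k * c k)" using c[of q] q by simp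
    also have "\<dots> = (\<Sum>k<length es. c k * es ! k $ (p + q) + c k * (\<Sum>j<p. ?\<psi> $$ (q, j) * es ! k $ j) / 2 + \<sigma> * (c k * es ! k $ q))"
      by (intro sum.cong refl) (use q in \<open>simp add: algebra_simps\<close>)
    also have "\<dots> = v $ (p + q) + (\<Sum>j<p. ?\<psi> $$ (q, j) * v $ j) / 2 + \<sigma> * v $ q"
      unfolding s using q by (simp add: vi sum.distrib sum_distrib_left sum_divide_distrib)
    finally show ?thesis by simp
  qed
  have "(\<Sum>i<p. \<Sum>j<p. v $ i * ?\<psi> $$ (i, j) * v $ j) + (\<Sum>i<p. v $ i * v $ (p + i) + v $ (p + i) * v $ i) =
      (\<Sum>i<p. - 2 * \<sigma> * (v $ i)\<^sup>2)"
    unfolding sum.distrib[symmetric]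
  proof (intro sum.cong refl)
    fix i assume "i \<in> {..<p}"
    then have i: "i < p" by simp
    have "(\<Sum>j<p. v $ i * ?\<psi> $$ (i, j) * v $ j) = v $ i * (\<Sum>j<p. ?\<psi> $$ (i, j) * v $ j)"
      by (simp add: sum_distrib_left mult.assoc)
    then show "(\<Sum>j<p. v $ i * ?\<psi> $$ (i, j) * v $ j) + (v $ i * v $ (p + i) + v $ (p + i) * v $ i) = - 2 * \<sigma> * (v $ i)\<^sup>2"
      unfolding y[OF i] by (simp add: algebra_simps power2_eq_square)
  qed
  then have "\<sigma> * gip (G z) v v = - 2 * (\<sigma> * \<sigma>) * (\<Sum>i<p. (v $ i)\<^sup>2) +
      \<sigma> * (\<Sum>k<u + w. flat_sign u k * v $ (2 * p + k) * v $ (2 * p + k))"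
    unfolding gip_g_N[OF \<psi> v v] by (simp add: distrib_left sum_distrib_left mult.assoc mult.left_commute)
  moreover have "\<sigma> * \<sigma> = 1" using \<sigma> by auto
  moreover have "(\<Sum>i<p. (v $ i)\<^sup>2) \<ge> 0" by (simp add: sum_nonneg)
  ultimately show False using pos flat_part_sign[OF \<sigma> fl] by auto
qed

lemma definite_x_part:
  assumes \<sigma>: "\<sigma> \<in> {-1, 1}" and v: "v \<in> carrier_vec n" and x: "\<And>i. i < p \<Longrightarrow> v $ i = 0"
    and fl: "\<And>k. k < flat_dim \<sigma> \<Longrightarrow> v $ flat_index \<sigma> k = 0"
  shows "\<sigma> * gip (G z) v v \<le> 0"
  using flat_part_sign[OF \<sigma> fl] x by (simp add: gip_g_N[OF \<psi> v v])

text \<open>Suppose all \<open>x\<close>-parts are multiples of \<open>y \<noteq> 0\<close>. Then a single equation, the vanishing of a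
  coordinate \<open>i\<close> with \<open>y\<^sub>i \<noteq> 0\<close>, removes the \<open>x\<close>-part of a combination, and \<open>flat_dim \<sigma>\<close> more
  equations remove its flat part of sign \<open>\<sigma>\<close>. What is left cannot have a norm of sign \<open>\<sigma>\<close>.\<close>

lemma definite_family_independent_x_parts:
  assumes es: "definite_family z \<sigma> es" and \<sigma>: "\<sigma> \<in> {-1, 1}" and len: "flat_dim \<sigma> + 2 \<le> length es"
    and y: "\<And>k i j. k < length es \<Longrightarrow> i < p \<Longrightarrow> j < p \<Longrightarrow> es ! k $ i * y j = es ! k $ j * y i"
  shows "\<forall>i<p. y i = 0"
proof (rule ccontr)
  assume "\<not> (\<forall>i<p. y i = 0)"
  then obtain i where i: "i < p" "y i \<noteq> 0" by blast
  have lt: "Suc (flat_dim \<sigma>) < length es" using len by simp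
  let ?a = "\<lambda>q k. if q = 0 then es ! k $ i else es ! k $ flat_index \<sigma> (q - 1)"
  obtain v c where v: "v \<in> carrier_vec n" and vi: "\<And>i. i < n \<Longrightarrow> v $ i = (\<Sum>k<length es. c k * es ! k $ i)"
    and c: "\<And>q. q < Suc (flat_dim \<sigma>) \<Longrightarrow> (\<Sum>k<length es. ?a q k * c k) = 0" and pos: "\<sigma> * gip (G z) v v > 0"
    by (rule definite_family_combination[OF es \<sigma> lt, of ?a], rule that)
  have "v $ j = 0" if j: "j < p" for j
  proof -
    have "v $ j * y i = (\<Sum>k<length es. c k * (es ! k $ j * y i))"
      using j by (simp add: vi sum_distrib_right mult.assoc)
    also have "\<dots> = (\<Sum>k<length es. c k * (es ! k $ i * y j))"
      by (intro sum.cong refl) (simp add: y[OF _ j i(1)])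
    also have "\<dots> = (\<Sum>k<length es. es ! k $ i * c k) * y j"
      unfolding sum_distrib_right by (intro sum.cong) auto
    also have "\<dots> = 0" using c[of 0] by simp
    finally show ?thesis using i by simp
  qed
  moreover have "v $ flat_index \<sigma> k = 0" if "k < flat_dim \<sigma>" for k
  proof -
    have "flat_index \<sigma> k < n" using that by (auto simp: flat_index_def flat_dim_def split: if_splits)
    then show ?thesis using c[of "Suc k"] that vi[of "flat_index \<sigma> k"] by (simp add: mult.commute)
  qed
  ultimately have "\<sigma> * gip (G z) v v \<le> 0" by (rule definite_x_part[OF \<sigma> v])
  then show False using pos by simp
qed

end

section \<open>Jordan types for tensors with positive semidefinite Jacobi operators\<close>

context
  assumes Psi: "\<psi> \<in> Psi p" and p2: "p \<ge> 2"
begin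

private abbreviation (input) "block_of z es \<equiv> jacobi_form p \<psi> (first_coords p z) (g_N p \<psi> u w z) es"

lemmas psi_smooth = Psi_smooth[OF Psi]

lemmas jac_form_psd = Psi_jac_form_psd[OF Psi p2]

lemmas jac_form_ker = Psi_jac_form_kernel[OF Psi p2]

text \<open>A vector in the kernel is isotropic for every summand, all of them having the same sign, and so
  parallel to the \<open>x\<close>-part of each member of the family.\<close>

lemma definite_form_nondeg:
  assumes es: "definite_family z \<sigma> es" and \<sigma>: "\<sigma> \<in> {-1, 1}" and len: "flat_dim \<sigma> + 2 \<le> length es"
  shows "nondeg p (block_of z es)"
  unfolding nondeg_def
proof (rule allI, rule impI)
  fix y assume y: "\<forall>i<p. form_vec p (block_of z es) y i = 0"
  let ?A = "\<lambda>k. jac_form p \<psi> (first_coords p z) (($) (es ! k))"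
  have form: "block_of z es = (\<lambda>l j. \<Sum>k<length es. \<sigma> * ?A k l j)"
    using es by (auto simp: jacobi_form_def definite_family_def fun_eq_iff intro!: sum.cong)
  have "0 = form_val p (block_of z es) y y" using y by (intro kernel_isotropic[symmetric]) auto
  also have "\<dots> = \<sigma> * (\<Sum>k<length es. form_val p (?A k) y y)"
    unfolding form form_val_sum_form by (simp add: sum_distrib_left)
  finally have "(\<Sum>k<length es. form_val p (?A k) y y) = 0" using \<sigma> by auto
  then have "form_val p (?A k) y y = 0" if "k < length es" for k
    using sum_nonneg_eq_0_iff[of "{..<length es}" "\<lambda>k. form_val p (?A k) y y"] jac_form_psd that by (auto simp: psd_def)
  then have "es ! k $ i * y j = es ! k $ j * y i" if "k < length es" "i < p" "j < p" for k i j
    using jac_form_ker[OF psd_isotropic_kernel[OF jac_form_psd]] that by blast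
  then show "\<forall>i<p. y i = 0"
    by (rule definite_family_independent_x_parts[OF psi_smooth es \<sigma> len])
qed

text \<open>The \<open>x\<close>-part of the only member is nonzero, for otherwise the norm would come from flat directions of
  the opposite sign.\<close>

lemma definite_form_line:
  assumes es: "definite_family z \<sigma> es" and \<sigma>: "\<sigma> \<in> {-1, 1}" and len: "length es = 1" "flat_dim \<sigma> = 0"
  shows "\<exists>a. (\<Sum>i<p. a i * a i) = 1 \<and> block_similar (block_of z es) (proj_along a)"
proof -
  obtain e where e: "es = [e]" using len(1) by (metis One_nat_def length_0_conv length_Suc_conv)
  have ee: "gip (G z) e e = \<sigma>" and ec: "e \<in> carrier_vec n"
    using es by (auto simp: e definite_family_def orthonormal_def)
  let ?A = "jac_form p \<psi> (first_coords p z) (($) e)"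
  have form: "block_of z es = (\<lambda>l j. \<sigma> * ?A l j)" by (auto simp: jacobi_form_def e ee fun_eq_iff)
  have "\<exists>i<p. e $ i \<noteq> 0"
  proof (rule ccontr)
    assume "\<not> (\<exists>i<p. e $ i \<noteq> 0)"
    then have "\<sigma> * gip (G z) e e \<le> 0" using len(2) by (intro definite_x_part[OF psi_smooth \<sigma> ec]) auto
    then show False using ee \<sigma> by auto
  qed
  then obtain i0 where i0: "i0 < p" "e $ i0 \<noteq> 0" by blast
  define N where "N = (\<Sum>i<p. e $ i * e $ i)"
  have "N > 0" unfolding N_def by (rule sum_pos2[of _ i0]) (use i0 in \<open>auto simp: zero_less_mult_iff\<close>)
  define a where "a i = (1 / sqrt N) * e $ i" for i
  have a1: "(\<Sum>i<p. a i * a i) = 1"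
  proof -
    have "(\<Sum>i<p. a i * a i) = (\<Sum>i<p. (1 / N) * (e $ i * e $ i))"
      using \<open>N > 0\<close> by (intro sum.cong) (auto simp: a_def field_simps)
    also have "\<dots> = (1 / N) * N" by (simp only: sum_distrib_left[symmetric] N_def)
    finally show ?thesis using \<open>N > 0\<close> by simp
  qed
  have ap_form: "form_vec p (block_of z es) x i = \<sigma> * form_vec p ?A x i" for x i
    unfolding form form_vec_def by (simp add: sum_distrib_left mult.assoc)
  have "block_similar (block_of z es) (proj_along a)"
  proof (rule lower_block_similar_line_kernel[OF _ a1])
    show "sym_form p (block_of z es)"
      using jac_form_psd[of z "($) e"] unfolding form psd_def sym_form_def by simp
    show "form_vec p (block_of z es) a i = 0" if "i < p" for i
      unfolding ap_form a_def form_vec_scale using jac_form_kernel[of p \<psi> "first_coords p z" "($) e" i] by (simp add: form_vec_def)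
    fix x assume x: "\<And>i. i < p \<Longrightarrow> form_vec p (block_of z es) x i = 0"
    have "form_vec p ?A x i = 0" if "i < p" for i using x[OF that] \<sigma> unfolding ap_form by auto
    then have "e $ i0 * x j = e $ j * x i0" if "j < p" for j using jac_form_ker i0(1) that by blast
    then have "x j = (x i0 / e $ i0 * sqrt N) * a j" if "j < p" for j
      using that i0(2) \<open>N > 0\<close> by (simp add: a_def field_simps)
    then show "\<exists>t. \<forall>i<p. x i = t * a i" by blast
  qed
  then show ?thesis using a1 by blast
qed

lemma definite_forms_similar:
  assumes es: "definite_family z \<sigma> es" "definite_family z' \<sigma> es'" and \<sigma>: "\<sigma> \<in> {-1, 1}"
    and len: "length es = k" "length es' = k"
    and k: "flat_dim \<sigma> + 2 \<le> k \<or> flat_dim \<sigma> = 0 \<and> k = 1"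
  shows "block_similar (block_of z es) (block_of z' es')"
  using k
proof
  assume "flat_dim \<sigma> + 2 \<le> k"
  then show ?thesis
    by (intro lower_block_similar_nondeg definite_form_nondeg[OF es(1) \<sigma>] definite_form_nondeg[OF es(2) \<sigma>]) (simp_all add: len)
next
  assume k1: "flat_dim \<sigma> = 0 \<and> k = 1"
  then have l1: "length es = 1" "length es' = 1" "flat_dim \<sigma> = 0" using len by auto
  obtain a where a: "(\<Sum>i<p. a i * a i) = 1" "block_similar (block_of z es) (proj_along a)"
    using definite_form_line[OF es(1) \<sigma> l1(1,3)] by (elim exE conjE) (rule that)
  obtain b where b: "(\<Sum>i<p. b i * b i) = 1" "block_similar (block_of z' es') (proj_along b)"
    using definite_form_line[OF es(2) \<sigma> l1(2,3)] by (elim exE conjE) (rule that)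
  show ?thesis
    using similar_mat_trans[OF a(2) similar_mat_trans[OF lower_block_similar_hyperplane_projections[OF a(1) b(1)] similar_mat_sym[OF b(2)]]] .
qed

lemma Gr_definite:
  assumes \<sigma>: "\<sigma> \<in> {-1, 1}" and \<pi>: "\<pi> \<in> Gr n (G z) (if \<sigma> = -1 then k else 0) (if \<sigma> = -1 then 0 else k)"
  shows "\<exists>es. definite_family z \<sigma> es \<and> length es = k \<and> J_op z \<pi> = lower_block p n (block_of z es)"
proof -
  obtain es where on: "orthonormal n (G z) es"
    and f: "length (filter (\<lambda>e. gip (G z) e e = -1) es) = (if \<sigma> = -1 then k else 0)"
      "length (filter (\<lambda>e. gip (G z) e e = 1) es) = (if \<sigma> = -1 then 0 else k)"
      "length es = (if \<sigma> = -1 then k else 0) + (if \<sigma> = -1 then 0 else k)"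
    and J: "J_op z \<pi> = lower_block p n (block_of z es)"
    using Gr_orthonormal_basis[OF psi_smooth \<pi>] .
  have "gip (G z) e e = \<sigma>" if "e \<in> set es" for e
    using f(1,2) \<sigma> on that unfolding orthonormal_iff_distinct by (auto simp: filter_empty_conv split: if_splits)
  then have "definite_family z \<sigma> es" using on by (simp add: definite_family_def)
  then show ?thesis using f(3) J by auto
qed

text \<open>Extend an orthonormal basis of \<open>\<pi>\<close> by a family \<open>fs\<close>. The basis already contains as many vectors of
  sign \<open>- \<sigma>\<close> as the signature permits, so \<open>fs\<close> is definite of sign \<open>\<sigma>\<close>.\<close>

lemma Gr_codefinite:
  assumes \<sigma>: "\<sigma> \<in> {-1, 1}" and k: "k \<le> p + flat_dim \<sigma>"
    and \<pi>: "\<pi> \<in> Gr n (G z) (if \<sigma> = -1 then p + u - k else p + u) (if \<sigma> = -1 then p + w else p + w - k)"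
  shows "\<exists>es. definite_family z \<sigma> es \<and> length es = k \<and>
    J_op z \<pi> = lower_block p n (\<lambda>l j. - block_of z es l j)"
proof -
  obtain es where on: "orthonormal n (G z) es"
    and f: "length (filter (\<lambda>e. gip (G z) e e = -1) es) = (if \<sigma> = -1 then p + u - k else p + u)"
      "length (filter (\<lambda>e. gip (G z) e e = 1) es) = (if \<sigma> = -1 then p + w else p + w - k)"
      "length es = (if \<sigma> = -1 then p + u - k else p + u) + (if \<sigma> = -1 then p + w else p + w - k)"
    and J: "J_op z \<pi> = lower_block p n (block_of z es)"
    using Gr_orthonormal_basis[OF psi_smooth \<pi>] .
  obtain fs where fs: "orthonormal n (G z) (es @ fs)" "length es + length fs = n"
    "block_of z es = (\<lambda>l j. - block_of z fs l j)"
    using orthonormal_complement[OF psi_smooth on, of "first_coords p z"] .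
  have len: "length fs = k" using fs(2) f(3) k \<sigma> by (auto simp: flat_dim_def split: if_splits)
  \<comment> \<open>all vectors of the opposite sign; their number is bounded by the signature\<close>
  let ?ds = "filter (\<lambda>e. gip (G z) e e = - \<sigma>) (es @ fs)"
  have "definite_family z (- \<sigma>) ?ds"
    using orthonormal_filter[OF fs(1)] by (auto simp: definite_family_def)
  then have "length ?ds \<le> p + flat_dim (- \<sigma>)"
    by (rule definite_family_length[OF psi_smooth]) (use \<sigma> in auto)
  moreover have "length (filter (\<lambda>e. gip (G z) e e = - \<sigma>) es) = p + flat_dim (- \<sigma>)"
    using f(1,2) \<sigma> by (auto simp: flat_dim_def)
  ultimately have "filter (\<lambda>e. gip (G z) e e = - \<sigma>) fs = []" by simp
  then have ne: "gip (G z) e e \<noteq> - \<sigma>" if "e \<in> set fs" for e using that by (auto simp: filter_empty_conv)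
  have "gip (G z) e e = \<sigma>" if "e \<in> set fs" for e
  proof -
    have "gip (G z) e e \<in> {-1, 1}" using fs(1) that unfolding orthonormal_iff_distinct by auto
    then show ?thesis using ne[OF that] \<sigma> by auto
  qed
  moreover have "orthonormal n (G z) fs" using fs(1) unfolding orthonormal_iff_distinct by auto
  ultimately have "definite_family z \<sigma> fs" by (simp add: definite_family_def)
  then show ?thesis using len J fs(3) by auto
qed

lemma jordan_osserman_definite:
  assumes \<sigma>: "\<sigma> \<in> {-1, 1}" and k: "flat_dim \<sigma> + 2 \<le> k \<or> flat_dim \<sigma> = 0 \<and> k = 1"
  shows "jordan_osserman n (g_N p \<psi> u w) (if \<sigma> = -1 then k else 0) (if \<sigma> = -1 then 0 else k)"
  unfolding jordan_osserman_def
proof (intro ballI)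
  fix z z' \<pi> \<pi>'
  assume "\<pi> \<in> Gr n (G z) (if \<sigma> = -1 then k else 0) (if \<sigma> = -1 then 0 else k)"
    "\<pi>' \<in> Gr n (G z') (if \<sigma> = -1 then k else 0) (if \<sigma> = -1 then 0 else k)"
  from Gr_definite[OF \<sigma> this(1)] Gr_definite[OF \<sigma> this(2)]
  show "similar_mat (J_op z \<pi>) (J_op z' \<pi>')"
    using definite_forms_similar[OF _ _ \<sigma> _ _ k] by metis
qed

lemma jordan_osserman_codefinite:
  assumes \<sigma>: "\<sigma> \<in> {-1, 1}" and k: "flat_dim \<sigma> + 2 \<le> k \<or> flat_dim \<sigma> = 0 \<and> k = 1" "k \<le> p + flat_dim \<sigma>"
  shows "jordan_osserman n (g_N p \<psi> u w) (if \<sigma> = -1 then p + u - k else p + u) (if \<sigma> = -1 then p + w else p + w - k)"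
  unfolding jordan_osserman_def
proof (intro ballI)
  fix z z' \<pi> \<pi>'
  assume "\<pi> \<in> Gr n (G z) (if \<sigma> = -1 then p + u - k else p + u) (if \<sigma> = -1 then p + w else p + w - k)"
    "\<pi>' \<in> Gr n (G z') (if \<sigma> = -1 then p + u - k else p + u) (if \<sigma> = -1 then p + w else p + w - k)"
  from Gr_codefinite[OF \<sigma> k(2) this(1)] Gr_codefinite[OF \<sigma> k(2) this(2)]
  show "similar_mat (J_op z \<pi>) (J_op z' \<pi>')"
    using similar_lower_block_uminus[OF definite_forms_similar[OF _ _ \<sigma> _ _ k(1)]] by metis
qed

section \<open>Subspaces adapted to the coordinate axes\<close>

text \<open>The combination \<open>t\<^sub>i \<xi>\<^sub>i + (\<epsilon> / (2 t\<^sub>i)) \<partial>\<^sub>i\<^sup>y\<close> of null vectors, where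
  \<open>\<xi>\<^sub>i = \<partial>\<^sub>i\<^sup>x - (1/2) \<Sum>\<^sub>k \<psi>\<^sub>i\<^sub>k \<partial>\<^sub>k\<^sup>y\<close>. Its norm is \<open>\<epsilon>\<close> for every value of the parameter \<open>t\<^sub>i\<close>, and
  the vectors for \<open>\<epsilon> = 1\<close> and \<open>\<epsilon> = -1\<close> are orthogonal although they have the same \<open>x\<close>-part.\<close>

definition hyp_vec :: "point \<Rightarrow> (nat \<Rightarrow> real) \<Rightarrow> nat \<Rightarrow> real \<Rightarrow> real vec" where
  "hyp_vec z t i \<epsilon> = vec n (\<lambda>k. if k < p then if k = i then t i else 0
     else if k < 2 * p then - (\<psi> (first_coords p z) $$ (i, k - p) * t i / 2) + (if k = p + i then \<epsilon> / (2 * t i) else 0)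
     else 0)"

lemma hyp_vec_carrier [simp]: "hyp_vec z t i \<epsilon> \<in> carrier_vec n"
  by (simp add: hyp_vec_def)

lemma gip_hyp_vec:
  assumes ij: "i < p" "j < p" and t: "\<And>i. t i > 0"
  shows "gip (G z) (hyp_vec z t i \<epsilon>) (hyp_vec z t j \<delta>) = (if i = j then (\<epsilon> + \<delta>) / 2 else 0)"
proof -
  let ?\<psi> = "\<psi> (first_coords p z)"
  let ?a = "hyp_vec z t i \<epsilon>" and ?b = "hyp_vec z t j \<delta>"
  have x: "hyp_vec z t i \<epsilon> $ k = (if k = i then t i else 0)" if "k < p" for i \<epsilon> k using that by (simp add: hyp_vec_def)
  have y: "hyp_vec z t i \<epsilon> $ (p + k) = - (?\<psi> $$ (i, k) * t i / 2) + (if k = i then \<epsilon> / (2 * t i) else 0)"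
    if "k < p" for i \<epsilon> k using that by (simp add: hyp_vec_def)
  have f: "hyp_vec z t i \<epsilon> $ (2 * p + k) = 0" if "k < u + w" for i \<epsilon> k using that by (simp add: hyp_vec_def)
  have "(\<Sum>k<p. \<Sum>l<p. ?a $ k * ?\<psi> $$ (k, l) * ?b $ l) =
      (\<Sum>k<p. if k = i then \<Sum>l<p. t i * ?\<psi> $$ (k, l) * ?b $ l else 0)"
    by (intro sum.cong refl) (simp add: x)
  also have "\<dots> = (\<Sum>l<p. t i * ?\<psi> $$ (i, l) * ?b $ l)" using ij by simp
  also have "\<dots> = (\<Sum>l<p. if l = j then t i * ?\<psi> $$ (i, l) * t j else 0)"
  proof (intro sum.cong refl)
    fix l assume "l \<in> {..<p}"
    then show "t i * ?\<psi> $$ (i, l) * ?b $ l = (if l = j then t i * ?\<psi> $$ (i, l) * t j else 0)"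
      by (simp add: x)
  qed
  also have "\<dots> = t i * ?\<psi> $$ (i, j) * t j" using ij by (subst sum.delta) auto
  finally have 1: "(\<Sum>k<p. \<Sum>l<p. ?a $ k * ?\<psi> $$ (k, l) * ?b $ l) = t i * ?\<psi> $$ (i, j) * t j" .
  have "(\<Sum>k<p. ?a $ k * ?b $ (p + k) + ?a $ (p + k) * ?b $ k) =
      (\<Sum>k<p. (if k = i then t i * ?b $ (p + k) else 0) + (if k = j then ?a $ (p + k) * t j else 0))"
    by (intro sum.cong refl) (simp add: x)
  also have "\<dots> = t i * ?b $ (p + i) + ?a $ (p + j) * t j" using ij by (simp add: sum.distrib)
  finally have 2: "(\<Sum>k<p. ?a $ k * ?b $ (p + k) + ?a $ (p + k) * ?b $ k) = t i * ?b $ (p + i) + ?a $ (p + j) * t j" .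
  have 3: "(\<Sum>k<u + w. (flat_sign u k) * ?a $ (2 * p + k) * ?b $ (2 * p + k)) = 0"
    by (intro sum.neutral) (simp add: f)
  have s: "?\<psi> $$ (j, i) = ?\<psi> $$ (i, j)" using psi_sym[OF psi_smooth first_coords_in_Euclidean_space ij] by simp
  show ?thesis
    unfolding gip_g_N[OF psi_smooth hyp_vec_carrier hyp_vec_carrier] 1 2 3 y[OF ij(1)] y[OF ij(2)] s
    using t[of i] t[of j] by (auto simp: field_simps)
qed

lemma gip_unit_left:
  assumes "k < u + w" "b \<in> carrier_vec n"
  shows "gip (G z) (unit_vec n (2 * p + k)) b = (flat_sign u k) * b $ (2 * p + k)"
proof -
  have "(\<Sum>i<p. \<Sum>j<p. unit_vec n (2 * p + k) $ i * \<psi> (first_coords p z) $$ (i, j) * b $ j) = 0"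
    using assms(1) by (intro sum.neutral ballI) auto
  moreover have "(\<Sum>i<p. unit_vec n (2 * p + k) $ i * b $ (p + i) + unit_vec n (2 * p + k) $ (p + i) * b $ i) = 0"
    using assms(1) by (intro sum.neutral ballI) auto
  moreover have "(\<Sum>l<u + w. (flat_sign u l) * unit_vec n (2 * p + k) $ (2 * p + l) * b $ (2 * p + l)) =
      (\<Sum>l<u + w. if l = k then (flat_sign u k) * b $ (2 * p + l) else 0)"
    using assms(1) by (intro sum.cong) auto
  ultimately show ?thesis
    using assms by (simp add: gip_g_N[OF psi_smooth unit_vec_carrier assms(2)] del: index_unit_vec)
qed

text \<open>An orthonormal basis of the tangent space with labels: \<open>(0, i)\<close> and \<open>(1, i)\<close> for the timelike and
  the spacelike vector over the \<open>i\<close>-th coordinate axis, \<open>(2, k)\<close> for the \<open>k\<close>-th flat direction.\<close>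

definition frame :: "point \<Rightarrow> (nat \<Rightarrow> real) \<Rightarrow> nat \<times> nat \<Rightarrow> real vec" where
  "frame z t c = (case c of (m, i) \<Rightarrow> if m = 2 then unit_vec n (2 * p + i) else hyp_vec z t i (if m = 0 then -1 else 1))"

definition frame_sign :: "nat \<times> nat \<Rightarrow> real" where
  "frame_sign c = (case c of (m, i) \<Rightarrow> if m = 2 then if i < u then -1 else 1 else if m = 0 then -1 else 1)"

definition frame_index :: "(nat \<times> nat) set" where
  "frame_index = {(m, i). m < 2 \<and> i < p \<or> m = 2 \<and> i < u + w}"

lemma frame_carrier [simp]: "frame z t c \<in> carrier_vec n"
  by (auto simp: frame_def split: prod.split)

lemma gip_frame:
  assumes c: "c \<in> frame_index" and d: "d \<in> frame_index" and t: "\<And>i. t i > 0"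
  shows "gip (G z) (frame z t c) (frame z t d) = (if c = d then frame_sign c else 0)"
proof -
  obtain m i m' j where cd: "c = (m, i)" "d = (m', j)" by (metis surj_pair)
  have hv_flat: "hyp_vec z t i \<epsilon> $ (2 * p + k) = 0" if "k < u + w" for i \<epsilon> k using that by (simp add: hyp_vec_def)
  consider "m = 2" | "m < 2" "m' = 2" | "m < 2" "m' < 2"
    using c d by (auto simp: cd frame_index_def)
  then show ?thesis
  proof cases
    case 1
    then have i: "i < u + w" using c by (simp add: cd frame_index_def)
    show ?thesis
    proof (cases "m' = 2")
      case True
      then have "j < u + w" using d by (simp add: cd frame_index_def)
      then show ?thesis using 1 True i by (simp add: frame_def cd frame_sign_def gip_unit_left)
    next
      case False
      then show ?thesis using 1 i by (simp add: frame_def cd gip_unit_left hv_flat)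
    qed
  next
    case 2
    then have j: "j < u + w" using d by (simp add: cd frame_index_def)
    have "gip (G z) (frame z t c) (frame z t d) = gip (G z) (frame z t d) (frame z t c)"
      by (rule gip_commute[OF g_N_carrier[OF psi_smooth] g_N_transpose[OF psi_smooth]]) auto
    also have "\<dots> = 0" using 2 j by (simp add: frame_def cd gip_unit_left hv_flat)
    finally show ?thesis using 2 by (simp add: cd)
  next
    case 3
    then have "i < p" "j < p" using c d by (auto simp: cd frame_index_def)
    then show ?thesis using 3 by (auto simp: frame_def cd frame_sign_def gip_hyp_vec[OF _ _ t] less_2_cases_iff)
  qed
qed

private abbreviation (input) "axis_form z i \<equiv> jac_form p \<psi> (first_coords p z) (\<lambda>a. if a = i then 1 else 0)"

lemma jac_form_frame:
  "jac_form p \<psi> (first_coords p z) (($) (frame z t (m, i))) l j = (if m = 2 then 0 else (t i)\<^sup>2 * axis_form z i l j)"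
proof (cases "m = 2")
  case True
  then show ?thesis by (auto simp: frame_def unit_vec_def intro!: jac_form_zero)
next
  case False
  then have "jac_form p \<psi> (first_coords p z) (($) (frame z t (m, i))) l j =
      jac_form p \<psi> (first_coords p z) (\<lambda>a. t i * (if a = i then 1 else 0)) l j"
    by (intro jac_form_cong) (simp add: frame_def hyp_vec_def)
  then show ?thesis using False by (simp only: jac_form_scale if_False)
qed

text \<open>The block of a coordinate subspace of the frame that contains the timelike vectors over the axes in
  \<open>I\<close>, the spacelike vectors over the axes in \<open>K\<close>, and any flat directions. Axes in both sets cancel.\<close>

definition config_form :: "point \<Rightarrow> (nat \<Rightarrow> real) \<Rightarrow> nat set \<Rightarrow> nat set \<Rightarrow> nat \<Rightarrow> nat \<Rightarrow> real" where
  "config_form z t I K l j = (\<Sum>i\<in>K. (t i)\<^sup>2 * axis_form z i l j) - (\<Sum>i\<in>I. (t i)\<^sup>2 * axis_form z i l j)"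

private abbreviation (input) "config0 \<equiv> config_form (\<lambda>_. 0)"

text \<open>The flat directions supply the missing \<open>r - card I\<close> timelike and \<open>s - card K\<close> spacelike vectors.\<close>

lemma config_exists:
  assumes t: "\<And>i. t i > 0" and I: "I \<subseteq> {..<p}" "card I \<le> r" "r \<le> card I + u"
    and K: "K \<subseteq> {..<p}" "card K \<le> s" "s \<le> card K + w"
  shows "\<exists>\<pi>\<in>Gr n (G z) r s. J_op z \<pi> = lower_block p n (config_form z t I K)"
proof -
  define F where "F = {..<r - card I} \<union> {u..<u + (s - card K)}"
  have fin: "finite I" "finite K" "finite F" using I(1) K(1) finite_subset by (auto simp: F_def)
  define S where "S = Pair (0 :: nat) ` I \<union> Pair 1 ` K \<union> Pair 2 ` F"
  have S: "S \<subseteq> frame_index" using I K by (auto simp: S_def frame_index_def F_def)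
  obtain ls where ls: "set ls = S" "distinct ls" using finite_distinct_list[of S] fin by (auto simp: S_def)
  define es where "es = map (frame z t) ls"
  have gip: "gip (G z) (es ! i) (es ! j) = (if i = j then frame_sign (ls ! i) else 0)"
    if "i < length ls" "j < length ls" for i j
  proof -
    have "ls ! i \<in> frame_index" "ls ! j \<in> frame_index" using S ls that by (auto dest: nth_mem)
    then show ?thesis using that gip_frame[OF _ _ t] ls(2) by (simp add: es_def nth_eq_iff_index_eq)
  qed
  have sign: "frame_sign c \<in> {-1, 1}" for c by (auto simp: frame_sign_def split: prod.split)
  have on: "orthonormal n (G z) es"
    unfolding orthonormal_def using gip sign by (auto simp: es_def)
  define \<pi> where "\<pi> = LinearCombinations.module.span class_ring (module_vec TYPE(real) n) (set es)"
  have ob: "orthonormal_basis n (G z) \<pi> es" using on by (simp add: orthonormal_basis_iff \<pi>_def)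
  have count: "length (filter (\<lambda>e. gip (G z) e e = \<epsilon>) es) = card {c\<in>S. frame_sign c = \<epsilon>}" for \<epsilon>
  proof -
    have "filter (\<lambda>c. gip (G z) (frame z t c) (frame z t c) = \<epsilon>) ls = filter (\<lambda>c. frame_sign c = \<epsilon>) ls"
      by (intro filter_cong refl) (use S ls gip_frame[OF _ _ t] in auto)
    then have "length (filter (\<lambda>e. gip (G z) e e = \<epsilon>) es) = length (filter (\<lambda>c. frame_sign c = \<epsilon>) ls)"
      by (simp add: es_def filter_map o_def)
    also have "\<dots> = card (set (filter (\<lambda>c. frame_sign c = \<epsilon>) ls))"
      by (rule distinct_card[symmetric]) (simp add: ls(2))
    finally show ?thesis by (simp add: ls(1))
  qed
  have neg: "{c\<in>S. frame_sign c = -1} = Pair 0 ` I \<union> Pair 2 ` {..<r - card I}"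
    using I(3) by (auto simp: S_def frame_sign_def F_def)
  have pos: "{c\<in>S. frame_sign c = 1} = Pair 1 ` K \<union> Pair 2 ` {u..<u + (s - card K)}"
    using I(3) by (auto simp: S_def frame_sign_def F_def split: if_splits)
  have "card {c\<in>S. frame_sign c = -1} = r"
    unfolding neg using I(2) fin by (subst card_Un_disjoint) (auto simp: card_image inj_on_def)
  moreover have "card {c\<in>S. frame_sign c = 1} = s"
    unfolding pos using K(2) fin by (subst card_Un_disjoint) (auto simp: card_image inj_on_def)
  ultimately have "\<pi> \<in> Gr n (G z) r s"
    unfolding Gr_def using ob count by blast
  moreover have "block_of z es l j = config_form z t I K l j" for l j
  proof -
    let ?h = "\<lambda>c. frame_sign c * jac_form p \<psi> (first_coords p z) (($) (frame z t c)) l j"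
    have "block_of z es l j = (\<Sum>k<length ls. ?h (ls ! k))"
      unfolding jacobi_form_def
    proof (intro sum.cong)
      fix k assume "k \<in> {..<length ls}"
      then show "gip (G z) (es ! k) (es ! k) * jac_form p \<psi> (first_coords p z) (($) (es ! k)) l j = ?h (ls ! k)"
        using gip[of k k] by (simp add: es_def)
    qed (simp add: es_def)
    also have "\<dots> = (\<Sum>c\<in>S. ?h c)"
      using sum.reindex_bij_betw[OF bij_betw_nth[OF ls(2) refl ls(1)[symmetric]], of ?h] by simp
    also have "\<dots> = (\<Sum>c\<in>Pair 0 ` I. ?h c) + (\<Sum>c\<in>Pair 1 ` K. ?h c) + (\<Sum>c\<in>Pair 2 ` F. ?h c)"
      unfolding S_def using fin by (subst sum.union_disjoint, auto)+
    also have "\<dots> = (\<Sum>i\<in>I. ?h (0, i)) + (\<Sum>i\<in>K. ?h (1, i)) + (\<Sum>i\<in>F. ?h (2, i))"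
      by (simp add: sum.reindex inj_on_def)
    also have "\<dots> = config_form z t I K l j"
      by (simp add: jac_form_frame frame_sign_def config_form_def sum_negf)
    finally show ?thesis .
  qed
  ultimately show ?thesis
    using jacobi_sub_eq[OF psi_smooth ob] by (metis lower_block_cong)
qed

lemma jordan_osserman_configs:
  assumes jo: "jordan_osserman n (g_N p \<psi> u w) r s"
    and 1: "\<And>i. t i > 0" "I \<subseteq> {..<p}" "card I \<le> r" "r \<le> card I + u" "K \<subseteq> {..<p}" "card K \<le> s" "s \<le> card K + w"
    and 2: "\<And>i. t' i > 0" "I' \<subseteq> {..<p}" "card I' \<le> r" "r \<le> card I' + u" "K' \<subseteq> {..<p}" "card K' \<le> s" "s \<le> card K' + w"
  shows "block_similar (config0 t I K) (config0 t' I' K')"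
proof -
  let ?z = "\<lambda>_. 0 :: real"
  have z: "?z \<in> topspace (Euclidean_space n)" by (simp add: topspace_Euclidean_space)
  obtain \<pi> where \<pi>: "\<pi> \<in> Gr n (G ?z) r s" "J_op ?z \<pi> = lower_block p n (config_form ?z t I K)"
    by (rule bexE[OF config_exists[OF 1, where z = ?z]], rule that)
  obtain \<pi>' where \<pi>': "\<pi>' \<in> Gr n (G ?z) r s" "J_op ?z \<pi>' = lower_block p n (config_form ?z t' I' K')"
    by (rule bexE[OF config_exists[OF 2, where z = ?z]], rule that)
  have "similar_mat (J_op ?z \<pi>) (J_op ?z \<pi>')"
    using jo[unfolded jordan_osserman_def, rule_format, OF z z \<pi>(1) \<pi>'(1)] .
  then show ?thesis unfolding \<pi>(2) \<pi>'(2) .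
qed

private abbreviation (input) "axis0 i \<equiv> axis_form (\<lambda>_. 0) i"

text \<open>From here on everything takes place at the origin, which suffices to refute the Jordan Osserman
  condition.\<close>

definition axis_sum :: "nat set \<Rightarrow> nat \<Rightarrow> nat \<Rightarrow> real" where
  "axis_sum K l j = (\<Sum>i\<in>K. axis0 i l j)"

lemma axis0_psd: "psd p (axis0 i)"
  by (rule jac_form_psd)

lemma axis0_kernel: "(\<And>l. l < p \<Longrightarrow> form_vec p (axis0 i) y l = 0) \<Longrightarrow> i < p \<Longrightarrow> j < p \<Longrightarrow> j \<noteq> i \<Longrightarrow> y j = 0"
  using jac_form_ker[of "\<lambda>_. 0" "\<lambda>a. if a = i then 1 else 0" y i j] by simp

lemma axis0_pos:
  assumes "i < p"
  obtains x where "form_val p (axis0 i) x x > 0"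
proof -
  obtain j where j: "j < p" "j \<noteq> i" using p2 by (metis One_nat_def Suc_1 less_le_trans lessI zero_less_Suc zero_neq_one)
  let ?x = "\<lambda>k. if k = j then 1 else 0 :: real"
  have "form_val p (axis0 i) ?x ?x \<noteq> 0"
    using axis0_kernel[OF psd_isotropic_kernel[OF axis0_psd], of i ?x j] assms j by auto
  then have "form_val p (axis0 i) ?x ?x > 0" using axis0_psd[of i] unfolding psd_def by (metis order_le_less)
  then show ?thesis using that by blast
qed

lemma axis0_nonzero:
  assumes "i < p" "\<And>l j. l < p \<Longrightarrow> j < p \<Longrightarrow> axis0 i l j = 0"
  shows False
proof -
  obtain x where "form_val p (axis0 i) x x > 0" using axis0_pos[OF assms(1)] .
  moreover have "form_val p (axis0 i) x x = 0" unfolding form_val_def form_vec_def using assms(2) by simp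
  ultimately show False by simp
qed

lemma form_vec_axis_sum: "form_vec p (axis_sum K) x i = (\<Sum>k\<in>K. form_vec p (axis0 k) x i)"
  using form_vec_sum_form[of p "\<lambda>_. 1" "\<lambda>k. axis0 k" K x i] by (simp add: axis_sum_def[abs_def])

lemma form_val_axis_sum: "form_val p (axis_sum K) x y = (\<Sum>k\<in>K. form_val p (axis0 k) x y)"
  using form_val_sum_form[of p "\<lambda>_. 1" "\<lambda>k. axis0 k" K x y] by (simp add: axis_sum_def[abs_def])

lemma axis_sum_psd: "psd p (axis_sum K)"
proof -
  have "axis_sum K i j = axis_sum K j i" if "i < p" "j < p" for i j
    unfolding axis_sum_def using axis0_psd that by (intro sum.cong refl) (simp add: psd_def sym_form_def)
  moreover have "0 \<le> form_val p (axis_sum K) x x" for x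
    unfolding form_val_axis_sum using axis0_psd by (intro sum_nonneg) (simp add: psd_def)
  ultimately show ?thesis by (simp add: psd_def sym_form_def)
qed

text \<open>The kernels of two different axes intersect in zero.\<close>

lemma axis_sum_nondeg:
  assumes K: "K \<subseteq> {..<p}" and ij: "i \<in> K" "j \<in> K" "i \<noteq> j"
  shows "nondeg p (axis_sum K)"
  unfolding nondeg_def
proof (rule allI, rule impI, rule allI, rule impI)
  fix x k assume x: "\<forall>i<p. form_vec p (axis_sum K) x i = 0" and k: "k < p"
  have fin: "finite K" using K finite_subset by blast
  have "0 = (\<Sum>k\<in>K. form_val p (axis0 k) x x)" unfolding form_val_axis_sum[symmetric] using x by (intro kernel_isotropic[symmetric]) auto
  then have "form_val p (axis0 m) x x = 0" if "m \<in> K" for m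
    using sum_nonneg_eq_0_iff[OF fin, of "\<lambda>k. form_val p (axis0 k) x x"] axis0_psd that by (auto simp: psd_def)
  then have "x k = 0" if "m \<in> K" "k \<noteq> m" for m
    using axis0_kernel[OF psd_isotropic_kernel[OF axis0_psd], of m x k] K k that by auto
  then show "x k = 0" using ij by metis
qed

text \<open>The rank of the sum over the first \<open>k\<close> axes is \<open>0\<close>, \<open>p - 1\<close>, \<open>p\<close> for \<open>k = 0, 1, 2\<close>.\<close>

lemma not_similar_axis_sum_step:
  assumes k: "k \<le> 1"
  shows "\<not> block_similar (axis_sum {..<k}) (axis_sum {..<Suc k})"
proof
  assume sim: "block_similar (axis_sum {..<k}) (axis_sum {..<Suc k})"
  show False
  proof (cases "k = 0")
    case True
    then have "axis_sum {..<k} = (\<lambda>_ _. 0)" by (simp add: axis_sum_def fun_eq_iff)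
    then have "axis_sum {..<Suc k} l j = 0" if "l < p" "j < p" for l j
      using similar_lower_block_zero[OF similar_mat_sym] sim that by metis
    then show False using axis0_nonzero[of 0] p2 True by (simp add: axis_sum_def)
  next
    case False
    then have "k = 1" using k by simp
    have "nondeg p (axis_sum {..<Suc k})"
      by (rule axis_sum_nondeg[of _ 0 1]) (use p2 \<open>k = 1\<close> in auto)
    then have nd: "nondeg p (axis_sum {..<k})" by (rule similar_lower_block_nondeg[OF similar_mat_sym[OF sim]])
    have ap0: "form_vec p (axis_sum {..<k}) (\<lambda>a. if a = 0 then 1 else 0) i = 0" for i
    proof -
      have "form_vec p (axis_sum {..<k}) (\<lambda>a. if a = 0 then 1 else 0) i = form_vec p (axis0 0) (\<lambda>a. if a = 0 then 1 else 0) i"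
        unfolding form_vec_axis_sum \<open>k = 1\<close> by simp
      also have "\<dots> = 0"
        using jac_form_kernel[of p \<psi> "first_coords p (\<lambda>_. 0)" "\<lambda>a. if a = 0 then 1 else 0" i] unfolding form_vec_def .
      finally show ?thesis .
    qed
    have "\<forall>i<p. (if i = 0 then 1 else 0 :: real) = 0"
      by (rule mp[OF nd[unfolded nondeg_def, THEN spec, of "\<lambda>a. if a = 0 then 1 else 0"]]) (intro allI impI ap0)
    from this[THEN spec, of 0] show False using p2 by simp
  qed
qed

lemma not_similar_uminus:
  assumes "\<not> block_similar S S'"
  shows "\<not> block_similar (\<lambda>l j. - S l j) (\<lambda>l j. - S' l j)"
  using similar_lower_block_uminus[of p n "\<lambda>l j. - S l j" "\<lambda>l j. - S' l j"] assms by auto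

private abbreviation (input) "ones \<equiv> \<lambda>_ :: nat. 1 :: real"

lemma config_plus: "config0 ones {} K = axis_sum K"
  by (simp add: config_form_def axis_sum_def fun_eq_iff)

lemma config_minus: "config0 ones I {} = (\<lambda>l j. - axis_sum I l j)"
  by (simp add: config_form_def axis_sum_def fun_eq_iff)

text \<open>This configuration is an orthogonal complement of the timelike one over \<open>I\<close>.\<close>

lemma config_co_plus: "I \<subseteq> {..<p} \<Longrightarrow> config0 ones ({..<p} - I) {..<p} = axis_sum I"
  by (auto simp: config_form_def axis_sum_def fun_eq_iff sum_diff)

lemma config_co_minus: "I \<subseteq> {..<p} \<Longrightarrow> config0 ones {..<p} ({..<p} - I) = (\<lambda>l j. - axis_sum I l j)"
  by (auto simp: config_form_def axis_sum_def fun_eq_iff sum_diff)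

text \<open>With at most \<open>u + 1\<close> timelike vectors, all but \<open>k = r - u \<le> 1\<close> of them fit into the flat factor,
  but one may also use \<open>k + 1\<close> axes; the truncated difference is \<open>0\<close> when all of them fit.\<close>

lemma not_jordan_timelike:
  assumes "u > 0" "1 \<le> r" "r \<le> u + 1"
  shows "\<not> jordan_osserman n (g_N p \<psi> u w) r 0"
proof
  assume jo: "jordan_osserman n (g_N p \<psi> u w) r 0"
  define k where "k = r - u"
  have k: "k \<le> 1" using assms by (simp add: k_def)
  have "block_similar (config0 ones {..<k} {}) (config0 ones {..<Suc k} {})"
    by (rule jordan_osserman_configs[OF jo]) (use assms p2 k in \<open>auto simp: k_def\<close>)
  then show False using not_similar_uminus[OF not_similar_axis_sum_step[OF k]] by (simp add: config_minus)
qed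

lemma not_jordan_spacelike:
  assumes "w > 0" "1 \<le> s" "s \<le> w + 1"
  shows "\<not> jordan_osserman n (g_N p \<psi> u w) 0 s"
proof
  assume jo: "jordan_osserman n (g_N p \<psi> u w) 0 s"
  define k where "k = s - w"
  have k: "k \<le> 1" using assms by (simp add: k_def)
  have "block_similar (config0 ones {} {..<k}) (config0 ones {} {..<Suc k})"
    by (rule jordan_osserman_configs[OF jo]) (use assms p2 k in \<open>auto simp: k_def\<close>)
  then show False using not_similar_axis_sum_step[OF k] by (simp add: config_plus)
qed

lemma not_jordan_cotimelike:
  assumes "u > 0" "1 \<le> r" "r \<le> u + 1"
  shows "\<not> jordan_osserman n (g_N p \<psi> u w) (p + u - r) (p + w)"
proof
  assume jo: "jordan_osserman n (g_N p \<psi> u w) (p + u - r) (p + w)"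
  define k where "k = r - u"
  have k: "k \<le> 1" using assms by (simp add: k_def)
  have c: "card ({..<p} - {..<k}) = p - k" "card ({..<p} - {..<Suc k}) = p - Suc k"
    using k p2 by (simp_all add: card_Diff_subset)
  have "block_similar (config0 ones ({..<p} - {..<k}) {..<p})
      (config0 ones ({..<p} - {..<Suc k}) {..<p})"
    by (rule jordan_osserman_configs[OF jo]) (use assms p2 k c in \<open>auto simp: k_def\<close>)
  moreover have "{..<k} \<subseteq> {..<p}" "{..<Suc k} \<subseteq> {..<p}" using k p2 by auto
  ultimately show False using not_similar_axis_sum_step[OF k] by (simp only: config_co_plus)
qed

lemma not_jordan_cospacelike:
  assumes "w > 0" "1 \<le> s" "s \<le> w + 1"
  shows "\<not> jordan_osserman n (g_N p \<psi> u w) (p + u) (p + w - s)"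
proof
  assume jo: "jordan_osserman n (g_N p \<psi> u w) (p + u) (p + w - s)"
  define k where "k = s - w"
  have k: "k \<le> 1" using assms by (simp add: k_def)
  have c: "card ({..<p} - {..<k}) = p - k" "card ({..<p} - {..<Suc k}) = p - Suc k"
    using k p2 by (simp_all add: card_Diff_subset)
  have "block_similar (config0 ones {..<p} ({..<p} - {..<k}))
      (config0 ones {..<p} ({..<p} - {..<Suc k}))"
    by (rule jordan_osserman_configs[OF jo]) (use assms p2 k c in \<open>auto simp: k_def\<close>)
  moreover have "{..<k} \<subseteq> {..<p}" "{..<Suc k} \<subseteq> {..<p}" using k p2 by auto
  ultimately show False using not_similar_uminus[OF not_similar_axis_sum_step[OF k]] by (simp only: config_co_minus)
qed

text \<open>The degenerate value of the parameter and half of it.\<close>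

lemma pencil_not_similar:
  assumes K: "K \<subseteq> {..<p}" "i \<in> K" "j \<in> K" "i \<noteq> j"
  shows "\<exists>t>0. \<exists>t'>0. \<not> block_similar (\<lambda>l j. axis_sum K l j - t * axis0 0 l j) (\<lambda>l j. axis_sum K l j - t' * axis0 0 l j)"
proof -
  obtain x where x: "form_val p (axis0 0) x x > 0" using axis0_pos[of 0] p2 by auto
  obtain t where t: "t > 0" "\<not> nondeg p (\<lambda>l j. axis_sum K l j - t * axis0 0 l j)" "nondeg p (\<lambda>l j. axis_sum K l j - t / 2 * axis0 0 l j)"
    using definite_pencil_degenerates[OF axis_sum_psd axis_sum_nondeg[OF K] axis0_psd x] by blast
  then have "\<not> block_similar (\<lambda>l j. axis_sum K l j - t / 2 * axis0 0 l j) (\<lambda>l j. axis_sum K l j - t * axis0 0 l j)"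
    using similar_lower_block_nondeg by blast
  then show ?thesis using t(1) by (intro exI[of _ "t / 2"] conjI exI[of _ t]) auto
qed

private abbreviation (input) "stretch t \<equiv> \<lambda>i :: nat. if i = 0 then sqrt t else 1"

text \<open>The parameter of the frame is stretched on axis \<open>0\<close> only, so that the form of this axis is
  multiplied by \<open>t\<close>.\<close>

lemma sum_stretch:
  assumes "t > 0" "1 \<le> a"
  shows "(\<Sum>i<a. (stretch t i)\<^sup>2 * axis0 i l j) = t * axis0 0 l j + (\<Sum>i\<in>{1..<a}. axis0 i l j)"
    and "(\<Sum>i\<in>{1..b}. (stretch t i)\<^sup>2 * axis0 i l j) = (\<Sum>i\<in>{1..b}. axis0 i l j)"
proof -
  have "{..<a} = insert 0 {1..<a}" using assms(2) by auto
  then have "(\<Sum>i<a. (stretch t i)\<^sup>2 * axis0 i l j) = t * axis0 0 l j + (\<Sum>i\<in>{1..<a}. (stretch t i)\<^sup>2 * axis0 i l j)"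
    using assms(1) by simp
  also have "(\<Sum>i\<in>{1..<a}. (stretch t i)\<^sup>2 * axis0 i l j) = (\<Sum>i\<in>{1..<a}. axis0 i l j)"
    by (intro sum.cong) auto
  finally show "(\<Sum>i<a. (stretch t i)\<^sup>2 * axis0 i l j) = t * axis0 0 l j + (\<Sum>i\<in>{1..<a}. axis0 i l j)" .
  show "(\<Sum>i\<in>{1..b}. (stretch t i)\<^sup>2 * axis0 i l j) = (\<Sum>i\<in>{1..b}. axis0 i l j)"
    by (intro sum.cong) auto
qed

lemma axis_sum_difference:
  assumes "1 \<le> a" "a \<le> Suc b"
  shows "(\<Sum>i\<in>{1..b}. axis0 i l j) - (\<Sum>i\<in>{1..<a}. axis0 i l j) = axis_sum {a..b} l j"
proof -
  have "{1..b} = {1..<a} \<union> {a..b}" "{1..<a} \<inter> {a..b} = {}" using assms by auto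
  then show ?thesis by (simp add: sum.union_disjoint axis_sum_def)
qed

text \<open>Timelike vectors over the axes \<open>0, \<dots>, a - 1\<close> and spacelike ones over \<open>1, \<dots>, b\<close>: the common
  axes cancel, axis \<open>0\<close> enters negatively with weight \<open>t\<close>, and at least two axes enter positively if
  \<open>a < b\<close>.\<close>

lemma config_mixed_plus:
  assumes "t > 0" "1 \<le> a" "a \<le> Suc b"
  shows "config0 (stretch t) {..<a} {1..b} = (\<lambda>l j. axis_sum {a..b} l j - t * axis0 0 l j)"
  using axis_sum_difference[OF assms(2,3)] unfolding config_form_def
  by (simp only: sum_stretch[OF assms(1,2)] fun_eq_iff) (simp add: algebra_simps)

lemma config_mixed_minus:
  assumes "t > 0" "1 \<le> b" "b \<le> Suc a"
  shows "config0 (stretch t) {1..a} {..<b} = (\<lambda>l j. - (axis_sum {b..a} l j - t * axis0 0 l j))"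
  using axis_sum_difference[OF assms(2,3)] unfolding config_form_def
  by (simp only: sum_stretch[OF assms(1,2)] fun_eq_iff) (simp add: algebra_simps)

text \<open>Flat vectors allow one to use \<open>a\<close> timelike and \<open>b\<close> spacelike vectors over the axes, with both
  numbers between \<open>1\<close> and \<open>p - 1\<close>. If \<open>a = b\<close>, the block may vanish, but shifting the spacelike
  axes by one produces a pencil in \<open>t\<close> that cannot vanish for two values of \<open>t\<close>. If \<open>a \<noteq> b\<close>, the
  shifted configurations give \<open>\<plusminus>(P - t Q)\<close> with \<open>P\<close> positive definite.\<close>

lemma not_jordan_mixed:
  assumes r: "1 \<le> r" "r \<le> p + u - 1" and s: "1 \<le> s" "s \<le> p + w - 1"
  shows "\<not> jordan_osserman n (g_N p \<psi> u w) r s"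
proof
  assume jo: "jordan_osserman n (g_N p \<psi> u w) r s"
  define a where "a = max 1 (r - u)"
  define b where "b = max 1 (s - w)"
  have a: "1 \<le> a" "a \<le> p - 1" "a \<le> r" "r \<le> a + u" using r p2 by (auto simp: a_def)
  have b: "1 \<le> b" "b \<le> p - 1" "b \<le> s" "s \<le> b + w" using s p2 by (auto simp: b_def)
  consider "a = b" | "a < b" | "b < a" by linarith
  then show False
  proof cases
    case 1
    have z: "config0 ones {..<a} {..<a} = (\<lambda>_ _. 0)" by (simp add: config_form_def fun_eq_iff)
    have "block_similar (\<lambda>l j. axis_sum {a..a} l j - t * axis0 0 l j) (\<lambda>_ _. 0)" if "t > 0" for t
    proof -
      have "block_similar (config0 (stretch t) {..<a} {1..a}) (config0 ones {..<a} {..<a})"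
        by (rule jordan_osserman_configs[OF jo]) (use that a b 1 p2 in auto)
      then show ?thesis unfolding z config_mixed_plus[OF that a(1) le_SucI[OF order_refl]] .
    qed
    then have zero: "axis_sum {a..a} l j - t * axis0 0 l j = 0" if "t > 0" "l < p" "j < p" for t l j
      by (rule similar_lower_block_zero[OF _ that(2,3)]) (rule that(1))
    have "axis0 0 l j = 0" if "l < p" "j < p" for l j using zero[of 1 l j] zero[of 2 l j] that by simp
    then show False using axis0_nonzero[of 0] p2 by simp
  next
    case 2
    have "block_similar (config0 (stretch t) {..<a} {1..b}) (config0 (stretch t') {..<a} {1..b})"
      if "t > 0" "t' > 0" for t t'
      by (rule jordan_osserman_configs[OF jo]) (use that a b 2 p2 in auto)
    then have "block_similar (\<lambda>l j. axis_sum {a..b} l j - t * axis0 0 l j) (\<lambda>l j. axis_sum {a..b} l j - t' * axis0 0 l j)"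
      if "t > 0" "t' > 0" for t t'
      using that config_mixed_plus[OF _ a(1), of _ b] 2 by simp
    moreover have "{a..b} \<subseteq> {..<p}" using b(2) p2 by auto
    ultimately show False using pencil_not_similar[of "{a..b}" a b] 2 by auto
  next
    case 3
    have "block_similar (config0 (stretch t) {1..a} {..<b}) (config0 (stretch t') {1..a} {..<b})"
      if "t > 0" "t' > 0" for t t'
      by (rule jordan_osserman_configs[OF jo]) (use that a b 3 p2 in auto)
    then have "block_similar (\<lambda>l j. - (axis_sum {b..a} l j - t * axis0 0 l j)) (\<lambda>l j. - (axis_sum {b..a} l j - t' * axis0 0 l j))"
      if "t > 0" "t' > 0" for t t'
      using that config_mixed_minus[OF _ b(1), of _ a] 3 by simp
    moreover have "{b..a} \<subseteq> {..<p}" using a(2) p2 by auto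
    then obtain t t' where t: "t > 0" "t' > 0"
      "\<not> block_similar (\<lambda>l j. axis_sum {b..a} l j - t * axis0 0 l j) (\<lambda>l j. axis_sum {b..a} l j - t' * axis0 0 l j)"
      using pencil_not_similar[of "{b..a}" b a] 3 by auto
    ultimately show False using not_similar_uminus[OF t(3)] by blast
  qed
qed

lemma jordan_osserman_listed:
  assumes "(r, s) \<in> listed_types p u w"
  shows "jordan_osserman n (g_N p \<psi> u w) r s"
proof -
  have fd: "flat_dim (-1) = u" "flat_dim 1 = w" by (simp_all add: flat_dim_def)
  have "\<exists>k \<sigma>. \<sigma> \<in> {-1, 1 :: real} \<and> (flat_dim \<sigma> + 2 \<le> k \<or> flat_dim \<sigma> = 0 \<and> k = 1) \<and> k \<le> p + flat_dim \<sigma> \<and>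
    ((r, s) = (if \<sigma> = -1 then k else 0, if \<sigma> = -1 then 0 else k) \<or>
     (r, s) = (if \<sigma> = -1 then p + u - k else p + u, if \<sigma> = -1 then p + w else p + w - k))"
    using assms unfolding listed_types_def
  proof (elim UnE CollectE exE conjE)
    fix k assume "u = 0" "0 < k" "k \<le> p" "(r, s) = (k, 0) \<or> (r, s) = (p + u - k, p + w)"
    then show ?thesis by (intro exI[of _ k] exI[of _ "-1"]) (use fd in auto)
  next
    fix k assume "w = 0" "0 < k" "k \<le> p" "(r, s) = (0, k) \<or> (r, s) = (p + u, p + w - k)"
    then show ?thesis by (intro exI[of _ k] exI[of _ 1]) (use fd in auto)
  next
    fix k assume "u + 2 \<le> k" "k \<le> p + u" "(r, s) = (k, 0) \<or> (r, s) = (p + u - k, p + w)"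
    then show ?thesis by (intro exI[of _ k] exI[of _ "-1"]) (use fd in auto)
  next
    fix k assume "w + 2 \<le> k" "k \<le> p + w" "(r, s) = (0, k) \<or> (r, s) = (p + u, p + w - k)"
    then show ?thesis by (intro exI[of _ k] exI[of _ 1]) (use fd in auto)
  qed
  then obtain k \<sigma> where \<sigma>: "\<sigma> \<in> {-1, 1 :: real}"
    and k: "flat_dim \<sigma> + 2 \<le> k \<or> flat_dim \<sigma> = 0 \<and> k = 1" "k \<le> p + flat_dim \<sigma>"
    and rs: "(r, s) = (if \<sigma> = -1 then k else 0, if \<sigma> = -1 then 0 else k) \<or>
     (r, s) = (if \<sigma> = -1 then p + u - k else p + u, if \<sigma> = -1 then p + w else p + w - k)"
    by blast
  from rs show ?thesis
  proof
    assume "(r, s) = (if \<sigma> = -1 then k else 0, if \<sigma> = -1 then 0 else k)"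
    then show ?thesis using jordan_osserman_definite[OF \<sigma> k(1)] by (simp only: prod.inject)
  next
    assume "(r, s) = (if \<sigma> = -1 then p + u - k else p + u, if \<sigma> = -1 then p + w else p + w - k)"
    then show ?thesis using jordan_osserman_codefinite[OF \<sigma> k] by (simp only: prod.inject)
  qed
qed

text \<open>A type outside the list is definite, the complement of a definite type, or has \<open>0 < r < p + u\<close> and
  \<open>0 < s < p + w\<close>.\<close>

lemma not_jordan_osserman_unlisted:
  assumes ad: "admissible (p + u) (p + w) r s" and nl: "(r, s) \<notin> listed_types p u w"
  shows "\<not> jordan_osserman n (g_N p \<psi> u w) r s"
proof -
  have bounds: "r \<le> p + u" "s \<le> p + w" "1 \<le> r + s" "r + s \<le> (p + u) + (p + w) - 1"
    using ad by (auto simp: admissible_def)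
  have tl: "u > 0 \<and> k \<le> u + 1" if "1 \<le> k" "k \<le> p + u" "(r, s) = (k, 0) \<or> (r, s) = (p + u - k, p + w)" for k
  proof (rule ccontr)
    assume "\<not> (u > 0 \<and> k \<le> u + 1)"
    then have "u = 0 \<or> u > 0 \<and> u + 2 \<le> k" by linarith
    then have "(r, s) \<in> listed_types p u w"
    proof
      assume "u = 0"
      then have "\<exists>k. u = 0 \<and> 0 < k \<and> k \<le> p \<and> ((r, s) = (k, 0) \<or> (r, s) = (p + u - k, p + w))"
        using that by (intro exI[of _ k]) simp
      then show ?thesis unfolding listed_types_def by blast
    next
      assume "u > 0 \<and> u + 2 \<le> k"
      then have "\<exists>k. u > 0 \<and> u + 2 \<le> k \<and> k \<le> p + u \<and> ((r, s) = (k, 0) \<or> (r, s) = (p + u - k, p + w))"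
        using that by (intro exI[of _ k]) simp
      then show ?thesis unfolding listed_types_def by blast
    qed
    then show False using nl by blast
  qed
  have sl: "w > 0 \<and> k \<le> w + 1" if "1 \<le> k" "k \<le> p + w" "(r, s) = (0, k) \<or> (r, s) = (p + u, p + w - k)" for k
  proof (rule ccontr)
    assume "\<not> (w > 0 \<and> k \<le> w + 1)"
    then have "w = 0 \<or> w > 0 \<and> w + 2 \<le> k" by linarith
    then have "(r, s) \<in> listed_types p u w"
    proof
      assume "w = 0"
      then have "\<exists>k. w = 0 \<and> 0 < k \<and> k \<le> p \<and> ((r, s) = (0, k) \<or> (r, s) = (p + u, p + w - k))"
        using that by (intro exI[of _ k]) simp
      then show ?thesis unfolding listed_types_def by blast
    next
      assume "w > 0 \<and> w + 2 \<le> k"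
      then have "\<exists>k. w > 0 \<and> w + 2 \<le> k \<and> k \<le> p + w \<and> ((r, s) = (0, k) \<or> (r, s) = (p + u, p + w - k))"
        using that by (intro exI[of _ k]) simp
      then show ?thesis unfolding listed_types_def by blast
    qed
    then show False using nl by blast
  qed
  consider "r = 0" | "s = 0" | "r = p + u" | "s = p + w" | "1 \<le> r" "r \<le> p + u - 1" "1 \<le> s" "s \<le> p + w - 1"
    using bounds by linarith
  then show ?thesis
  proof cases
    case 1
    then show ?thesis using sl[of s] not_jordan_spacelike[of s] bounds by auto
  next
    case 2
    then show ?thesis using tl[of r] not_jordan_timelike[of r] bounds by auto
  next
    case 3
    then have "1 \<le> p + w - s" "p + w - s \<le> p + w" "s = p + w - (p + w - s)" using bounds p2 by auto
    then show ?thesis using sl[of "p + w - s"] not_jordan_cospacelike[of "p + w - s"] 3 by auto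
  next
    case 4
    then have "1 \<le> p + u - r" "p + u - r \<le> p + u" "r = p + u - (p + u - r)" using bounds p2 by auto
    then show ?thesis using tl[of "p + u - r"] not_jordan_cotimelike[of "p + u - r"] 4 by auto
  next
    case 5
    then show ?thesis using not_jordan_mixed by blast
  qed
qed

end

end

theorem theorem1p7:
  fixes p u v :: nat and \<psi> :: metric
  assumes "p \<ge> 2"
    and "smooth_symmetric_tensor p \<psi>"
  shows "(\<forall>k. 1 \<le> k \<and> k \<le> (p + u) + (p + v) - 1 \<longrightarrow>
            k_osserman (p + u) (p + v) (g_N p \<psi> u v) k) \<and>
         (\<psi> \<in> Psi p \<longrightarrow>
            (\<forall>(r, s) \<in> listed_types p u v.
               jordan_osserman ((p + u) + (p + v)) (g_N p \<psi> u v) r s) \<and>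
            (\<forall>r s. admissible (p + u) (p + v) r s \<and> (r, s) \<notin> listed_types p u v \<longrightarrow>
               \<not> jordan_osserman ((p + u) + (p + v)) (g_N p \<psi> u v) r s))"
proof -
  have dim: "(p + u) + (p + v) = 2 * p + (u + v)" by simp
  have "k_osserman (p + u) (p + v) (g_N p \<psi> u v) k" for k
    unfolding k_osserman_def dim using osserman_g_N[OF assms(2)] by blast
  moreover have "jordan_osserman ((p + u) + (p + v)) (g_N p \<psi> u v) r s"
    if "\<psi> \<in> Psi p" "(r, s) \<in> listed_types p u v" for r s
    unfolding dim by (rule jordan_osserman_listed[OF that(1) assms(1) that(2)])
  moreover have "\<not> jordan_osserman ((p + u) + (p + v)) (g_N p \<psi> u v) r s"
    if "\<psi> \<in> Psi p" "admissible (p + u) (p + v) r s" "(r, s) \<notin> listed_types p u v" for r s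
    unfolding dim by (rule not_jordan_osserman_unlisted[OF that(1) assms(1) that(2,3)])
  ultimately show ?thesis by blast
qed

end
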